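(* Let $\mathcal G(\mathsf X,\mathsf A)$ be a directed graph with state nodes $\mathsf X=\{\mathsf x_1,\dots,\mathsf x_N\}$ and edge set $\mathsf A$ of edges $\mathsf x_i\to\mathsf x_j$ (self-loops allowed). (i) Any set obtained by arbitrarily choosing exactly one node in each root strongly connected component of $\mathcal G(\mathsf X,\mathsf A)$ is a minimal set of driver nodes (in the sense of structural accessibility). (ii) Any set obtained by arbitrarily choosing exactly one node in each top strongly connected component of $\mathcal G(\mathsf X,\mathsf A)$ is a minimal set of sensor nodes (in the sense of structural observability).
   Context: A strongly connected component (SCC) of a directed graph is a maximal subgraph such that there is a directed path in both directions between any two of its nodes. A root SCC is an SCC with no incoming edges from nodes outside it; a top SCC is an SCC with no outgoing edges to nodes outside it. Meromorphic functions here are quotients of real-analytic functions with denominator not identically zero; "$\not\equiv 0$" means not identically zero. Structural accessibility: let $\mathcal G(\mathsf X\cup\mathsf U,\mathsf A\cup\mathsf B)$ be a graph with input nodes $\mathsf U=\{\mathsf u_1,\dots,\mathsf u_M\}$ and $\mathsf B$ consisting of edges $\mathsf u_i\to\mathsf x_j$. It is structurally accessible if there exists a meromorphic $f(x,u)$, $x\in\mathbb R^N,u\in\mathbb R^M$, with values in $\mathbb R^N$, such that $\partial f_i/\partial x_j\not\equiv0$ iff $\mathsf x_j\to\mathsf x_i\in\mathsf A$, $\partial f_i/\partial u_j\not\equiv0$ iff $\mathsf u_j\to\mathsf x_i\in\mathsf B$, and the system $\dot x=f(x,u)$ is accessible, i.e. has no autonomous element. An autonomous element is a non-constant meromorphic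 function $\xi(x)$ such that $\partial\xi^{(k)}/\partial u\equiv0$ for all $k\ge0$, where $\xi^{(0)}=\xi$ and $\dot\varphi=\frac{\partial\varphi}{\partial x}f(x,u)+\sum_{j\ge0}\frac{\partial\varphi}{\partial u^{(j)}}u^{(j+1)}$ is the time derivative along the system. Structural observability: let $\mathcal G(\mathsf X\cup\mathsf Y,\mathsf A\cup\mathsf C)$ be a graph with output nodes $\mathsf Y=\{\mathsf y_1,\dots,\mathsf y_P\}$ and $\mathsf C$ consisting of edges $\mathsf x_i\to\mathsf y_j$. It is structurally observable if there exist meromorphic $f(x)$ with values in $\mathbb R^N$ and $h(x)$ with values in $\mathbb R^P$ such that $\partial f_i/\partial x_j\not\equiv0$ iff $\mathsf x_j\to\mathsf x_i\in\mathsf A$, $\partial h_i/\partial x_j\not\equiv0$ iff $\mathsf x_j\to\mathsf y_i\in\mathsf C$, and the system $\dot x=f(x)$, $y=h(x)$ is observable, i.e. has no hidden element. A hidden element is a non-constant meromorphic function $\zeta(x)$ such that $\mathrm d\zeta\notin\operatorname{span}_{\mathcal K}\{\mathrm dy,\mathrm d\dot y,\dots,\mathrm dy^{(k)}\}$ for all $k\ge0$, where $\mathcal K$ is the field of meromorphic functions of $x$, and $y^{(k)}$ is the $k$-th time derivative of $y=h(x)$ along $\dot x=f(x)$. Driver nodes: $\mathsf X_D\subseteq\mathsf X$ is a set of driver nodes if there exist a set $\mathsf U$ of input nodes and a set $\mathsf B$ of edges of the form $\mathsf u_i\to\mathsf x_j$ such that $\mathcal G(\mathsf X\cup\mathsf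 U,\mathsf A\cup\mathsf B)$ is structurally accessible and all and only the nodes in $\mathsf X_D$ have incoming edges from input nodes. Sensor nodes: $\mathsf X_S\subseteq\mathsf X$ is a set of sensor nodes if there exist a set $\mathsf Y$ of output nodes and a set $\mathsf C$ of edges of the form $\mathsf x_i\to\mathsf y_j$ such that $\mathcal G(\mathsf X\cup\mathsf Y,\mathsf A\cup\mathsf C)$ is structurally observable and all and only the nodes in $\mathsf X_S$ have outgoing edges to output nodes. A set of driver (sensor) nodes is minimal if it has minimal cardinality among all sets of driver (sensor) nodes. *)

theory Defs
  imports "HOL-Analysis.Analysis" "Graph_Theory.Graph_Theory"
begin

section \<open>Real-analytic and meromorphic functions of finitely many variables\<close>

text \<open>
  A point assigns a real value to every variable of a (possibly infinite) type \<open>'v\<close> of variables.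
  \<open>analytic_in S f\<close> means that \<open>f\<close> is a real-analytic function on all of the space of the
  variables in the finite set \<open>S\<close>: around every point it is the sum of an (unconditionally
  convergent) power series in these variables. The multi-indices are the extensional functions
  \<open>S \<rightarrow>\<^sub>E UNIV\<close>. Because the neighbourhood of \<open>a\<close> only restricts the coordinates in
  \<open>S\<close>, the function cannot depend on any other coordinate (lemma \<open>analytic_in_cong\<close>).
\<close>

definition analytic_in :: "'v set \<Rightarrow> (('v \<Rightarrow> real) \<Rightarrow> real) \<Rightarrow> bool" where
  "analytic_in S f \<longleftrightarrow> finite S \<and>
     (\<forall>a. \<exists>r>0. \<exists>c :: ('v \<Rightarrow> nat) \<Rightarrow> real. \<forall>v. (\<forall>i\<in>S. \<bar>v i - a i\<bar> < r) \<longrightarrow>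
        ((\<lambda>\<alpha>. c \<alpha> * (\<Prod>i\<in>S. (v i - a i) ^ \<alpha> i)) has_sum f v) (S \<rightarrow>\<^sub>E UNIV))"

lemma analytic_in_cong:
  assumes "analytic_in S f" and eq: "\<And>i. i \<in> S \<Longrightarrow> v i = a i"
  shows "f v = f a"
proof -
  have "\<exists>r>0. \<exists>c :: ('a \<Rightarrow> nat) \<Rightarrow> real. \<forall>v. (\<forall>i\<in>S. \<bar>v i - a i\<bar> < r) \<longrightarrow>
        ((\<lambda>\<alpha>. c \<alpha> * (\<Prod>i\<in>S. (v i - a i) ^ \<alpha> i)) has_sum f v) (S \<rightarrow>\<^sub>E UNIV)"
    using assms(1) unfolding analytic_in_def by (elim conjE) (erule spec)
  then obtain r :: real and c :: "('a \<Rightarrow> nat) \<Rightarrow> real" where r: "r > 0"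
    and c: "\<forall>v. (\<forall>i\<in>S. \<bar>v i - a i\<bar> < r) \<longrightarrow>
        ((\<lambda>\<alpha>. c \<alpha> * (\<Prod>i\<in>S. (v i - a i) ^ \<alpha> i)) has_sum f v) (S \<rightarrow>\<^sub>E UNIV)"
    by (elim exE conjE)
  have *: "(\<Prod>i\<in>S. (v i - a i) ^ \<alpha> i) = (\<Prod>i\<in>S. (a i - a i) ^ \<alpha> i)" for \<alpha> :: "'a \<Rightarrow> nat"
    by (rule prod.cong) (simp_all add: eq)
  have "((\<lambda>\<alpha>. c \<alpha> * (\<Prod>i\<in>S. (a i - a i) ^ \<alpha> i)) has_sum f v) (S \<rightarrow>\<^sub>E UNIV)"
    unfolding *[symmetric] by (rule c[THEN spec, THEN mp]) (simp add: eq r)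
  moreover have "((\<lambda>\<alpha>. c \<alpha> * (\<Prod>i\<in>S. (a i - a i) ^ \<alpha> i)) has_sum f a) (S \<rightarrow>\<^sub>E UNIV)"
    by (rule c[THEN spec, THEN mp]) (simp add: r)
  ultimately show ?thesis
    by (rule has_sum_unique)
qed

text \<open>
  A quotient \<open>p / q\<close> of analytic functions is only defined where \<open>q\<close> does not vanish. It is
  represented by any total function that agrees with \<open>p / q\<close> there; the remaining values are
  irrelevant. Accordingly, identities between meromorphic functions are understood off the zero
  set of some analytic function that is not identically zero, which is expressed by
  \<open>generically\<close>. Two meromorphic functions are the same element of the field of meromorphic
  functions iff they agree generically, and a meromorphic function is identically zero iff it
  vanishes generically.
\<close>

definition meromorphic_in :: "'v set \<Rightarrow> (('v \<Rightarrow> real) \<Rightarrow> real) \<Rightarrow> bool" where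
  "meromorphic_in S f \<longleftrightarrow> (\<exists>p q. analytic_in S p \<and> analytic_in S q \<and>
     (\<exists>v. q v \<noteq> 0) \<and> (\<forall>v. q v \<noteq> 0 \<longrightarrow> f v = p v / q v))"

definition generically :: "(('v \<Rightarrow> real) \<Rightarrow> bool) \<Rightarrow> bool" where
  "generically P \<longleftrightarrow> (\<exists>S q. analytic_in S q \<and> (\<exists>v. q v \<noteq> 0) \<and> (\<forall>v. q v \<noteq> 0 \<longrightarrow> P v))"

definition identically_zero :: "(('v \<Rightarrow> real) \<Rightarrow> real) \<Rightarrow> bool" where
  "identically_zero f \<longleftrightarrow> generically (\<lambda>v. f v = 0)"

definition nonconstant :: "(('v \<Rightarrow> real) \<Rightarrow> real) \<Rightarrow> bool" where
  "nonconstant f \<longleftrightarrow> \<not> (\<exists>c. generically (\<lambda>v. f v = c))"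

text \<open>
  Where the denominator of a meromorphic function does not vanish, \<open>pderivative\<close> is its actual
  partial derivative.
\<close>

definition pderivative :: "'v \<Rightarrow> (('v \<Rightarrow> real) \<Rightarrow> real) \<Rightarrow> ('v \<Rightarrow> real) \<Rightarrow> real" where
  "pderivative i f v = deriv (\<lambda>t. f (v(i := t))) (v i)"


section \<open>Structural accessibility\<close>

text \<open>
  \<open>Input j k\<close> is the \<open>k\<close>-th time derivative of the \<open>j\<close>-th input, so that \<open>Input j 0\<close> is
  the input itself. The states are indexed by the vertices of the graph.
\<close>

datatype 'a sys_var = State 'a | Input nat nat

text \<open>
  The time derivative along \<open>x' = f(x,u)\<close> with inputs \<open>1..M\<close>. A meromorphic function depends on
  finitely many variables, so generically the series has only finitely many nonzero terms.
\<close>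

definition time_derivative ::
  "'a set \<Rightarrow> nat \<Rightarrow> ('a \<Rightarrow> ('a sys_var \<Rightarrow> real) \<Rightarrow> real) \<Rightarrow>
     (('a sys_var \<Rightarrow> real) \<Rightarrow> real) \<Rightarrow> ('a sys_var \<Rightarrow> real) \<Rightarrow> real" where
  "time_derivative X M f \<phi> v =
     (\<Sum>i\<in>X. pderivative (State i) \<phi> v * f i v) +
     (\<Sum>j=1..M. \<Sum>k. pderivative (Input j k) \<phi> v * v (Input j (Suc k)))"

definition autonomous_element ::
  "'a set \<Rightarrow> nat \<Rightarrow> ('a \<Rightarrow> ('a sys_var \<Rightarrow> real) \<Rightarrow> real) \<Rightarrow>
     (('a sys_var \<Rightarrow> real) \<Rightarrow> real) \<Rightarrow> bool" where
  "autonomous_element X M f \<xi> \<longleftrightarrow>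
     meromorphic_in (State ` X) \<xi> \<and> nonconstant \<xi> \<and>
     (\<forall>k. \<forall>j\<in>{1..M}. identically_zero (pderivative (Input j 0) ((time_derivative X M f ^^ k) \<xi>)))"

definition accessible ::
  "'a set \<Rightarrow> nat \<Rightarrow> ('a \<Rightarrow> ('a sys_var \<Rightarrow> real) \<Rightarrow> real) \<Rightarrow> bool" where
  "accessible X M f \<longleftrightarrow> \<not> (\<exists>\<xi>. autonomous_element X M f \<xi>)"

text \<open>
  The graph \<open>G\<close> extended by the input nodes \<open>1..M\<close> and by the edges \<open>B\<close>, where \<open>(j, i) \<in> B\<close>
  is the edge from the \<open>j\<close>-th input to the state node \<open>i\<close>.
\<close>

definition structurally_accessible :: "'a pair_pre_digraph \<Rightarrow> nat \<Rightarrow> (nat \<times> 'a) set \<Rightarrow> bool" where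
  "structurally_accessible G M B \<longleftrightarrow>
     (\<exists>f :: 'a \<Rightarrow> ('a sys_var \<Rightarrow> real) \<Rightarrow> real.
        (\<forall>i\<in>pverts G. meromorphic_in (State ` pverts G \<union> (\<lambda>j. Input j 0) ` {1..M}) (f i)) \<and>
        (\<forall>i\<in>pverts G. \<forall>j\<in>pverts G.
           \<not> identically_zero (pderivative (State j) (f i)) \<longleftrightarrow> (j, i) \<in> parcs G) \<and>
        (\<forall>i\<in>pverts G. \<forall>j\<in>{1..M}.
           \<not> identically_zero (pderivative (Input j 0) (f i)) \<longleftrightarrow> (j, i) \<in> B) \<and>
        accessible (pverts G) M f)"

definition driver_set :: "'a pair_pre_digraph \<Rightarrow> 'a set \<Rightarrow> bool" where
  "driver_set G D \<longleftrightarrow> D \<subseteq> pverts G \<and>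
     (\<exists>M B. B \<subseteq> {1..M} \<times> pverts G \<and> structurally_accessible G M B \<and>
        (\<forall>i\<in>pverts G. i \<in> D \<longleftrightarrow> (\<exists>j. (j, i) \<in> B)))"

definition minimal_driver_set :: "'a pair_pre_digraph \<Rightarrow> 'a set \<Rightarrow> bool" where
  "minimal_driver_set G D \<longleftrightarrow> driver_set G D \<and> (\<forall>D'. driver_set G D' \<longrightarrow> card D \<le> card D')"


section \<open>Structural observability\<close>

text \<open>There are no inputs here, so the variables are the state nodes themselves.\<close>

definition lie_derivative ::
  "'a set \<Rightarrow> ('a \<Rightarrow> ('a \<Rightarrow> real) \<Rightarrow> real) \<Rightarrow> (('a \<Rightarrow> real) \<Rightarrow> real) \<Rightarrow> ('a \<Rightarrow> real) \<Rightarrow> real" where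
  "lie_derivative X f \<phi> x = (\<Sum>i\<in>X. pderivative i \<phi> x * f i x)"

text \<open>
  \<open>d\<zeta> \<in> span {dy, dy', \<dots>, dy\<^sup>(\<^sup>k\<^sup>)}\<close> over the field of meromorphic functions of the state, for the
  output \<open>y = h(x)\<close> with components \<open>1..P\<close>. A differential is given by its coefficients with
  respect to the basis \<open>dx\<^sub>i\<close>, \<open>i \<in> X\<close>, which are the partial derivatives.
\<close>

definition in_output_span ::
  "'a set \<Rightarrow> nat \<Rightarrow> ('a \<Rightarrow> ('a \<Rightarrow> real) \<Rightarrow> real) \<Rightarrow> (nat \<Rightarrow> ('a \<Rightarrow> real) \<Rightarrow> real) \<Rightarrow> nat \<Rightarrow>
     (('a \<Rightarrow> real) \<Rightarrow> real) \<Rightarrow> bool" where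
  "in_output_span X P f h k \<zeta> \<longleftrightarrow>
     (\<exists>c :: nat \<Rightarrow> nat \<Rightarrow> ('a \<Rightarrow> real) \<Rightarrow> real.
        (\<forall>j\<in>{1..P}. \<forall>l\<le>k. meromorphic_in X (c j l)) \<and>
        (\<forall>i\<in>X. generically (\<lambda>x. pderivative i \<zeta> x =
           (\<Sum>j=1..P. \<Sum>l\<le>k. c j l x * pderivative i ((lie_derivative X f ^^ l) (h j)) x))))"

definition hidden_element ::
  "'a set \<Rightarrow> nat \<Rightarrow> ('a \<Rightarrow> ('a \<Rightarrow> real) \<Rightarrow> real) \<Rightarrow> (nat \<Rightarrow> ('a \<Rightarrow> real) \<Rightarrow> real) \<Rightarrow>
     (('a \<Rightarrow> real) \<Rightarrow> real) \<Rightarrow> bool" where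
  "hidden_element X P f h \<zeta> \<longleftrightarrow>
     meromorphic_in X \<zeta> \<and> nonconstant \<zeta> \<and> (\<forall>k. \<not> in_output_span X P f h k \<zeta>)"

definition observable ::
  "'a set \<Rightarrow> nat \<Rightarrow> ('a \<Rightarrow> ('a \<Rightarrow> real) \<Rightarrow> real) \<Rightarrow> (nat \<Rightarrow> ('a \<Rightarrow> real) \<Rightarrow> real) \<Rightarrow> bool" where
  "observable X P f h \<longleftrightarrow> \<not> (\<exists>\<zeta>. hidden_element X P f h \<zeta>)"

text \<open>
  The graph \<open>G\<close> extended by the output nodes \<open>1..P\<close> and by the edges \<open>C\<close>, where \<open>(i, j) \<in> C\<close>
  is the edge from the state node \<open>i\<close> to the \<open>j\<close>-th output.
\<close>

definition structurally_observable :: "'a pair_pre_digraph \<Rightarrow> nat \<Rightarrow> ('a \<times> nat) set \<Rightarrow> bool" where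
  "structurally_observable G P C \<longleftrightarrow>
     (\<exists>(f :: 'a \<Rightarrow> ('a \<Rightarrow> real) \<Rightarrow> real) (h :: nat \<Rightarrow> ('a \<Rightarrow> real) \<Rightarrow> real).
        (\<forall>i\<in>pverts G. meromorphic_in (pverts G) (f i)) \<and>
        (\<forall>j\<in>{1..P}. meromorphic_in (pverts G) (h j)) \<and>
        (\<forall>i\<in>pverts G. \<forall>j\<in>pverts G.
           \<not> identically_zero (pderivative j (f i)) \<longleftrightarrow> (j, i) \<in> parcs G) \<and>
        (\<forall>j\<in>{1..P}. \<forall>i\<in>pverts G.
           \<not> identically_zero (pderivative i (h j)) \<longleftrightarrow> (i, j) \<in> C) \<and>
        observable (pverts G) P f h)"

definition sensor_set :: "'a pair_pre_digraph \<Rightarrow> 'a set \<Rightarrow> bool" where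
  "sensor_set G D \<longleftrightarrow> D \<subseteq> pverts G \<and>
     (\<exists>P C. C \<subseteq> pverts G \<times> {1..P} \<and> structurally_observable G P C \<and>
        (\<forall>i\<in>pverts G. i \<in> D \<longleftrightarrow> (\<exists>j. (i, j) \<in> C)))"

definition minimal_sensor_set :: "'a pair_pre_digraph \<Rightarrow> 'a set \<Rightarrow> bool" where
  "minimal_sensor_set G D \<longleftrightarrow> sensor_set G D \<and> (\<forall>D'. sensor_set G D' \<longrightarrow> card D \<le> card D')"


section \<open>Root and top strongly connected components\<close>

definition root_sccs :: "'a pair_pre_digraph \<Rightarrow> ('a, 'a \<times> 'a) pre_digraph set" where
  "root_sccs G = {H \<in> pre_digraph.sccs (with_proj G).
     \<not> (\<exists>(u, v)\<in>parcs G. u \<notin> verts H \<and> v \<in> verts H)}"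

definition top_sccs :: "'a pair_pre_digraph \<Rightarrow> ('a, 'a \<times> 'a) pre_digraph set" where
  "top_sccs G = {H \<in> pre_digraph.sccs (with_proj G).
     \<not> (\<exists>(u, v)\<in>parcs G. u \<in> verts H \<and> v \<notin> verts H)}"

end

theory Submission
  imports Defs "HOL-Complex_Analysis.Cauchy_Integral_Formula"
    "HOL-Computational_Algebra.Formal_Power_Series"
begin

text \<open>
  If no node of a root component is driven, every coordinate function of that component is an
  autonomous element; if no node of a top component is sensed, every coordinate function of that
  component is a hidden element. Since the components are disjoint, this bounds the number of
  driver and sensor nodes from below.

  Conversely, one polynomial vector field serves for both parts: with an enumeration \<open>idx\<close> of the
  \<open>N\<close> nodes, an edge from \<open>j\<close> to \<open>i\<close> contributes \<open>x\<^sub>j ^ n\<^sub>j\<^sub>i\<close> with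
  \<open>n\<^sub>j\<^sub>i = N + idx j - idx i\<close> to \<open>f\<^sub>i\<close>, and each \<open>f\<^sub>i\<close> has the constant term \<open>1\<close>.

  For accessibility, consider the nodes on which no time derivative of an autonomous element
  depends. They contain the driver nodes. They are closed under edges: if no derivative depends
  on \<open>x\<^sub>j\<close>, then differentiating the derivative of the next order with respect to \<open>x\<^sub>j\<close> yields a
  relation between distinct powers of \<open>x\<^sub>j\<close> with coefficients independent of \<open>x\<^sub>j\<close>. So the element is constant.

  For observability, the trajectory through the origin has components \<open>t + \<dots>\<close> with nonnegative
  coefficients, so the sensitivity of an output node with respect to the initial value of a node
  \<open>i\<close> vanishes at time 0 to the order of the least sum of exponents along a path from \<open>i\<close>. Modulo \<open>N\<close> such a
  sum telescopes and determines \<open>i\<close>. Hence the differentials of the output derivatives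
  span everything at the origin, and therefore generically.
\<close>

text \<open>Linear interactions would not do. Two nodes fed linearly by the same node alone move in
  proportion up to known drifts, so a combination of them is autonomous; dually, two source nodes
  feeding one sensed node linearly are seen only through a fixed combination. Accessibility
  therefore asks for distinct exponents on the edges leaving a node, observability for distinct
  orders at an output. Both follow from \<open>n j i = N + idx j - idx i\<close>: it is injective in
  \<open>i\<close>, and along a path only the end points survive modulo \<open>N\<close>. The
  summand \<open>N\<close> keeps the exponents positive without disturbing the residue.

  The constant term \<open>1\<close> makes all coordinates leave the origin with speed 1, so that
  the \<open>m\<close>-th power of a coordinate has order exactly \<open>m\<close>; at rest in the
  origin the higher powers would hide every sensitivity. As all coefficients are nonnegative,
  contributions of different paths cannot cancel. The trajectory is a formal series of iterated Lie
  derivatives, so no differential equation is solved.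

  The analytic groundwork serves one purpose: that generic identities may be combined,
  differentiated and, for analytic functions, evaluated at chosen points.\<close>

section \<open>Analytic functions\<close>

text \<open>
  Unlike the extensional functions in \<open>analytic_in\<close>, these multi-indices vanish outside \<open>S\<close>, so that
  they can be added pointwise and compared for different \<open>S\<close>.
\<close>

definition multi_indices :: "'v set \<Rightarrow> ('v \<Rightarrow> nat) set" where
  "multi_indices S = {\<alpha>. \<forall>i. i \<notin> S \<longrightarrow> \<alpha> i = 0}"

definition power_series ::
  "'v set \<Rightarrow> ('v \<Rightarrow> real) \<Rightarrow> real \<Rightarrow> (('v \<Rightarrow> nat) \<Rightarrow> real) \<Rightarrow> (('v \<Rightarrow> real) \<Rightarrow> real) \<Rightarrow> bool" where
  "power_series S a r c f \<longleftrightarrow> (\<forall>v. (\<forall>i\<in>S. \<bar>v i - a i\<bar> < r) \<longrightarrow>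
     ((\<lambda>\<alpha>. c \<alpha> * (\<Prod>i\<in>S. (v i - a i) ^ \<alpha> i)) has_sum f v) (multi_indices S))"

lemma bij_betw_multi_indices:
  "bij_betw (\<lambda>\<alpha> i. if i \<in> S then \<alpha> i else 0) (S \<rightarrow>\<^sub>E (UNIV :: nat set)) (multi_indices S)"
proof (rule bij_betwI[where g = "\<lambda>\<alpha>. restrict \<alpha> S"])
  show "(\<lambda>\<alpha> i. if i \<in> S then \<alpha> i else 0) \<in> (S \<rightarrow>\<^sub>E (UNIV :: nat set)) \<rightarrow> multi_indices S"
    by (auto simp: multi_indices_def)
  show "(\<lambda>\<alpha>. restrict \<alpha> S) \<in> multi_indices S \<rightarrow> (S \<rightarrow>\<^sub>E UNIV)" by auto
  show "restrict (\<lambda>i. if i \<in> S then \<alpha> i else 0) S = \<alpha>" if "\<alpha> \<in> S \<rightarrow>\<^sub>E UNIV" for \<alpha> :: "'a \<Rightarrow> nat"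
    using that by (auto simp: restrict_def PiE_def extensional_def)
  show "(\<lambda>i. if i \<in> S then restrict \<alpha> S i else 0) = \<alpha>" if "\<alpha> \<in> multi_indices S" for \<alpha>
    using that by (auto simp: multi_indices_def)
qed

lemma has_sum_multi_indices:
  fixes c :: "('v \<Rightarrow> nat) \<Rightarrow> real"
  shows "((\<lambda>\<alpha>. c (restrict \<alpha> S) * (\<Prod>i\<in>S. x i ^ \<alpha> i)) has_sum s) (multi_indices S) \<longleftrightarrow>
         ((\<lambda>\<alpha>. c \<alpha> * (\<Prod>i\<in>S. x i ^ \<alpha> i)) has_sum s) (S \<rightarrow>\<^sub>E UNIV)"
proof -
  have "((\<lambda>\<alpha>. c \<alpha> * (\<Prod>i\<in>S. x i ^ \<alpha> i)) has_sum s) (S \<rightarrow>\<^sub>E UNIV) \<longleftrightarrow>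
    ((\<lambda>\<alpha>. c (restrict (\<lambda>i. if i \<in> S then \<alpha> i else 0) S)
        * (\<Prod>i\<in>S. x i ^ (if i \<in> S then \<alpha> i else 0))) has_sum s) (S \<rightarrow>\<^sub>E UNIV)"
  proof (rule has_sum_cong)
    fix \<alpha> :: "'v \<Rightarrow> nat" assume \<alpha>: "\<alpha> \<in> S \<rightarrow>\<^sub>E UNIV"
    then have "restrict (\<lambda>i. if i \<in> S then \<alpha> i else 0) S = \<alpha>"
      by (auto simp: restrict_def PiE_def extensional_def)
    moreover have "(\<Prod>i\<in>S. x i ^ (if i \<in> S then \<alpha> i else 0)) = (\<Prod>i\<in>S. x i ^ \<alpha> i)"
      by (rule prod.cong) auto
    ultimately show "c \<alpha> * (\<Prod>i\<in>S. x i ^ \<alpha> i) = c (restrict (\<lambda>i. if i \<in> S then \<alpha> i else 0) S)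
        * (\<Prod>i\<in>S. x i ^ (if i \<in> S then \<alpha> i else 0))" by simp
  qed
  also have "\<dots> \<longleftrightarrow> ((\<lambda>\<alpha>. c (restrict \<alpha> S) * (\<Prod>i\<in>S. x i ^ \<alpha> i)) has_sum s) (multi_indices S)"
    by (rule has_sum_reindex_bij_betw[OF bij_betw_multi_indices,
          where f = "\<lambda>\<alpha>. c (restrict \<alpha> S) * (\<Prod>i\<in>S. x i ^ \<alpha> i)"])
  finally show ?thesis by simp
qed

lemma has_sum_multi_indices':
  fixes c :: "('v \<Rightarrow> nat) \<Rightarrow> real"
  shows "((\<lambda>\<alpha>. c (\<lambda>i. if i \<in> S then \<alpha> i else 0) * (\<Prod>i\<in>S. x i ^ \<alpha> i)) has_sum s) (S \<rightarrow>\<^sub>E UNIV) \<longleftrightarrow>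
         ((\<lambda>\<alpha>. c \<alpha> * (\<Prod>i\<in>S. x i ^ \<alpha> i)) has_sum s) (multi_indices S)"
proof -
  have "((\<lambda>\<alpha>. c (\<lambda>i. if i \<in> S then restrict \<alpha> S i else 0) * (\<Prod>i\<in>S. x i ^ \<alpha> i)) has_sum s) (multi_indices S)
     \<longleftrightarrow> ((\<lambda>\<alpha>. c \<alpha> * (\<Prod>i\<in>S. x i ^ \<alpha> i)) has_sum s) (multi_indices S)"
  proof (rule has_sum_cong)
    fix \<alpha> :: "'v \<Rightarrow> nat" assume "\<alpha> \<in> multi_indices S"
    then have "(\<lambda>i. if i \<in> S then restrict \<alpha> S i else 0) = \<alpha>"
      by (auto simp: multi_indices_def)
    then show "c (\<lambda>i. if i \<in> S then restrict \<alpha> S i else 0) * (\<Prod>i\<in>S. x i ^ \<alpha> i) =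
      c \<alpha> * (\<Prod>i\<in>S. x i ^ \<alpha> i)" by simp
  qed
  then show ?thesis
    using has_sum_multi_indices[of "\<lambda>\<alpha>. c (\<lambda>i. if i \<in> S then \<alpha> i else 0)" S x s] by simp
qed

lemma analytic_in_iff:
  "analytic_in S f \<longleftrightarrow> finite S \<and> (\<forall>a. \<exists>r>0. \<exists>c. power_series S a r c f)"
proof -
  have "(\<exists>c. power_series S a r c f) \<longleftrightarrow>
    (\<exists>c :: ('a \<Rightarrow> nat) \<Rightarrow> real. \<forall>v. (\<forall>i\<in>S. \<bar>v i - a i\<bar> < r) \<longrightarrow>
        ((\<lambda>\<alpha>. c \<alpha> * (\<Prod>i\<in>S. (v i - a i) ^ \<alpha> i)) has_sum f v) (S \<rightarrow>\<^sub>E UNIV))" for a r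
  proof
    assume "\<exists>c. power_series S a r c f"
    then obtain c where "power_series S a r c f" by blast
    then have "((\<lambda>\<alpha>. c (\<lambda>i. if i \<in> S then \<alpha> i else 0) * (\<Prod>i\<in>S. (v i - a i) ^ \<alpha> i)) has_sum f v)
        (S \<rightarrow>\<^sub>E UNIV)" if "\<forall>i\<in>S. \<bar>v i - a i\<bar> < r" for v
      unfolding has_sum_multi_indices'[where c=c and x="\<lambda>i. v i - a i"]
      using that by (simp add: power_series_def)
    then show "\<exists>c. \<forall>v. (\<forall>i\<in>S. \<bar>v i - a i\<bar> < r) \<longrightarrow>
        ((\<lambda>\<alpha>. c \<alpha> * (\<Prod>i\<in>S. (v i - a i) ^ \<alpha> i)) has_sum f v) (S \<rightarrow>\<^sub>E UNIV)"
      by (intro exI[of _ "\<lambda>\<alpha>. c (\<lambda>i. if i \<in> S then \<alpha> i else 0)"]) simp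
  next
    assume "\<exists>c. \<forall>v. (\<forall>i\<in>S. \<bar>v i - a i\<bar> < r) \<longrightarrow>
        ((\<lambda>\<alpha>. c \<alpha> * (\<Prod>i\<in>S. (v i - a i) ^ \<alpha> i)) has_sum f v) (S \<rightarrow>\<^sub>E UNIV)"
    then obtain c where "\<forall>v. (\<forall>i\<in>S. \<bar>v i - a i\<bar> < r) \<longrightarrow>
        ((\<lambda>\<alpha>. c \<alpha> * (\<Prod>i\<in>S. (v i - a i) ^ \<alpha> i)) has_sum f v) (S \<rightarrow>\<^sub>E UNIV)" by blast
    then have "power_series S a r (\<lambda>\<alpha>. c (restrict \<alpha> S)) f"
      unfolding power_series_def
      using has_sum_multi_indices[where c=c and S=S and x="\<lambda>i. v i - a i" for v] by simp
    then show "\<exists>c. power_series S a r c f" by blast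
  qed
  then show ?thesis unfolding analytic_in_def by simp
qed

lemma power_series_mono_radius: "power_series S a r c f \<Longrightarrow> r' \<le> r \<Longrightarrow> power_series S a r' c f"
proof -
  assume *: "power_series S a r c f" "r' \<le> r"
  have "\<forall>i\<in>S. \<bar>v i - a i\<bar> < r" if "\<forall>i\<in>S. \<bar>v i - a i\<bar> < r'" for v
    using that *(2) by fastforce
  then show ?thesis using *(1) unfolding power_series_def by simp
qed

lemma power_series_add:
  "power_series S a r c f \<Longrightarrow> power_series S a r d g \<Longrightarrow>
   power_series S a r (\<lambda>\<alpha>. c \<alpha> + d \<alpha>) (\<lambda>v. f v + g v)"
  unfolding power_series_def by (simp add: distrib_right has_sum_add)

lemma analytic_in_common_radius:
  assumes "analytic_in S f" "analytic_in S g"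
  obtains r c d where "r > 0" "power_series S a r c f" "power_series S a r d g"
proof -
  obtain r1 c r2 d where "r1 > 0" "power_series S a r1 c f" "r2 > 0" "power_series S a r2 d g"
    using assms unfolding analytic_in_iff by metis
  then show thesis
    using that[of "min r1 r2" c d] power_series_mono_radius[of S a r1 c f "min r1 r2"]
      power_series_mono_radius[of S a r2 d g "min r1 r2"] by simp
qed

lemma analytic_in_add:
  assumes "analytic_in S f" "analytic_in S g"
  shows "analytic_in S (\<lambda>v. f v + g v)"
  unfolding analytic_in_iff
proof (intro conjI allI)
  show "finite S" using assms(1) by (simp add: analytic_in_def)
  fix a
  obtain r c d where "r > 0" "power_series S a r c f" "power_series S a r d g"
    by (rule analytic_in_common_radius[OF assms])
  then show "\<exists>r>0. \<exists>c. power_series S a r c (\<lambda>v. f v + g v)"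
    by (blast intro: power_series_add)
qed

text \<open>Serves the Cauchy product, where \<open>k\<close> adds multi-indices, and the
  restriction of a series to a line, where \<open>k\<close> is the total degree. In both cases the
  fibres are finite, so the inner sums are ordinary ones.\<close>

lemma has_sum_regroup:
  fixes f :: "'a \<Rightarrow> real"
  assumes f: "(f has_sum s) A" and k: "k ` A \<subseteq> B" and fin: "\<And>b. b \<in> B \<Longrightarrow> finite {a\<in>A. k a = b}"
  shows "((\<lambda>b. \<Sum>a | a \<in> A \<and> k a = b. f a) has_sum s) B"
proof (rule has_sum_SigmaD)
  have "bij_betw snd (SIGMA b:B. {a\<in>A. k a = b}) A"
    by (rule bij_betwI[where g="\<lambda>a. (k a, a)"]) (use k in auto)
  from has_sum_reindex_bij_betw[OF this, of f]
  show "((\<lambda>x. f (snd x)) has_sum s) (SIGMA b:B. {a\<in>A. k a = b})" using f by simp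
qed (use fin in auto)

lemma has_sum_times:
  fixes f :: "'a \<Rightarrow> real" and g :: "'b \<Rightarrow> real"
  assumes f: "(f has_sum s) A" and g: "(g has_sum t) B"
  shows "((\<lambda>(a, b). f a * g b) has_sum s * t) (A \<times> B)"
proof (rule has_sum_SigmaI)
  show "((\<lambda>b. case (a, b) of (a, b) \<Rightarrow> f a * g b) has_sum f a * t) B" for a
    using has_sum_cmult_right[OF g] by simp
  show "((\<lambda>a. f a * t) has_sum s * t) A" using has_sum_cmult_left[OF f] .
  \<comment> \<open>Unconditional summability of reals is absolute, and this passes from the factors
    to the family of products.\<close>
  have "(\<lambda>a. norm (f a)) summable_on A" "(\<lambda>b. norm (g b)) summable_on B"
    using has_sum_imp_summable[OF f] has_sum_imp_summable[OF g]
    by (simp_all add: summable_on_iff_abs_summable_on_real[THEN iffD1, unfolded real_norm_def])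
  then have "(\<lambda>(a, b). norm (f a) * norm (g b)) summable_on A \<times> B"
    by (intro summable_on_SigmaI[where g="\<lambda>a. norm (f a) * (\<Sum>\<^sub>\<infinity>b\<in>B. norm (g b))"])
      (simp_all add: has_sum_cmult_right summable_on_cmult_left)
  then have "(\<lambda>x. norm (case x of (a, b) \<Rightarrow> f a * g b)) summable_on A \<times> B"
    by (simp add: case_prod_unfold abs_mult)
  then show "(\<lambda>(a, b). f a * g b) summable_on A \<times> B"
    by (rule summable_on_iff_abs_summable_on_real[THEN iffD2])
qed

lemma finite_multi_indices_le:
  assumes "finite S" shows "finite {\<alpha> \<in> multi_indices S. \<forall>i\<in>S. \<alpha> i \<le> N i}"
proof -
  have "finite (PiE S (\<lambda>i. {..N i}))" using assms by (intro finite_PiE) auto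
  then have "finite ((\<lambda>\<alpha> i. if i \<in> S then \<alpha> i else 0) ` PiE S (\<lambda>i. {..N i}))" by (rule finite_imageI)
  moreover have "{\<alpha> \<in> multi_indices S. \<forall>i\<in>S. \<alpha> i \<le> N i} \<subseteq>
     (\<lambda>\<alpha> i. if i \<in> S then \<alpha> i else 0) ` PiE S (\<lambda>i. {..N i})"
  proof
    fix \<alpha> assume "\<alpha> \<in> {\<alpha> \<in> multi_indices S. \<forall>i\<in>S. \<alpha> i \<le> N i}"
    then show "\<alpha> \<in> (\<lambda>\<alpha> i. if i \<in> S then \<alpha> i else 0) ` PiE S (\<lambda>i. {..N i})"
      by (intro image_eqI[where x="restrict \<alpha> S"]) (auto simp: multi_indices_def)
  qed
  ultimately show ?thesis by (rule rev_finite_subset)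
qed

lemma power_series_mult:
  assumes S: "finite S" and f: "power_series S a r c f" and g: "power_series S a r d g"
  shows "power_series S a r
    (\<lambda>\<gamma>. \<Sum>(\<alpha>, \<beta>) | (\<alpha>, \<beta>) \<in> multi_indices S \<times> multi_indices S \<and> (\<lambda>i. \<alpha> i + \<beta> i) = \<gamma>. c \<alpha> * d \<beta>)
    (\<lambda>v. f v * g v)"
  unfolding power_series_def
proof (intro allI impI)
  fix v assume v: "\<forall>i\<in>S. \<bar>v i - a i\<bar> < r"
  let ?m = "\<lambda>\<alpha>. \<Prod>i\<in>S. (v i - a i) ^ \<alpha> i" and ?A = "multi_indices S \<times> multi_indices S"
  let ?k = "\<lambda>(\<alpha>, \<beta>) i. \<alpha> i + (\<beta> i :: nat)"
  have "((\<lambda>(\<alpha>, \<beta>). (c \<alpha> * ?m \<alpha>) * (d \<beta> * ?m \<beta>)) has_sum f v * g v) ?A"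
    using f g v unfolding power_series_def by (intro has_sum_times) auto
  then have "((\<lambda>\<gamma>. \<Sum>p | p \<in> ?A \<and> ?k p = \<gamma>. case p of (\<alpha>, \<beta>) \<Rightarrow> (c \<alpha> * ?m \<alpha>) * (d \<beta> * ?m \<beta>))
      has_sum f v * g v) (multi_indices S)"
  proof (rule has_sum_regroup)
    show "?k ` ?A \<subseteq> multi_indices S" by (auto simp: multi_indices_def)
    fix \<gamma>
    have "{p \<in> ?A. ?k p = \<gamma>} \<subseteq> {\<alpha> \<in> multi_indices S. \<forall>i\<in>S. \<alpha> i \<le> \<gamma> i} \<times> {\<alpha> \<in> multi_indices S. \<forall>i\<in>S. \<alpha> i \<le> \<gamma> i}"
      by auto
    then show "finite {p \<in> ?A. ?k p = \<gamma>}"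
      by (rule finite_subset) (intro finite_cartesian_product finite_multi_indices_le[OF S])
  qed
  moreover have "(\<Sum>p | p \<in> ?A \<and> ?k p = \<gamma>. case p of (\<alpha>, \<beta>) \<Rightarrow> (c \<alpha> * ?m \<alpha>) * (d \<beta> * ?m \<beta>)) =
    (\<Sum>(\<alpha>, \<beta>) | (\<alpha>, \<beta>) \<in> ?A \<and> (\<lambda>i. \<alpha> i + \<beta> i) = \<gamma>. c \<alpha> * d \<beta>) * ?m \<gamma>" for \<gamma>
    unfolding sum_distrib_right
    by (rule sum.cong) (auto simp: power_add prod.distrib mult_ac)
  ultimately show "((\<lambda>\<gamma>. (\<Sum>(\<alpha>, \<beta>) | (\<alpha>, \<beta>) \<in> ?A \<and> (\<lambda>i. \<alpha> i + \<beta> i) = \<gamma>. c \<alpha> * d \<beta>) * ?m \<gamma>)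
      has_sum f v * g v) (multi_indices S)"
    by simp
qed

lemma analytic_in_mult:
  assumes "analytic_in S f" "analytic_in S g"
  shows "analytic_in S (\<lambda>v. f v * g v)"
  unfolding analytic_in_iff
proof (intro conjI allI)
  show S: "finite S" using assms(1) by (simp add: analytic_in_def)
  fix a
  obtain r c d where "r > 0" "power_series S a r c f" "power_series S a r d g"
    by (rule analytic_in_common_radius[OF assms])
  then show "\<exists>r>0. \<exists>c. power_series S a r c (\<lambda>v. f v * g v)"
    by (blast intro: power_series_mult[OF S])
qed

lemma analytic_in_const [simp]:
  assumes "finite S" shows "analytic_in S (\<lambda>_. k)"
  unfolding analytic_in_iff
proof (intro conjI allI exI)
  fix a
  show "power_series S a 1 (\<lambda>\<alpha>. if \<alpha> = (\<lambda>_. 0) then k else 0) (\<lambda>_. k)"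
    unfolding power_series_def
    by (auto intro!: has_sum_finite_neutralI[of "{\<lambda>_. 0}"] simp: multi_indices_def split: if_splits)
qed (use assms in auto)

lemma analytic_in_coord:
  assumes "finite S" "k \<in> S" shows "analytic_in S (\<lambda>v. v k)"
  unfolding analytic_in_iff
proof (intro conjI allI exI)
  fix a
  let ?e = "(\<lambda>_. 0)(k := Suc 0)"
  show "power_series S a 1 (\<lambda>\<alpha>. if \<alpha> = (\<lambda>_. 0) then a k else if \<alpha> = ?e then 1 else 0) (\<lambda>v. v k)"
    unfolding power_series_def
  proof (intro allI impI has_sum_finite_neutralI[of "{\<lambda>_. 0, ?e}"])
    fix v
    have *: "(\<Prod>i\<in>S. (v i - a i) ^ (?e i)) = v k - a k"
      using assms by (subst prod.remove[of S k]) auto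
    have ne: "?e \<noteq> (\<lambda>_. 0)" by (metis fun_upd_same nat.distinct(1))
    show "v k = (\<Sum>\<alpha>\<in>{\<lambda>_. 0, ?e}. (if \<alpha> = (\<lambda>_. 0) then a k else if \<alpha> = ?e then 1 else 0) *
        (\<Prod>i\<in>S. (v i - a i) ^ \<alpha> i))"
      using ne * by (simp add: ne[symmetric])
  qed (use assms in \<open>auto simp: multi_indices_def\<close>)
qed (use assms in auto)

lemma analytic_in_mono:
  assumes f: "analytic_in S f" and "S \<subseteq> T" "finite T" shows "analytic_in T f"
  unfolding analytic_in_iff
proof (intro conjI allI)
  fix a
  obtain r c where r: "r > 0" and c: "power_series S a r c f" using f unfolding analytic_in_iff by blast
  have "power_series T a r (\<lambda>\<alpha>. if \<alpha> \<in> multi_indices S then c \<alpha> else 0) f"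
    unfolding power_series_def
  proof (intro allI impI)
    fix v assume v: "\<forall>i\<in>T. \<bar>v i - a i\<bar> < r"
    then have "((\<lambda>\<alpha>. c \<alpha> * (\<Prod>i\<in>S. (v i - a i) ^ \<alpha> i)) has_sum f v) (multi_indices S)"
      using c \<open>S \<subseteq> T\<close> unfolding power_series_def by blast
    moreover have "(\<Prod>i\<in>T. (v i - a i) ^ \<alpha> i) = (\<Prod>i\<in>S. (v i - a i) ^ \<alpha> i)"
      if "\<alpha> \<in> multi_indices S" for \<alpha>
      using that assms by (intro prod.mono_neutral_right) (auto simp: multi_indices_def)
    moreover have "multi_indices S \<subseteq> multi_indices T"
      using \<open>S \<subseteq> T\<close> by (auto simp: multi_indices_def)
    ultimately show "((\<lambda>\<alpha>. (if \<alpha> \<in> multi_indices S then c \<alpha> else 0) * (\<Prod>i\<in>T. (v i - a i) ^ \<alpha> i))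
       has_sum f v) (multi_indices T)"
      by (subst has_sum_cong_neutral[where T="multi_indices S" and g="\<lambda>\<alpha>. c \<alpha> * (\<Prod>i\<in>S. (v i - a i) ^ \<alpha> i)"]) auto
  qed
  with r show "\<exists>r>0. \<exists>c. power_series T a r c f" by blast
qed fact

section \<open>Majorants, continuity and termwise differentiation\<close>

text \<open>The series converges at the corner where every coordinate is displaced by
  \<open>\<rho>\<close>. There every monomial is a power of \<open>\<rho>\<close>, so absolute
  convergence yields a majorant for the whole box of radius \<open>\<rho>\<close>.\<close>

lemma power_series_summable:
  assumes "power_series S a r c f" "0 \<le> \<rho>" "\<rho> < r"
  shows "(\<lambda>\<alpha>. \<bar>c \<alpha>\<bar> * \<rho> ^ (\<Sum>i\<in>S. \<alpha> i)) summable_on multi_indices S"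
proof -
  have "((\<lambda>\<alpha>. c \<alpha> * (\<Prod>i\<in>S. ((a i + \<rho>) - a i) ^ \<alpha> i)) has_sum f (\<lambda>i. a i + \<rho>)) (multi_indices S)"
    by (rule assms(1)[unfolded power_series_def, rule_format]) (use assms in auto)
  then have "(\<lambda>\<alpha>. c \<alpha> * \<rho> ^ (\<Sum>i\<in>S. \<alpha> i)) summable_on multi_indices S"
    by (auto simp: power_sum dest: has_sum_imp_summable)
  then have "(\<lambda>\<alpha>. norm (c \<alpha> * \<rho> ^ (\<Sum>i\<in>S. \<alpha> i))) summable_on multi_indices S"
    by (rule summable_on_iff_abs_summable_on_real[THEN iffD1])
  then show ?thesis using assms(2) by (simp add: abs_mult)
qed

lemma abs_monomial_le:
  fixes x :: "'v \<Rightarrow> real"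
  assumes "\<And>i. i \<in> S \<Longrightarrow> \<bar>x i\<bar> \<le> \<rho>"
  shows "\<bar>\<Prod>i\<in>S. x i ^ \<alpha> i\<bar> \<le> \<rho> ^ (\<Sum>i\<in>S. \<alpha> i :: nat)"
  unfolding abs_prod power_sum power_abs
  by (intro prod_mono) (auto intro!: power_mono assms)

text \<open>Shrinking the box by a factor \<open>\<epsilon>\<close> shrinks every nonconstant
  monomial at least by that factor, so the deviation from the value at the centre is at most
  \<open>\<epsilon>\<close> times the sum \<open>K\<close> of the majorant.\<close>

lemma power_series_continuous:
  assumes S: "finite S" and f: "power_series S a r c f" and r: "r > 0" and e: "e > 0"
  obtains d where "d > 0" "\<And>v. (\<And>i. i \<in> S \<Longrightarrow> \<bar>v i - a i\<bar> \<le> d) \<Longrightarrow> \<bar>f v - f a\<bar> < e"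
proof -
  define \<rho> where "\<rho> = r / 2"
  have \<rho>: "\<rho> > 0" "\<rho> < r" using r by (auto simp: \<rho>_def)
  define K where "K = (\<Sum>\<^sub>\<infinity>\<alpha>\<in>multi_indices S. \<bar>c \<alpha>\<bar> * \<rho> ^ (\<Sum>i\<in>S. \<alpha> i))"
  have K: "((\<lambda>\<alpha>. \<bar>c \<alpha>\<bar> * \<rho> ^ (\<Sum>i\<in>S. \<alpha> i)) has_sum K) (multi_indices S)"
    unfolding K_def by (rule has_sum_infsum) (rule power_series_summable[OF f], use \<rho> in auto)
  have K0: "K \<ge> 0" using \<rho> by (intro has_sum_nonneg[OF K]) auto
  have bound: "\<bar>f v - f a\<bar> \<le> \<epsilon> * K"
    if \<epsilon>: "0 \<le> \<epsilon>" "\<epsilon> \<le> 1" and v: "\<And>i. i \<in> S \<Longrightarrow> \<bar>v i - a i\<bar> \<le> \<epsilon> * \<rho>" for v \<epsilon>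
  proof -
    let ?t = "\<lambda>v \<alpha>. c \<alpha> * (\<Prod>i\<in>S. (v i - a i) ^ \<alpha> i)"
    have "\<epsilon> * \<rho> \<le> \<rho>" using \<epsilon> \<rho> by (simp add: mult_left_le_one_le)
    then have "\<bar>v i - a i\<bar> < r" if "i \<in> S" for i using v[OF that] \<rho> by linarith
    then have "((\<lambda>\<alpha>. ?t v \<alpha>) has_sum f v) (multi_indices S)" "((\<lambda>\<alpha>. ?t a \<alpha>) has_sum f a) (multi_indices S)"
      using f[unfolded power_series_def, THEN spec, THEN mp, of v] f[unfolded power_series_def, THEN spec, THEN mp, of a] r
      by simp_all
    from has_sum_add[OF this(1) has_sum_uminusI[OF this(2)]]
    have diff: "((\<lambda>\<alpha>. ?t v \<alpha> - ?t a \<alpha>) has_sum f v - f a) (multi_indices S)" by simp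
    have "\<bar>?t v \<alpha> - ?t a \<alpha>\<bar> \<le> \<epsilon> * (\<bar>c \<alpha>\<bar> * \<rho> ^ (\<Sum>i\<in>S. \<alpha> i))" if "\<alpha> \<in> multi_indices S" for \<alpha>
    proof (cases "\<forall>i\<in>S. \<alpha> i = 0")
      case True
      then show ?thesis using \<epsilon> \<rho> by simp
    next
      case False
      then obtain i where "i \<in> S" "\<alpha> i > 0" by auto
      then have pos: "(\<Sum>i\<in>S. \<alpha> i) > 0" using S by (meson member_le_sum order_less_le_trans zero_le)
      have ta: "?t a \<alpha> = 0" using False S by auto
      have "\<bar>?t v \<alpha> - ?t a \<alpha>\<bar> = \<bar>c \<alpha>\<bar> * \<bar>\<Prod>i\<in>S. (v i - a i) ^ \<alpha> i\<bar>" by (simp only: ta diff_zero abs_mult)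
      also have "\<dots> \<le> \<bar>c \<alpha>\<bar> * (\<epsilon> * \<rho>) ^ (\<Sum>i\<in>S. \<alpha> i)"
        by (intro mult_left_mono abs_monomial_le v) auto
      also have "\<dots> \<le> \<bar>c \<alpha>\<bar> * (\<epsilon> * \<rho> ^ (\<Sum>i\<in>S. \<alpha> i))"
      proof -
        have "\<epsilon> ^ (\<Sum>i\<in>S. \<alpha> i) \<le> \<epsilon> ^ 1" using pos \<epsilon> by (intro power_decreasing) auto
        then show ?thesis using \<rho> by (auto simp: power_mult_distrib intro!: mult_left_mono mult_right_mono)
      qed
      finally show ?thesis by (simp add: mult_ac)
    qed
    then have "norm (f v - f a) \<le> \<epsilon> * K"
      by (intro norm_infsum_le[OF diff has_sum_cmult_right[OF K]]) simp
    then show ?thesis by simp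
  qed
  define \<epsilon> where "\<epsilon> = min 1 (e / (2 * (K + 1)))"
  have \<epsilon>: "\<epsilon> > 0" "\<epsilon> \<le> 1" using e K0 by (auto simp: \<epsilon>_def)
  have "\<epsilon> * K \<le> e / (2 * (K + 1)) * K" using K0 by (intro mult_right_mono) (auto simp: \<epsilon>_def)
  also have "\<dots> < e" using K0 e by (simp add: field_simps add_nonneg_pos)
  finally have "\<epsilon> * K < e" .
  show thesis
  proof (rule that[of "\<epsilon> * \<rho>"])
    show "\<epsilon> * \<rho> > 0" using \<epsilon> \<rho> by simp
    fix v assume "\<And>i. i \<in> S \<Longrightarrow> \<bar>v i - a i\<bar> \<le> \<epsilon> * \<rho>"
    then have "\<bar>f v - f a\<bar> \<le> \<epsilon> * K" using \<epsilon> by (intro bound) auto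
    also note \<open>\<epsilon> * K < e\<close>
    finally show "\<bar>f v - f a\<bar> < e" .
  qed
qed

text \<open>The series is differentiated term by term, justified by the Weierstrass M-test on an
  enumeration of the multi-indices. The loss of radius pays for the factor \<open>\<alpha> k\<close>
  that differentiation brings down.\<close>

lemma has_derivative_power_series:
  assumes S: "finite S" and k: "k \<in> S" and f: "power_series S a r c f" and r: "r > 0"
    and v: "\<forall>i\<in>S. \<bar>v i - a i\<bar> < r / 4"
  shows "((\<lambda>t. f (v(k := t))) has_field_derivative pderivative k f v) (at (v k))"
    and "((\<lambda>\<alpha>. (c (\<alpha>(k := Suc (\<alpha> k))) * real (Suc (\<alpha> k))) * (\<Prod>i\<in>S. (v i - a i) ^ \<alpha> i))
           has_sum pderivative k f v) (multi_indices S)"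
proof -
  define \<rho> where "\<rho> = r / 4"
  have \<rho>: "\<rho> > 0" using r by (auto simp: \<rho>_def)
  \<comment> \<open>By \<open>n \<le> 2 ^ n\<close> doubling the radius absorbs the factor
    \<open>\<alpha> k\<close>, and \<open>2 * \<rho> = r / 2\<close> still lies inside the box of
    convergence. The division by \<open>\<rho>\<close> accounts for the lowered exponent.\<close>
  define M where "M = (\<lambda>\<alpha>. \<bar>c \<alpha>\<bar> * (2 * \<rho>) ^ (\<Sum>i\<in>S. \<alpha> i) / \<rho>)"
  define P where "P = (\<lambda>\<alpha>. \<Prod>i\<in>S - {k}. (v i - a i) ^ \<alpha> i)"
  define D where "D = (\<lambda>\<alpha> t. c \<alpha> * (P \<alpha> * (real (\<alpha> k) * (t - a k) ^ (\<alpha> k - 1))))"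
  have M: "M summable_on multi_indices S"
    unfolding M_def divide_inverse
    by (rule summable_on_cmult_left, rule power_series_summable[OF f]) (use \<rho> r in \<open>auto simp: \<rho>_def\<close>)
  have DM: "\<bar>D \<alpha> t\<bar> \<le> M \<alpha>" if t: "\<bar>t - a k\<bar> < \<rho>" for \<alpha> t
  proof (cases "\<alpha> k")
    case 0
    then show ?thesis using \<rho> by (simp add: D_def M_def)
  next
    case (Suc n)
    have "\<bar>P \<alpha>\<bar> \<le> \<rho> ^ (\<Sum>i\<in>S - {k}. \<alpha> i)"
      unfolding P_def using v by (intro abs_monomial_le) (auto simp: \<rho>_def less_imp_le)
    also have "\<dots> \<le> (2 * \<rho>) ^ (\<Sum>i\<in>S - {k}. \<alpha> i)" using \<rho> by (intro power_mono) auto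
    finally have 1: "\<bar>P \<alpha>\<bar> \<le> (2 * \<rho>) ^ (\<Sum>i\<in>S - {k}. \<alpha> i)" .
    have "\<bar>t - a k\<bar> ^ n \<le> \<rho> ^ n" using t by (intro power_mono) auto
    moreover have "real (Suc n) \<le> 2 ^ Suc n"
      using of_nat_less_two_power[of "Suc n", where 'a=real] by (rule less_imp_le)
    ultimately have "real (Suc n) * \<bar>t - a k\<bar> ^ n \<le> 2 ^ Suc n * \<rho> ^ n"
      by (intro mult_mono) auto
    also have "\<dots> = (2 * \<rho>) ^ Suc n / \<rho>" using \<rho> by (simp add: power_mult_distrib)
    finally have 2: "real (Suc n) * \<bar>t - a k\<bar> ^ n \<le> (2 * \<rho>) ^ Suc n / \<rho>" .
    have "\<bar>P \<alpha>\<bar> * (real (Suc n) * \<bar>t - a k\<bar> ^ n) \<le>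
        (2 * \<rho>) ^ (\<Sum>i\<in>S - {k}. \<alpha> i) * ((2 * \<rho>) ^ Suc n / \<rho>)"
      using \<rho> by (intro mult_mono 1 2) auto
    also have "\<dots> = (2 * \<rho>) ^ (\<Sum>i\<in>S. \<alpha> i) / \<rho>"
      using S k Suc by (simp add: sum.remove[of S k] power_add)
    finally have *: "\<bar>P \<alpha>\<bar> * (real (Suc n) * \<bar>t - a k\<bar> ^ n) \<le> (2 * \<rho>) ^ (\<Sum>i\<in>S. \<alpha> i) / \<rho>" .
    have "\<bar>D \<alpha> t\<bar> = \<bar>c \<alpha>\<bar> * (\<bar>P \<alpha>\<bar> * (real (Suc n) * \<bar>t - a k\<bar> ^ n))"
      using Suc by (simp add: D_def abs_mult power_abs)
    also have "\<dots> \<le> \<bar>c \<alpha>\<bar> * ((2 * \<rho>) ^ (\<Sum>i\<in>S. \<alpha> i) / \<rho>)"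
      using * by (intro mult_left_mono) auto
    finally show ?thesis by (simp add: M_def)
  qed
  have "infinite (multi_indices S)"
  proof
    assume "finite (multi_indices S)"
    moreover have "range (\<lambda>n. (\<lambda>_. 0)(k := n)) \<subseteq> multi_indices S" using k by (auto simp: multi_indices_def)
    ultimately have "finite (range (\<lambda>n. (\<lambda>_::'a. 0::nat)(k := n)))" by (rule rev_finite_subset)
    moreover have "inj (\<lambda>n. (\<lambda>_::'a. 0::nat)(k := n))" by (rule injI) (metis fun_upd_same)
    ultimately show False using finite_imageD infinite_UNIV_nat by blast
  qed
  moreover have "countable (multi_indices S)"
    using countable_image[OF countable_PiE[OF S, of "\<lambda>_. UNIV :: nat set"]]
    unfolding bij_betw_imp_surj_on[OF bij_betw_multi_indices, symmetric] by simp
  \<comment> \<open>The theorem on derivatives of series speaks of sequences, so the countably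
    infinite index set is enumerated. The order is immaterial since \<open>has_sum\<close> is
    unconditional.\<close>
  ultimately have e: "bij_betw (from_nat_into (multi_indices S)) UNIV (multi_indices S)" (is "bij_betw ?e _ _")
    using bij_betw_from_nat_into by blast
  have sumsI: "(\<lambda>n. g (?e n)) sums s" if "(g has_sum s) (multi_indices S)" for g :: "_ \<Rightarrow> real" and s
    using that has_sum_imp_sums has_sum_reindex_bij_betw[OF e, of g s] by blast
  have f_sums: "(\<lambda>n. c (?e n) * (P (?e n) * (t - a k) ^ ?e n k)) sums f (v(k := t))" if t: "\<bar>t - a k\<bar> < \<rho>" for t
  proof -
    have "((\<lambda>\<alpha>. c \<alpha> * (\<Prod>i\<in>S. ((v(k := t)) i - a i) ^ \<alpha> i)) has_sum f (v(k := t))) (multi_indices S)"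
      by (rule f[unfolded power_series_def, rule_format]) (use v t r in \<open>auto simp: \<rho>_def intro: less_trans[of _ "r / 4"]\<close>)
    moreover have "(\<Prod>i\<in>S. ((v(k := t)) i - a i) ^ \<alpha> i) = P \<alpha> * (t - a k) ^ \<alpha> k" for \<alpha>
    proof -
      have "(\<Prod>i\<in>S - {k}. ((v(k := t)) i - a i) ^ \<alpha> i) = P \<alpha>" unfolding P_def by (rule prod.cong) auto
      then show ?thesis using S k by (subst prod.remove[of S k]) auto
    qed
    ultimately have "((\<lambda>\<alpha>. c \<alpha> * (P \<alpha> * (t - a k) ^ \<alpha> k)) has_sum f (v(k := t))) (multi_indices S)" by simp
    then show ?thesis by (rule sumsI)
  qed
  define T where "T = ball (a k) \<rho>"
  have T: "t \<in> T \<longleftrightarrow> \<bar>t - a k\<bar> < \<rho>" for t by (auto simp: T_def dist_real_def abs_minus_commute)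
  have vT: "v k \<in> T" using v k by (simp add: T \<rho>_def)
  have "summable (\<lambda>n. M (?e n))"
    using sumsI[OF has_sum_infsum[OF M]] by (rule sums_summable)
  then have unif: "uniformly_convergent_on T (\<lambda>n t. \<Sum>i<n. D (?e i) t)"
    by (intro Weierstrass_m_test'[where M="\<lambda>n. M (?e n)"]) (use DM T in auto)
  have "((\<lambda>t. \<Sum>n. c (?e n) * (P (?e n) * (t - a k) ^ ?e n k)) has_field_derivative (\<Sum>n. D (?e n) (v k))) (at (v k))"
  proof (rule has_field_derivative_series'(2)[OF _ _ unif vT])
    show "summable (\<lambda>n. c (?e n) * (P (?e n) * (v k - a k) ^ ?e n k))"
      using f_sums vT T by (auto intro: sums_summable)
    show "v k \<in> interior T" using vT by (simp add: T_def interior_open)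
    show "((\<lambda>t. c (?e n) * (P (?e n) * (t - a k) ^ ?e n k)) has_field_derivative D (?e n) t) (at t within T)" for n t
      unfolding D_def by (auto intro!: derivative_eq_intros)
  qed (simp add: T_def)
  moreover have "eventually (\<lambda>t. t \<in> T) (nhds (v k))"
    using vT by (intro eventually_nhds_in_open) (auto simp: T_def)
  then have "eventually (\<lambda>t. f (v(k := t)) = (\<Sum>n. c (?e n) * (P (?e n) * (t - a k) ^ ?e n k))) (nhds (v k))"
    by eventually_elim (use f_sums T in \<open>auto simp: sums_iff\<close>)
  ultimately have deriv: "((\<lambda>t. f (v(k := t))) has_field_derivative (\<Sum>n. D (?e n) (v k))) (at (v k))"
    by (subst DERIV_cong_ev[OF refl _ refl])
  then have pd: "pderivative k f v = (\<Sum>n. D (?e n) (v k))"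
    unfolding pderivative_def by (rule DERIV_imp_deriv)
  show "((\<lambda>t. f (v(k := t))) has_field_derivative pderivative k f v) (at (v k))"
    using deriv unfolding pd .
  \<comment> \<open>The same majorant gives unconditional summability of the differentiated series,
    whose sum must then be that of the enumerated one.\<close>
  have "(\<lambda>\<alpha>. D \<alpha> (v k)) summable_on multi_indices S"
    by (rule summable_on_iff_abs_summable_on_real[THEN iffD2], rule Infinite_Sum.abs_summable_on_comparison_test'[OF M])
      (use DM vT T in auto)
  then have "((\<lambda>\<alpha>. D \<alpha> (v k)) has_sum (\<Sum>\<^sub>\<infinity>\<alpha>\<in>multi_indices S. D \<alpha> (v k))) (multi_indices S)"
    by (rule has_sum_infsum)
  from this sumsI[OF this] have "((\<lambda>\<alpha>. D \<alpha> (v k)) has_sum pderivative k f v) (multi_indices S)"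
    by (simp add: pd sums_iff)
  \<comment> \<open>Terms with \<open>\<alpha> k = 0\<close> vanish; the others are indexed by
    raising the \<open>k\<close>-th exponent of an arbitrary multi-index.\<close>
  then have "((\<lambda>\<alpha>. D \<alpha> (v k)) has_sum pderivative k f v) {\<alpha> \<in> multi_indices S. \<alpha> k > 0}"
    by (subst has_sum_cong_neutral[where T="multi_indices S" and g="\<lambda>\<alpha>. D \<alpha> (v k)"]) (auto simp: D_def)
  moreover have "bij_betw (\<lambda>\<alpha>. \<alpha>(k := Suc (\<alpha> k))) (multi_indices S) {\<alpha> \<in> multi_indices S. \<alpha> k > 0}"
    by (rule bij_betwI[where g="\<lambda>\<alpha>. \<alpha>(k := \<alpha> k - 1)"]) (use k in \<open>auto simp: multi_indices_def\<close>)
  ultimately have "((\<lambda>\<alpha>. D (\<alpha>(k := Suc (\<alpha> k))) (v k)) has_sum pderivative k f v) (multi_indices S)"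
    using has_sum_reindex_bij_betw[where f="\<lambda>\<alpha>. D \<alpha> (v k)"] by blast
  moreover have "D (\<alpha>(k := Suc (\<alpha> k))) (v k) =
      (c (\<alpha>(k := Suc (\<alpha> k))) * real (Suc (\<alpha> k))) * (\<Prod>i\<in>S. (v i - a i) ^ \<alpha> i)" for \<alpha>
  proof -
    have "P (\<alpha>(k := Suc (\<alpha> k))) = P \<alpha>" unfolding P_def by (rule prod.cong) auto
    then show ?thesis using S k by (simp add: D_def P_def prod.remove[of S k])
  qed
  ultimately show "((\<lambda>\<alpha>. (c (\<alpha>(k := Suc (\<alpha> k))) * real (Suc (\<alpha> k))) * (\<Prod>i\<in>S. (v i - a i) ^ \<alpha> i))
           has_sum pderivative k f v) (multi_indices S)"
    by simp
qed

lemma power_series_pderivative: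
  assumes "finite S" "k \<in> S" "power_series S a r c f" "r > 0"
  shows "power_series S a (r / 4) (\<lambda>\<alpha>. c (\<alpha>(k := Suc (\<alpha> k))) * real (Suc (\<alpha> k))) (pderivative k f)"
  unfolding power_series_def using has_derivative_power_series(2)[OF assms] by blast

lemma pderivative_eq_0:
  assumes "analytic_in S f" "k \<notin> S" shows "pderivative k f = (\<lambda>_. 0)"
proof
  fix v
  have "(\<lambda>t. f (v(k := t))) = (\<lambda>_. f v)"
    by (rule ext, rule analytic_in_cong[OF assms(1)]) (use assms(2) in auto)
  then show "pderivative k f v = 0" by (simp add: pderivative_def)
qed

lemma analytic_in_pderivative:
  assumes "analytic_in S f" shows "analytic_in S (pderivative k f)"
proof (cases "k \<in> S")
  case True
  have S: "finite S" using assms by (simp add: analytic_in_def)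
  show ?thesis unfolding analytic_in_iff
  proof (intro conjI allI S)
    fix a
    obtain r c where "r > 0" "power_series S a r c f" using assms unfolding analytic_in_iff by blast
    from this(1) power_series_pderivative[OF S True this(2,1)]
    show "\<exists>r>0. \<exists>c. power_series S a r c (pderivative k f)"
      by (intro exI[of _ "r / 4"] conjI exI) auto
  qed
next
  case False
  then show ?thesis using assms pderivative_eq_0[OF assms False] by (auto simp: analytic_in_iff intro: analytic_in_const[unfolded analytic_in_iff, THEN conjunct2, rule_format])
qed

lemma analytic_in_DERIV:
  assumes f: "analytic_in S f"
  shows "((\<lambda>t. f (v(k := t))) has_field_derivative pderivative k f v) (at (v k))"
proof (cases "k \<in> S")
  case True
  obtain r c where "r > 0" "power_series S v r c f" "finite S" using f unfolding analytic_in_iff by blast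
  then show ?thesis using True by (intro has_derivative_power_series(1)) auto
next
  case False
  have "(\<lambda>t. f (v(k := t))) = (\<lambda>_. f v)"
    by (rule ext, rule analytic_in_cong[OF f]) (use False in auto)
  then show ?thesis using pderivative_eq_0[OF f False] by simp
qed

lemma power_series_at_center:
  assumes "power_series S a r c f" "r > 0" "finite S" shows "f a = c (\<lambda>_. 0)"
proof (rule has_sum_unique)
  show "((\<lambda>\<alpha>. c \<alpha> * (\<Prod>i\<in>S. (a i - a i) ^ \<alpha> i)) has_sum f a) (multi_indices S)"
    by (rule assms(1)[unfolded power_series_def, rule_format]) (use assms(2) in simp)
  show "((\<lambda>\<alpha>. c \<alpha> * (\<Prod>i\<in>S. (a i - a i) ^ \<alpha> i)) has_sum c (\<lambda>_. 0)) (multi_indices S)"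
    using assms(3) by (intro has_sum_finite_neutralI[of "{\<lambda>_. 0}"]) (auto simp: multi_indices_def fun_eq_iff)
qed

text \<open>The value at the centre of an expansion is its zeroth coefficient. After differentiating
  in two distinct variables, in either order, this is the coefficient of the monomial that contains
  both once.\<close>

lemma analytic_in_mixed_pderivative:
  assumes f: "analytic_in S f" shows "pderivative i (pderivative j f) = pderivative j (pderivative i f)"
proof (cases "i \<in> S \<and> j \<in> S")
  case True
  show ?thesis
  proof
    fix a
    obtain r c where rc: "r > 0" "power_series S a r c f" and S: "finite S"
      using f unfolding analytic_in_iff by blast
    have r4: "r / 4 > 0" "r / 4 / 4 > 0" using rc by auto
    have "pderivative i (pderivative j f) a = pderivative j (pderivative i f) a" if "i \<noteq> j"
      using power_series_at_center[OF power_series_pderivative[OF S _ power_series_pderivative[OF S _ rc(2,1)] r4(1)] r4(2) S]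
        True that by (simp add: fun_upd_twist)
    then show "pderivative i (pderivative j f) a = pderivative j (pderivative i f) a" by (cases "i = j") auto
  qed
next
  case False
  have 0: "pderivative k (\<lambda>_. 0) = (\<lambda>_. 0)" for k :: 'a by (auto simp: pderivative_def)
  show ?thesis using False pderivative_eq_0[OF f] pderivative_eq_0[OF analytic_in_pderivative[OF f]] by (auto simp: 0)
qed

section \<open>Identity theorem by restriction to lines\<close>

text \<open>On a line through the centre a monomial of total degree \<open>n\<close> is a multiple
  of \<open>(t - t0) ^ n\<close>; collecting equal degrees leaves a series in one variable.\<close>

lemma analytic_in_line:
  assumes f: "analytic_in S f"
  obtains r A where "r > 0" "\<And>t. \<bar>t - t0\<bar> < r \<Longrightarrow> (\<lambda>n. A n * (t - t0) ^ n) sums f (\<lambda>i. b i + t * d i)"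
proof -
  define a where "a = (\<lambda>i. b i + t0 * d i)"
  obtain \<rho> c where \<rho>: "\<rho> > 0" and c: "power_series S a \<rho> c f" and S: "finite S"
    using f unfolding analytic_in_iff by blast
  define m where "m = 1 + (\<Sum>i\<in>S. \<bar>d i\<bar>)"
  have "m > 0" by (simp add: m_def add_pos_nonneg sum_nonneg)
  have m: "\<bar>d i\<bar> \<le> m" if "i \<in> S" for i
    using member_le_sum[of i S "\<lambda>i. \<bar>d i\<bar>"] S that by (simp add: m_def)
  define A where "A = (\<lambda>n. \<Sum>\<alpha> | \<alpha> \<in> multi_indices S \<and> (\<Sum>i\<in>S. \<alpha> i) = n. c \<alpha> * (\<Prod>i\<in>S. d i ^ \<alpha> i))"
  show thesis
  proof (rule that[of "\<rho> / m" A])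
    show "\<rho> / m > 0" using \<rho> \<open>m > 0\<close> by simp
    fix t assume t: "\<bar>t - t0\<bar> < \<rho> / m"
    let ?v = "\<lambda>i. b i + t * d i"
    have va: "?v i - a i = (t - t0) * d i" for i by (simp add: a_def algebra_simps)
    have "\<bar>?v i - a i\<bar> < \<rho>" if "i \<in> S" for i
    proof -
      have "\<bar>t - t0\<bar> * \<bar>d i\<bar> \<le> \<bar>t - t0\<bar> * m" using m[OF that] by (intro mult_left_mono) auto
      also have "\<dots> < \<rho>" using t \<open>m > 0\<close> by (simp add: field_simps)
      finally show ?thesis by (simp add: va abs_mult)
    qed
    then have "((\<lambda>\<alpha>. c \<alpha> * (\<Prod>i\<in>S. (?v i - a i) ^ \<alpha> i)) has_sum f ?v) (multi_indices S)"
      by (intro c[unfolded power_series_def, rule_format]) auto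
    then have "((\<lambda>n. \<Sum>\<alpha> | \<alpha> \<in> multi_indices S \<and> (\<Sum>i\<in>S. \<alpha> i) = n. c \<alpha> * (\<Prod>i\<in>S. (?v i - a i) ^ \<alpha> i)) has_sum f ?v) UNIV"
    proof (rule has_sum_regroup)
      fix n
      show "finite {\<alpha> \<in> multi_indices S. (\<Sum>i\<in>S. \<alpha> i) = n}"
        by (rule finite_subset[OF _ finite_multi_indices_le[OF S, of "\<lambda>_. n"]]) (auto intro: member_le_sum simp: S)
    qed auto
    moreover have "(\<Sum>\<alpha> | \<alpha> \<in> multi_indices S \<and> (\<Sum>i\<in>S. \<alpha> i) = n. c \<alpha> * (\<Prod>i\<in>S. (?v i - a i) ^ \<alpha> i)) = A n * (t - t0) ^ n" for n
      unfolding A_def sum_distrib_right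
      by (rule sum.cong) (auto simp: va power_mult_distrib prod.distrib power_sum)
    ultimately show "(\<lambda>n. A n * (t - t0) ^ n) sums f ?v" by (simp add: has_sum_imp_sums)
  qed
qed

text \<open>Either all coefficients of the one-variable series are zero, or its zeros are
  isolated.\<close>

lemma analytic_in_line_dichotomy:
  assumes f: "analytic_in S f"
  shows "(\<forall>\<^sub>F t in nhds t0. f (\<lambda>i. b i + t * d i) = 0) \<or> (\<forall>\<^sub>F t in at t0. f (\<lambda>i. b i + t * d i) \<noteq> 0)"
proof -
  let ?g = "\<lambda>t. f (\<lambda>i. b i + t * d i)"
  obtain r A where r: "r > 0" and A: "\<And>t. \<bar>t - t0\<bar> < r \<Longrightarrow> (\<lambda>n. A n * (t - t0) ^ n) sums ?g t"
    using analytic_in_line[OF f] by blast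
  show ?thesis
  proof (cases "\<forall>n. A n = 0")
    case True
    have "?g t = 0" if "\<bar>t - t0\<bar> < r" for t
      using A[OF that] True by (simp add: sums_iff)
    moreover have "\<forall>\<^sub>F t in nhds t0. \<bar>t - t0\<bar> < r"
      using r by (auto simp: eventually_nhds_metric dist_real_def)
    ultimately show ?thesis by (auto elim: eventually_mono)
  next
    case False
    then obtain n where n: "A n \<noteq> 0" by blast
    \<comment> \<open>\<open>powser_0_nonzero\<close> expects the value 0 at the centre and a
      nonzero coefficient of positive index. Multiplication by \<open>t - t0\<close> provides both,
      even if only \<open>A 0\<close> is nonzero.\<close>
    define B where "B = (\<lambda>n. case n of 0 \<Rightarrow> 0 | Suc k \<Rightarrow> A k)"
    have sm: "(\<lambda>n. B n * (t - t0) ^ n) sums ((t - t0) * ?g t)" if "norm (t - t0) < r" for t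
    proof -
      have "(\<lambda>n. (t - t0) * (A n * (t - t0) ^ n)) sums ((t - t0) * ?g t)"
        using that by (intro sums_mult A) simp
      then have "(\<lambda>n. B (Suc n) * (t - t0) ^ Suc n) sums ((t - t0) * ?g t)"
        by (simp add: B_def mult_ac)
      from sums_Suc[OF this] show ?thesis by (simp add: B_def)
    qed
    have Bn: "B (Suc n) \<noteq> 0" using n by (simp add: B_def)
    have "(t0 - t0) * ?g t0 = 0" by simp
    obtain s where "0 < s" "\<And>t. t \<in> cball t0 s - {t0} \<Longrightarrow> (t - t0) * ?g t \<noteq> 0"
      using powser_0_nonzero[OF r sm \<open>(t0 - t0) * ?g t0 = 0\<close> Bn zero_less_Suc] by blast
    then have "\<forall>\<^sub>F t in at t0. ?g t \<noteq> 0"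
      unfolding eventually_at by (intro exI[of _ s]) (auto simp: dist_commute)
    then show ?thesis ..
  qed
qed

text \<open>The points near which the restriction vanishes and the points around which it has no
  other zero form disjoint open sets covering the line. By connectedness one of them is empty, and
  \<open>t1\<close> does not belong to the first.\<close>

lemma analytic_in_line_nonzero:
  assumes f: "analytic_in S f" and nz: "f (\<lambda>i. b i + t1 * d i) \<noteq> 0"
  shows "\<forall>\<^sub>F t in at t0. f (\<lambda>i. b i + t * d i) \<noteq> 0"
proof -
  define g where "g = (\<lambda>t. f (\<lambda>i. b i + t * d i))"
  define U where "U = {t0. \<forall>\<^sub>F t in nhds t0. g t = 0}"
  define V where "V = {t0. \<forall>\<^sub>F t in at t0. g t \<noteq> 0}"
  have "open U"
    unfolding open_subopen[of U]
  proof
    fix t assume "t \<in> U"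
    then obtain T where T: "open T" "t \<in> T" "\<forall>x\<in>T. g x = 0"
      by (auto simp: U_def eventually_nhds)
    then have "T \<subseteq> U" by (auto simp: U_def eventually_nhds)
    then show "\<exists>T. open T \<and> t \<in> T \<and> T \<subseteq> U" using T by blast
  qed
  moreover have "open V"
    unfolding open_subopen[of V]
  proof
    fix t assume "t \<in> V"
    then obtain T where T: "open T" "t \<in> T" "\<And>x. x \<in> T \<Longrightarrow> x \<noteq> t \<Longrightarrow> g x \<noteq> 0"
      unfolding V_def eventually_at_topological by auto
    have "y \<in> V" if "y \<in> T" for y
    proof (cases "y = t")
      case False
      have "open (T - {t})" using T by auto
      then show ?thesis unfolding V_def eventually_at_topological mem_Collect_eq
        using False that T by (intro exI[of _ "T - {t}"]) auto
    qed (use \<open>t \<in> V\<close> in simp)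
    then show "\<exists>T. open T \<and> t \<in> T \<and> T \<subseteq> V" using T by blast
  qed
  moreover have "U \<inter> V \<inter> UNIV = {}"
  proof -
    have False if "\<forall>\<^sub>F t in nhds t0. g t = 0" "\<forall>\<^sub>F t in at t0. g t \<noteq> 0" for t0
    proof -
      have "\<forall>\<^sub>F t in at t0. g t = 0"
        using that(1) by (auto simp: eventually_at_filter elim: eventually_mono)
      with that(2) have "\<forall>\<^sub>F t in at t0. False" by eventually_elim simp
      then show False by simp
    qed
    then show ?thesis by (auto simp: U_def V_def)
  qed
  moreover have "UNIV \<subseteq> U \<union> V"
    using analytic_in_line_dichotomy[OF f, where b=b and d=d] by (auto simp: U_def V_def g_def)
  ultimately have "U \<inter> UNIV = {} \<or> V \<inter> UNIV = {}"
    by (rule connectedD[OF connected_UNIV])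
  moreover have "t1 \<notin> U" using nz by (auto simp: U_def g_def dest: eventually_nhds_x_imp_x)
  ultimately have "U = {}" using \<open>UNIV \<subseteq> U \<union> V\<close> by auto
  then show ?thesis using \<open>UNIV \<subseteq> U \<union> V\<close> by (auto simp: V_def g_def)
qed

text \<open>On the line from \<open>a\<close> to \<open>b\<close> neither function vanishes
  identically, so both are nonzero at all parameters close to, but different from, 0. This is the
  absence of zero divisors among analytic functions.\<close>

lemma analytic_in_mult_nonzero:
  assumes f: "analytic_in S f" and g: "analytic_in T g" and "f a \<noteq> 0" "g b \<noteq> 0"
  obtains v where "f v \<noteq> 0" "g v \<noteq> 0"
proof -
  let ?d = "\<lambda>i. b i - a i"
  have "\<forall>\<^sub>F t in at 0. f (\<lambda>i. a i + t * ?d i) \<noteq> 0"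
    by (rule analytic_in_line_nonzero[OF f, where ?t1.0=0]) (use assms in simp)
  moreover have "\<forall>\<^sub>F t in at 0. g (\<lambda>i. a i + t * ?d i) \<noteq> 0"
    by (rule analytic_in_line_nonzero[OF g, where ?t1.0=1]) (use assms in simp)
  ultimately have "\<forall>\<^sub>F t in at (0::real). \<exists>v. f v \<noteq> 0 \<and> g v \<noteq> 0"
    by eventually_elim blast
  then show thesis using that by (auto dest: eventually_happens)
qed

text \<open>On the line from \<open>a\<close> to \<open>v\<close>, a nonzero value at
  \<open>v\<close> would force nonzero values arbitrarily close to \<open>a\<close>.\<close>

lemma analytic_in_eq_0:
  assumes f: "analytic_in S f" and d: "d > 0"
    and z: "\<And>v. (\<And>i. i \<in> S \<Longrightarrow> \<bar>v i - a i\<bar> \<le> d) \<Longrightarrow> f v = 0"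
  shows "f v = 0"
proof (rule ccontr)
  assume "f v \<noteq> 0"
  then have "\<forall>\<^sub>F t in at 0. f (\<lambda>i. a i + t * (v i - a i)) \<noteq> 0"
    by (intro analytic_in_line_nonzero[OF f, where ?t1.0=1]) simp
  moreover have "\<forall>\<^sub>F t in at 0. \<forall>i\<in>S. \<bar>(a i + t * (v i - a i)) - a i\<bar> < d"
  proof (rule eventually_ball_finite, use f in \<open>simp add: analytic_in_def\<close>, rule ballI)
    fix i
    have "((\<lambda>t. \<bar>(a i + t * (v i - a i)) - a i\<bar>) \<longlongrightarrow> \<bar>(a i + 0 * (v i - a i)) - a i\<bar>) (at 0)"
      by (intro tendsto_intros)
    then show "\<forall>\<^sub>F t in at 0. \<bar>(a i + t * (v i - a i)) - a i\<bar> < d"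
      using d by (intro order_tendstoD(2)[where y = "\<bar>(a i + 0 * (v i - a i)) - a i\<bar>"]) auto
  qed
  ultimately have "\<forall>\<^sub>F t :: real in at 0. False"
    by eventually_elim (use z in \<open>auto simp: less_imp_le\<close>)
  then show False by simp
qed

section \<open>Meromorphic functions up to generic equality\<close>

text \<open>As a filter, generic truth can be combined by \<open>eventually_elim\<close>, so
  identities between meromorphic functions are handled like pointwise ones.\<close>

definition generic_filter :: "('v \<Rightarrow> real) filter" where
  "generic_filter = Abs_filter generically"

text \<open>The substantial filter axiom is closure under conjunction: the product of the two
  witnessing functions is again not identically zero.\<close>

lemma eventually_generic_filter: "eventually P generic_filter \<longleftrightarrow> generically P"
  unfolding generic_filter_def
proof (rule eventually_Abs_filter, rule is_filter.intro)
  show "generically (\<lambda>_. True)"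
    unfolding generically_def by (intro exI[of _ "{}"] exI[of _ "\<lambda>_. 1"]) auto
next
  fix P Q :: "('v \<Rightarrow> real) \<Rightarrow> bool" assume "generically P" "generically Q"
  then obtain S p T q where p: "analytic_in S p" "\<exists>v. p v \<noteq> 0" "\<And>v. p v \<noteq> 0 \<Longrightarrow> P v"
    and q: "analytic_in T q" "\<exists>v. q v \<noteq> 0" "\<And>v. q v \<noteq> 0 \<Longrightarrow> Q v"
    unfolding generically_def by metis
  have "finite (S \<union> T)" using p(1) q(1) by (auto simp: analytic_in_def)
  then have "analytic_in (S \<union> T) (\<lambda>v. p v * q v)"
    by (intro analytic_in_mult analytic_in_mono[OF p(1)] analytic_in_mono[OF q(1)]) auto
  moreover have "\<exists>v. p v * q v \<noteq> 0"
    using p(2) q(2) analytic_in_mult_nonzero[OF p(1) q(1)] by (metis mult_eq_0_iff)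
  ultimately show "generically (\<lambda>v. P v \<and> Q v)"
    unfolding generically_def using p(3) q(3) by (intro exI[of _ "S \<union> T"] exI[of _ "\<lambda>v. p v * q v"]) auto
next
  fix P Q :: "('v \<Rightarrow> real) \<Rightarrow> bool" assume "\<forall>x. P x \<longrightarrow> Q x" "generically P"
  then show "generically Q" unfolding generically_def by metis
qed

lemma generic_filter_neq_bot [simp]: "generic_filter \<noteq> bot"
  by (auto simp: trivial_limit_def eventually_generic_filter generically_def)

lemma eventually_nonzero:
  assumes "analytic_in S q" "q v \<noteq> 0" shows "\<forall>\<^sub>F v in generic_filter. q v \<noteq> 0"
  using assms unfolding eventually_generic_filter generically_def by blast

text \<open>Otherwise the function itself would witness that it is generically nonzero. Thus a
  generic identity between analytic functions may be evaluated at any point.\<close>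

lemma analytic_in_eq_0_generic:
  assumes f: "analytic_in S f" and z: "\<forall>\<^sub>F v in generic_filter. f v = 0"
  shows "f v = 0"
proof (rule ccontr)
  assume "f v \<noteq> 0"
  from eventually_conj[OF z eventually_nonzero[OF f this]]
  have "\<forall>\<^sub>F v :: 'a \<Rightarrow> real in generic_filter. False" by (rule eventually_mono) simp
  then show False by simp
qed

lemma analytic_in_nonzero_nhds:
  assumes q: "analytic_in S q" and v: "q v \<noteq> 0"
  shows "\<forall>\<^sub>F t in nhds (v k). q (v(k := t)) \<noteq> 0"
proof -
  define g where "g = (\<lambda>t. q (v(k := t)))"
  have "isCont g (v k)" unfolding g_def using analytic_in_DERIV[OF q] by (rule DERIV_isCont)
  then have "(g \<longlongrightarrow> g (v k)) (nhds (v k))"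
    by (simp add: isCont_def tendsto_at_iff_tendsto_nhds)
  moreover have "g (v k) \<noteq> 0" using v by (simp add: g_def)
  ultimately have "\<forall>\<^sub>F t in nhds (v k). g t \<noteq> 0" by (rule tendsto_imp_eventually_ne)
  then show ?thesis by (simp add: g_def)
qed

text \<open>The complement of the zero set of an analytic function is open along every coordinate.
  Hence a generic identity holds on a whole neighbourhood within the coordinate line, as needed for
  comparing derivatives.\<close>

lemma eventually_fun_upd:
  assumes P: "\<forall>\<^sub>F v in generic_filter. P v"
  shows "\<forall>\<^sub>F v in generic_filter. \<forall>\<^sub>F t in nhds (v k). P (v(k := t))"
proof -
  obtain S q where q: "analytic_in S q" "\<exists>v. q v \<noteq> 0" "\<And>v. q v \<noteq> 0 \<Longrightarrow> P v"
    using P unfolding eventually_generic_filter generically_def by metis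
  have "\<forall>\<^sub>F t in nhds (v k). P (v(k := t))" if "q v \<noteq> 0" for v
    using analytic_in_nonzero_nhds[OF q(1) that] by eventually_elim (rule q(3))
  then show ?thesis unfolding eventually_generic_filter generically_def using q(1,2) by blast
qed

lemma pderivative_cong:
  assumes "\<forall>\<^sub>F v in generic_filter. f v = g v"
  shows "\<forall>\<^sub>F v in generic_filter. pderivative k f v = pderivative k g v"
  using eventually_fun_upd[OF assms, of k]
  by eventually_elim (auto simp: pderivative_def intro: deriv_cong_ev)

lemma pderivative_const [simp]: "pderivative k (\<lambda>_. c) = (\<lambda>_. 0)"
  by (auto simp: pderivative_def)

lemma pderivative_coord: "pderivative k (\<lambda>v. v j) = (\<lambda>_. if j = k then 1 else 0)"
  by (auto simp: pderivative_def fun_upd_def)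

lemma pderivative_zero_cong:
  "\<forall>\<^sub>F v in generic_filter. f v = 0 \<Longrightarrow> \<forall>\<^sub>F v in generic_filter. pderivative k f v = 0"
  using pderivative_cong[of f "\<lambda>_. 0" k] by simp

lemma analytic_in_pderivative_add:
  assumes "analytic_in S f" "analytic_in S g"
  shows "pderivative k (\<lambda>v. f v + g v) = (\<lambda>v. pderivative k f v + pderivative k g v)"
  unfolding pderivative_def[of k "\<lambda>v. f v + g v"]
  by (intro ext DERIV_imp_deriv DERIV_add analytic_in_DERIV[OF assms(1)] analytic_in_DERIV[OF assms(2)])

lemma analytic_in_pderivative_mult:
  assumes "analytic_in S f" "analytic_in S g"
  shows "pderivative k (\<lambda>v. f v * g v) = (\<lambda>v. pderivative k f v * g v + f v * pderivative k g v)"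
proof
  fix v
  have "((\<lambda>t. f (v(k := t)) * g (v(k := t))) has_field_derivative
     pderivative k f v * g (v(k := v k)) + pderivative k g v * f (v(k := v k))) (at (v k))"
    by (intro DERIV_mult analytic_in_DERIV[OF assms(1)] analytic_in_DERIV[OF assms(2)])
  then show "pderivative k (\<lambda>v. f v * g v) v = pderivative k f v * g v + f v * pderivative k g v"
    unfolding pderivative_def[of k "\<lambda>v. f v * g v"] by (simp add: DERIV_imp_deriv mult.commute)
qed

section \<open>Arithmetic and differentiation of quotients\<close>

lemma meromorphic_inE:
  assumes "meromorphic_in S f"
  obtains p q w where "analytic_in S p" "analytic_in S q" "q w \<noteq> 0" "\<And>v. q v \<noteq> 0 \<Longrightarrow> f v = p v / q v"
  using assms unfolding meromorphic_in_def by blast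

lemma meromorphic_inI:
  assumes "analytic_in S p" "analytic_in S q" "q w \<noteq> 0" "\<And>v. q v \<noteq> 0 \<Longrightarrow> f v = p v / q v"
  shows "meromorphic_in S f"
  using assms unfolding meromorphic_in_def by blast

lemma analytic_imp_meromorphic_in: "analytic_in S f \<Longrightarrow> meromorphic_in S f"
  by (rule meromorphic_inI[of S f "\<lambda>_. 1"]) (auto simp: analytic_in_def[of S f])

lemma meromorphic_in_finite: "meromorphic_in S f \<Longrightarrow> finite S"
  by (auto simp: meromorphic_in_def analytic_in_def)

lemma meromorphic_in_mono:
  assumes "meromorphic_in S f" "S \<subseteq> T" "finite T" shows "meromorphic_in T f"
  using assms unfolding meromorphic_in_def by (metis analytic_in_mono)

lemma analytic_in_diff:
  assumes "analytic_in S f" "analytic_in S g" shows "analytic_in S (\<lambda>v. f v - g v)"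
proof -
  have "analytic_in S (\<lambda>v. (-1) * g v)"
    using assms by (intro analytic_in_mult) (auto simp: analytic_in_def[of S g])
  from analytic_in_add[OF assms(1) this] show ?thesis by simp
qed

lemma meromorphic_in_add:
  assumes f: "meromorphic_in S f" and g: "meromorphic_in S g"
  shows "meromorphic_in S (\<lambda>v. f v + g v)"
proof -
  obtain p q w where p: "analytic_in S p" "analytic_in S q" "q w \<noteq> 0" "\<And>v. q v \<noteq> 0 \<Longrightarrow> f v = p v / q v"
    using meromorphic_inE[OF f] by blast
  obtain p' q' w' where p': "analytic_in S p'" "analytic_in S q'" "q' w' \<noteq> 0" "\<And>v. q' v \<noteq> 0 \<Longrightarrow> g v = p' v / q' v"
    using meromorphic_inE[OF g] by blast
  obtain v where "q v \<noteq> 0" "q' v \<noteq> 0" by (rule analytic_in_mult_nonzero[of S q S q' w w', OF p(2) p'(2) p(3) p'(3)])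
  show ?thesis
  proof (rule meromorphic_inI)
    show "analytic_in S (\<lambda>v. p v * q' v + p' v * q v)" "analytic_in S (\<lambda>v. q v * q' v)"
      by (intro analytic_in_add analytic_in_mult p(1,2) p'(1,2))+
    show "q v * q' v \<noteq> 0" using \<open>q v \<noteq> 0\<close> \<open>q' v \<noteq> 0\<close> by simp
    show "f v + g v = (p v * q' v + p' v * q v) / (q v * q' v)" if "q v * q' v \<noteq> 0" for v
      using that p(4)[of v] p'(4)[of v] by (simp add: add_frac_eq)
  qed
qed

lemma meromorphic_in_mult:
  assumes f: "meromorphic_in S f" and g: "meromorphic_in S g"
  shows "meromorphic_in S (\<lambda>v. f v * g v)"
proof -
  obtain p q w where p: "analytic_in S p" "analytic_in S q" "q w \<noteq> 0" "\<And>v. q v \<noteq> 0 \<Longrightarrow> f v = p v / q v"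
    using meromorphic_inE[OF f] by blast
  obtain p' q' w' where p': "analytic_in S p'" "analytic_in S q'" "q' w' \<noteq> 0" "\<And>v. q' v \<noteq> 0 \<Longrightarrow> g v = p' v / q' v"
    using meromorphic_inE[OF g] by blast
  obtain v where "q v \<noteq> 0" "q' v \<noteq> 0" by (rule analytic_in_mult_nonzero[of S q S q' w w', OF p(2) p'(2) p(3) p'(3)])
  show ?thesis
  proof (rule meromorphic_inI)
    show "analytic_in S (\<lambda>v. p v * p' v)" "analytic_in S (\<lambda>v. q v * q' v)"
      by (intro analytic_in_mult p(1,2) p'(1,2))+
    show "q v * q' v \<noteq> 0" using \<open>q v \<noteq> 0\<close> \<open>q' v \<noteq> 0\<close> by simp
    show "f v * g v = (p v * p' v) / (q v * q' v)" if "q v * q' v \<noteq> 0" for v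
      using that p(4)[of v] p'(4)[of v] by simp
  qed
qed

lemma meromorphic_in_sum:
  assumes "finite S" "\<And>i. i \<in> I \<Longrightarrow> meromorphic_in S (f i)"
  shows "meromorphic_in S (\<lambda>v. \<Sum>i\<in>I. f i v)"
  using assms(2)
proof (induction I rule: infinite_finite_induct)
  case (insert i I)
  then show ?case by (simp add: meromorphic_in_add)
qed (use assms(1) in \<open>auto intro: analytic_imp_meromorphic_in\<close>)

lemma quotient_DERIV:
  assumes p: "analytic_in S p" and q: "analytic_in S q" and f: "\<And>v. q v \<noteq> 0 \<Longrightarrow> f v = p v / q v"
    and v: "q v \<noteq> 0"
  shows "((\<lambda>t. f (v(k := t))) has_field_derivative
     (pderivative k p v * q v - p v * pderivative k q v) / (q v * q v)) (at (v k))"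
proof -
  have D: "((\<lambda>t. p (v(k := t)) / q (v(k := t))) has_field_derivative
     (pderivative k p v * q v - p v * pderivative k q v) / (q v * q v)) (at (v k))"
    using DERIV_divide[OF analytic_in_DERIV[OF p, of v k] analytic_in_DERIV[OF q, of v k]] v by simp
  from analytic_in_nonzero_nhds[OF q v, of k]
  have ev: "\<forall>\<^sub>F t in nhds (v k). f (v(k := t)) = p (v(k := t)) / q (v(k := t))"
    by eventually_elim (rule f)
  show ?thesis by (rule DERIV_cong_ev[OF refl ev refl, THEN iffD2, OF D])
qed

lemma quotient_pderivative:
  assumes "analytic_in S p" "analytic_in S q" "\<And>v. q v \<noteq> 0 \<Longrightarrow> f v = p v / q v" "q v \<noteq> 0"
  shows "pderivative k f v = (pderivative k p v * q v - p v * pderivative k q v) / (q v * q v)"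
  unfolding pderivative_def[of k f] by (rule DERIV_imp_deriv[OF quotient_DERIV[OF assms(1,2,3)]], assumption, rule assms(4))

lemma meromorphic_in_pderivative:
  assumes f: "meromorphic_in S f" shows "meromorphic_in S (pderivative k f)"
proof -
  obtain p q w where p: "analytic_in S p" "analytic_in S q" "q w \<noteq> 0" "\<And>v. q v \<noteq> 0 \<Longrightarrow> f v = p v / q v"
    using meromorphic_inE[OF f] by blast
  show ?thesis
  proof (rule meromorphic_inI)
    show "analytic_in S (\<lambda>v. pderivative k p v * q v - p v * pderivative k q v)" "analytic_in S (\<lambda>v. q v * q v)"
      by (intro analytic_in_diff analytic_in_mult analytic_in_pderivative p(1,2))+
    show "q w * q w \<noteq> 0" using p(3) by simp
    show "pderivative k f v = (pderivative k p v * q v - p v * pderivative k q v) / (q v * q v)"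
      if "q v * q v \<noteq> 0" for v
      using that by (intro quotient_pderivative[OF p(1,2,4)]) auto
  qed
qed

text \<open>The variable set is hidden because generic equality need not preserve it: the
  exceptional set may involve further variables.\<close>

definition meromorphic :: "(('v \<Rightarrow> real) \<Rightarrow> real) \<Rightarrow> bool" where
  "meromorphic f \<longleftrightarrow> (\<exists>S. meromorphic_in S f)"

lemma meromorphicI: "meromorphic_in S f \<Longrightarrow> meromorphic f" by (auto simp: meromorphic_def)

lemma meromorphic_common:
  assumes "meromorphic f" "meromorphic g" obtains S where "meromorphic_in S f" "meromorphic_in S g"
proof -
  obtain S T where "meromorphic_in S f" "meromorphic_in T g" using assms by (auto simp: meromorphic_def)
  then show thesis using that[of "S \<union> T"] by (meson finite_Un meromorphic_in_finite meromorphic_in_mono Un_upper1 Un_upper2)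
qed

lemma meromorphic_add: "meromorphic f \<Longrightarrow> meromorphic g \<Longrightarrow> meromorphic (\<lambda>v. f v + g v)"
  by (metis meromorphic_common meromorphic_in_add meromorphicI)

lemma meromorphic_mult: "meromorphic f \<Longrightarrow> meromorphic g \<Longrightarrow> meromorphic (\<lambda>v. f v * g v)"
  by (metis meromorphic_common meromorphic_in_mult meromorphicI)

lemma meromorphic_pderivative: "meromorphic f \<Longrightarrow> meromorphic (pderivative k f)"
  by (auto simp: meromorphic_def intro: meromorphic_in_pderivative)

lemma meromorphic_const [simp]: "meromorphic (\<lambda>_. c)"
  by (rule meromorphicI[of "{}"]) (simp add: analytic_imp_meromorphic_in)

lemma meromorphic_coord [simp]: "meromorphic (\<lambda>v. v k)"
  by (rule meromorphicI[of "{k}"]) (simp add: analytic_imp_meromorphic_in analytic_in_coord)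

lemma meromorphic_power: "meromorphic f \<Longrightarrow> meromorphic (\<lambda>v. f v ^ n)"
  by (induction n) (auto intro: meromorphic_mult)

lemma meromorphic_sum:
  "(\<And>i. i \<in> I \<Longrightarrow> meromorphic (f i)) \<Longrightarrow> meromorphic (\<lambda>v. \<Sum>i\<in>I. f i v)"
  by (induction I rule: infinite_finite_induct) (auto intro: meromorphic_add)

text \<open>Extending the fraction by the function whose zeros contain the exceptional set removes
  that set from the points where the quotient has to be correct.\<close>

lemma meromorphic_cong:
  assumes f: "meromorphic f" and eq: "\<forall>\<^sub>F v in generic_filter. g v = f v" shows "meromorphic g"
proof -
  obtain T p q w where p: "analytic_in T p" "analytic_in T q" "q w \<noteq> 0" "\<And>v. q v \<noteq> 0 \<Longrightarrow> f v = p v / q v"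
    using f meromorphic_inE unfolding meromorphic_def by metis
  obtain S s w' where s: "analytic_in S s" "s w' \<noteq> 0" "\<And>v. s v \<noteq> 0 \<Longrightarrow> g v = f v"
    using eq unfolding eventually_generic_filter generically_def by metis
  have fin: "finite (S \<union> T)" using p s by (auto simp: analytic_in_def)
  obtain v where v: "q v \<noteq> 0" "s v \<noteq> 0" by (rule analytic_in_mult_nonzero[of T q S s w w', OF p(2) s(1) p(3) s(2)])
  have "meromorphic_in (S \<union> T) g"
  proof (rule meromorphic_inI)
    have *: "analytic_in (S \<union> T) p" "analytic_in (S \<union> T) q" "analytic_in (S \<union> T) s"
      using analytic_in_mono[OF p(1) _ fin] analytic_in_mono[OF p(2) _ fin] analytic_in_mono[OF s(1) _ fin] by auto
    show "analytic_in (S \<union> T) (\<lambda>v. p v * s v)" "analytic_in (S \<union> T) (\<lambda>v. q v * s v)"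
      by (intro analytic_in_mult *)+
    show "q v * s v \<noteq> 0" using v by simp
    show "g v = p v * s v / (q v * s v)" if "q v * s v \<noteq> 0" for v
      using that p(4)[of v] s(3)[of v] by simp
  qed
  then show ?thesis by (rule meromorphicI)
qed

text \<open>\<open>deriv\<close> is a total operator and says nothing about differentiability; the
  sum and product rules below need an actual derivative.\<close>

lemma meromorphic_DERIV:
  assumes "meromorphic f"
  shows "\<forall>\<^sub>F v in generic_filter. ((\<lambda>t. f (v(k := t))) has_field_derivative pderivative k f v) (at (v k))"
proof -
  obtain S p q w where p: "analytic_in S p" "analytic_in S q" "q w \<noteq> 0" "\<And>v. q v \<noteq> 0 \<Longrightarrow> f v = p v / q v"
    using assms meromorphic_inE unfolding meromorphic_def by metis
  from eventually_nonzero[OF p(2), OF p(3)] show ?thesis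
    by eventually_elim (use quotient_DERIV[OF p(1,2,4)] quotient_pderivative[OF p(1,2,4)] in metis)
qed

lemma pderivative_add:
  assumes "meromorphic f" "meromorphic g"
  shows "\<forall>\<^sub>F v in generic_filter. pderivative k (\<lambda>v. f v + g v) v = pderivative k f v + pderivative k g v"
  using meromorphic_DERIV[OF assms(1), of k] meromorphic_DERIV[OF assms(2), of k]
  by eventually_elim (simp add: pderivative_def[of k "\<lambda>v. f v + g v"] DERIV_imp_deriv DERIV_add)

lemma pderivative_mult:
  assumes "meromorphic f" "meromorphic g"
  shows "\<forall>\<^sub>F v in generic_filter. pderivative k (\<lambda>v. f v * g v) v = pderivative k f v * g v + f v * pderivative k g v"
  using meromorphic_DERIV[OF assms(1), of k] meromorphic_DERIV[OF assms(2), of k]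
proof eventually_elim
  case (elim v)
  from DERIV_mult[OF elim] show ?case
    unfolding pderivative_def[of k "\<lambda>v. f v * g v"] by (simp add: DERIV_imp_deriv mult.commute)
qed

lemma pderivative_sum:
  assumes "finite I" "\<And>i. i \<in> I \<Longrightarrow> meromorphic (f i)"
  shows "\<forall>\<^sub>F v in generic_filter. pderivative k (\<lambda>v. \<Sum>i\<in>I. f i v) v = (\<Sum>i\<in>I. pderivative k (f i) v)"
  using assms
proof (induction I rule: finite_induct)
  case (insert i I)
  have "meromorphic (f i)" "meromorphic (\<lambda>v. \<Sum>i\<in>I. f i v)"
    using insert by (auto intro: meromorphic_sum)
  from pderivative_add[OF this, of k]
  have "\<forall>\<^sub>F v in generic_filter. pderivative k (\<lambda>v. f i v + (\<Sum>i\<in>I. f i v)) v =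
      pderivative k (f i) v + pderivative k (\<lambda>v. \<Sum>i\<in>I. f i v) v" .
  moreover have "\<forall>\<^sub>F v in generic_filter. pderivative k (\<lambda>v. \<Sum>i\<in>I. f i v) v = (\<Sum>i\<in>I. pderivative k (f i) v)"
    using insert by auto
  ultimately show ?case by eventually_elim (simp add: insert(1,2))
qed simp

text \<open>The quotient rule applied twice expresses either order through derivatives of
  \<open>p\<close> and \<open>q\<close>. Once the mixed derivatives of these analytic functions are
  exchanged, both expressions agree by algebra.\<close>

lemma mixed_pderivative:
  assumes "meromorphic f"
  shows "\<forall>\<^sub>F v in generic_filter. pderivative i (pderivative j f) v = pderivative j (pderivative i f) v"
proof -
  obtain S p q w where p: "analytic_in S p" "analytic_in S q" "q w \<noteq> 0" "\<And>v. q v \<noteq> 0 \<Longrightarrow> f v = p v / q v"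
    using assms meromorphic_inE unfolding meromorphic_def by metis
  note an = analytic_in_diff analytic_in_mult analytic_in_pderivative p(1,2)
  have *: "pderivative i (pderivative j f) v =
     ((pderivative i (pderivative j p) v * q v + pderivative j p v * pderivative i q v
        - (pderivative i p v * pderivative j q v + p v * pderivative i (pderivative j q) v)) * (q v * q v)
      - (pderivative j p v * q v - p v * pderivative j q v) * (pderivative i q v * q v + q v * pderivative i q v))
      / ((q v * q v) * (q v * q v))" if v: "q v \<noteq> 0" for v i j
  proof -
    have an': "analytic_in S (\<lambda>v. pderivative j p v * q v)" "analytic_in S (\<lambda>v. p v * pderivative j q v)"
      by (intro an)+
    have "pderivative i (\<lambda>v. pderivative j p v * q v - p v * pderivative j q v) v =
       pderivative i (\<lambda>v. pderivative j p v * q v) v - pderivative i (\<lambda>v. p v * pderivative j q v) v"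
      unfolding pderivative_def[of i "\<lambda>v. pderivative j p v * q v - p v * pderivative j q v"]
      by (rule DERIV_imp_deriv, rule DERIV_diff[OF analytic_in_DERIV[OF an'(1)] analytic_in_DERIV[OF an'(2)]])
    also have "\<dots> = pderivative i (pderivative j p) v * q v + pderivative j p v * pderivative i q v
        - (pderivative i p v * pderivative j q v + p v * pderivative i (pderivative j q) v)"
      unfolding analytic_in_pderivative_mult[OF analytic_in_pderivative[OF p(1)] p(2)]
        analytic_in_pderivative_mult[OF p(1) analytic_in_pderivative[OF p(2)]] ..
    finally have num: "pderivative i (\<lambda>v. pderivative j p v * q v - p v * pderivative j q v) v = \<dots>" .
    have den: "pderivative i (\<lambda>v. q v * q v) v = pderivative i q v * q v + q v * pderivative i q v"
      unfolding analytic_in_pderivative_mult[OF p(2) p(2)] ..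
    have "pderivative i (pderivative j f) v =
      (pderivative i (\<lambda>v. pderivative j p v * q v - p v * pderivative j q v) v * (q v * q v)
        - (pderivative j p v * q v - p v * pderivative j q v) * pderivative i (\<lambda>v. q v * q v) v)
      / ((q v * q v) * (q v * q v))"
    proof (rule quotient_pderivative)
      show "analytic_in S (\<lambda>v. pderivative j p v * q v - p v * pderivative j q v)" by (intro an)
      show "analytic_in S (\<lambda>v. q v * q v)" by (intro an)
    qed (use v in \<open>auto simp: quotient_pderivative[OF p(1,2,4)]\<close>)
    then show ?thesis unfolding num den .
  qed
  have sw: "pderivative i (pderivative j p) = pderivative j (pderivative i p)"
     "pderivative i (pderivative j q) = pderivative j (pderivative i q)"
    by (rule analytic_in_mixed_pderivative, rule p)+
  from eventually_nonzero[OF p(2), OF p(3)] show ?thesis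
    by eventually_elim (simp add: * sw, simp add: algebra_simps)
qed

text \<open>The quantifier over \<open>k\<close> stands inside \<open>eventually\<close>: one
  denominator serves infinitely many variables at once, as the series in
  \<open>time_derivative\<close> demands.\<close>

lemma pderivative_outside:
  assumes "meromorphic_in S f"
  shows "\<forall>\<^sub>F v in generic_filter. \<forall>k. k \<notin> S \<longrightarrow> pderivative k f v = 0"
proof -
  obtain p q w where p: "analytic_in S p" "analytic_in S q" "q w \<noteq> 0" "\<And>v. q v \<noteq> 0 \<Longrightarrow> f v = p v / q v"
    using meromorphic_inE[OF assms] by blast
  from eventually_nonzero[OF p(2), OF p(3)] show ?thesis
    by eventually_elim (auto simp: quotient_pderivative[OF p(1,2,4)] pderivative_eq_0[OF p(1)] pderivative_eq_0[OF p(2)])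
qed

text \<open>The complement of the zeros of the denominator may be disconnected, so constancy is
  first shown on a box around \<open>a\<close> where \<open>q\<close> has no zero, and the identity
  theorem then spreads \<open>p = c * q\<close> to all points.\<close>

lemma generically_constant:
  assumes "meromorphic_in S f" "\<And>k. k \<in> S \<Longrightarrow> \<forall>\<^sub>F v in generic_filter. pderivative k f v = 0"
  shows "\<exists>c. \<forall>\<^sub>F v in generic_filter. f v = c"
proof -
  obtain p q a where p: "analytic_in S p" "analytic_in S q" "q a \<noteq> 0" "\<And>v. q v \<noteq> 0 \<Longrightarrow> f v = p v / q v"
    using meromorphic_inE[OF assms(1)] by blast
  have S: "finite S" using p by (auto simp: analytic_in_def)
  have num: "pderivative k p v * q v - p v * pderivative k q v = 0" if "k \<in> S" for k v
  proof (rule analytic_in_eq_0_generic[where f="\<lambda>v. pderivative k p v * q v - p v * pderivative k q v" and v=v])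
    show "analytic_in S (\<lambda>v. pderivative k p v * q v - p v * pderivative k q v)"
      by (intro analytic_in_diff analytic_in_mult analytic_in_pderivative p)
    show "\<forall>\<^sub>F v in generic_filter. pderivative k p v * q v - p v * pderivative k q v = 0"
      using assms(2)[OF that] eventually_nonzero[OF p(2), OF p(3)]
      by eventually_elim (simp add: quotient_pderivative[OF p(1,2,4)])
  qed
  define c where "c = p a / q a"
  obtain r C where "r > 0" "power_series S a r C q" using p(2) unfolding analytic_in_iff by blast
  then obtain d where d: "d > 0" "\<And>v. (\<And>i. i \<in> S \<Longrightarrow> \<bar>v i - a i\<bar> \<le> d) \<Longrightarrow> \<bar>q v - q a\<bar> < \<bar>q a\<bar>"
    using power_series_continuous[OF S, of a r C q "\<bar>q a\<bar>"] p(3) by (metis zero_less_abs_iff)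
  have nz: "q v \<noteq> 0" if "\<And>i. i \<in> S \<Longrightarrow> \<bar>v i - a i\<bar> \<le> d" for v
    using d(2)[OF that] by auto
  \<comment> \<open>Inside the box the coordinates are moved from \<open>a\<close> to
    \<open>v\<close> one at a time; \<open>T\<close> is the set of those already moved. Every move
    follows a segment on which \<open>f\<close> has derivative 0.\<close>
  have const: "p (override_on a v T) = c * q (override_on a v T)"
    if "finite T" "T \<subseteq> S" and v: "\<And>i. i \<in> S \<Longrightarrow> \<bar>v i - a i\<bar> \<le> d" for v T
    using that(1,2)
  proof (induction T rule: finite_induct)
    case empty
    then show ?case using p(3) by (simp add: c_def)
  next
    case (insert k T)
    define u where "u = override_on a v T"
    define I where "I = {a k - d .. a k + d}"
    have box: "\<bar>(u(k := t)) i - a i\<bar> \<le> d" if "t \<in> I" "i \<in> S" for t i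
      using v[OF that(2)] that d(1) by (auto simp: u_def override_on_def I_def abs_le_iff)
    have "\<exists>C. \<forall>t\<in>I. f (u(k := t)) = C"
    proof (rule has_field_derivative_zero_constant)
      show "convex I" by (simp add: I_def)
      fix t assume t: "t \<in> I"
      have "q (u(k := t)) \<noteq> 0" using box[OF t] by (rule nz)
      moreover have "k \<in> S" using insert by simp
      ultimately have "((\<lambda>s. f (u(k := s))) has_field_derivative 0) (at t)"
        using quotient_DERIV[OF p(1,2,4), where v="u(k := t)" and k=k] num by simp
      then show "((\<lambda>t. f (u(k := t))) has_field_derivative 0) (at t within I)"
        by (rule has_field_derivative_at_within)
    qed
    moreover have "v k \<in> I" "a k \<in> I" using v[of k] insert d(1) by (auto simp: I_def abs_le_iff)
    ultimately have "f (u(k := v k)) = f (u(k := a k))" by auto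
    moreover have u: "u(k := a k) = u" using insert by (auto simp: u_def override_on_def)
    moreover have nzu: "q (u(k := v k)) \<noteq> 0" "q (u(k := a k)) \<noteq> 0"
      using box \<open>v k \<in> I\<close> \<open>a k \<in> I\<close> by (auto intro!: nz)
    moreover have "f u = c" using nzu(2) insert p(4)[of u] by (simp add: u) (simp add: u_def)
    ultimately have "p (u(k := v k)) = c * q (u(k := v k))" using p(4)[OF nzu(1)] by (simp add: divide_eq_eq)
    moreover have "u(k := v k) = override_on a v (insert k T)" by (auto simp: u_def override_on_def)
    ultimately show ?case by simp
  qed
  have "p v - c * q v = 0" for v
  proof (rule analytic_in_eq_0[where f="\<lambda>v. p v - c * q v" and v=v, OF _ d(1)])
    show "analytic_in S (\<lambda>v. p v - c * q v)"
      using S by (intro analytic_in_diff analytic_in_mult p) auto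
    fix v assume v: "\<And>i. i \<in> S \<Longrightarrow> \<bar>v i - a i\<bar> \<le> d"
    have "p v = p (override_on a v S)" "q v = q (override_on a v S)"
      by (rule analytic_in_cong[OF p(1)], simp, rule analytic_in_cong[OF p(2)], simp)
    then show "p v - c * q v = 0" using const[OF S order_refl v] by simp
  qed
  then have "\<forall>\<^sub>F v in generic_filter. f v = c"
    using eventually_nonzero[OF p(2), OF p(3)] by (auto elim!: eventually_mono simp: p(4) field_simps)
  then show ?thesis ..
qed

section \<open>Accessibility\<close>

lemma identically_zero_iff: "identically_zero f \<longleftrightarrow> (\<forall>\<^sub>F v in generic_filter. f v = 0)"
  by (simp add: identically_zero_def eventually_generic_filter)

lemma nonconstant_iff: "nonconstant f \<longleftrightarrow> \<not> (\<exists>c. \<forall>\<^sub>F v in generic_filter. f v = c)"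
  by (simp add: nonconstant_def eventually_generic_filter)

lemma nonconstant_coord: "nonconstant (\<lambda>v. v k)"
proof -
  have False if "\<forall>\<^sub>F v in generic_filter. v k = c" for c
    using pderivative_cong[OF that, of k] by (simp add: pderivative_coord)
  then show ?thesis unfolding nonconstant_iff by blast
qed

section \<open>Derivatives along a vector field\<close>

text \<open>\<open>g\<close> turns nodes into variables, namely by \<open>State\<close> for
  accessibility and by the identity for observability, so that both theories share these
  lemmas.\<close>

lemma meromorphic_flow:
  "meromorphic \<phi> \<Longrightarrow> (\<And>i. i \<in> X \<Longrightarrow> meromorphic (F i)) \<Longrightarrow>
   meromorphic (\<lambda>v. \<Sum>i\<in>X. pderivative (g i) \<phi> v * F i v)"
  by (intro meromorphic_sum meromorphic_mult meromorphic_pderivative)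

text \<open>The terms with second derivatives of \<open>\<phi>\<close> disappear from the product
  rule, because derivatives commute and \<open>\<phi>\<close> does not depend on
  \<open>m\<close>.\<close>

lemma pderivative_flow:
  assumes X: "finite X" and \<phi>: "meromorphic \<phi>" and F: "\<And>i. i \<in> X \<Longrightarrow> meromorphic (F i)"
    and m: "\<forall>\<^sub>F v in generic_filter. pderivative m \<phi> v = 0"
  shows "\<forall>\<^sub>F v in generic_filter. pderivative m (\<lambda>v. \<Sum>i\<in>X. pderivative (g i) \<phi> v * F i v) v =
     (\<Sum>i\<in>X. pderivative (g i) \<phi> v * pderivative m (F i) v)"
proof -
  have "\<forall>\<^sub>F v in generic_filter. \<forall>i\<in>X.
     pderivative m (\<lambda>v. pderivative (g i) \<phi> v * F i v) v = pderivative (g i) \<phi> v * pderivative m (F i) v"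
  proof (rule eventually_ball_finite[OF X], rule ballI)
    fix i assume i: "i \<in> X"
    from pderivative_mult[OF meromorphic_pderivative[OF \<phi>] F[OF i], of m "g i"]
      mixed_pderivative[OF \<phi>, of m "g i"] pderivative_zero_cong[OF m, of "g i"]
    show "\<forall>\<^sub>F v in generic_filter. pderivative m (\<lambda>v. pderivative (g i) \<phi> v * F i v) v
        = pderivative (g i) \<phi> v * pderivative m (F i) v"
      by eventually_elim simp
  qed
  moreover have "\<forall>\<^sub>F v in generic_filter. pderivative m (\<lambda>v. \<Sum>i\<in>X. pderivative (g i) \<phi> v * F i v) v =
     (\<Sum>i\<in>X. pderivative m (\<lambda>v. pderivative (g i) \<phi> v * F i v) v)"
    by (rule pderivative_sum[OF X, of "\<lambda>i v. pderivative (g i) \<phi> v * F i v"])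
      (rule meromorphic_mult[OF meromorphic_pderivative[OF \<phi>] F])
  ultimately show ?thesis by eventually_elim simp
qed

text \<open>The induction step for showing that iterated derivatives never acquire the variable
  \<open>m\<close>: by \<open>z\<close> every surviving summand of \<open>pderivative_flow\<close>
  has a vanishing factor.\<close>

lemma pderivative_flow_eq_0:
  assumes X: "finite X" and \<phi>: "meromorphic \<phi>" and F: "\<And>i. i \<in> X \<Longrightarrow> meromorphic (F i)"
    and m: "\<forall>\<^sub>F v in generic_filter. pderivative m \<phi> v = 0"
    and \<psi>: "\<forall>\<^sub>F v in generic_filter. \<psi> v = (\<Sum>i\<in>X. pderivative (g i) \<phi> v * F i v)"
    and z: "\<And>i. i \<in> X \<Longrightarrow> (\<forall>\<^sub>F v in generic_filter. pderivative (g i) \<phi> v = 0) \<or>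
                         (\<forall>\<^sub>F v in generic_filter. pderivative m (F i) v = 0)"
  shows "\<forall>\<^sub>F v in generic_filter. pderivative m \<psi> v = 0"
proof -
  have "\<forall>\<^sub>F v in generic_filter. \<forall>i\<in>X. pderivative (g i) \<phi> v * pderivative m (F i) v = 0"
  proof (rule eventually_ball_finite[OF X], rule ballI)
    fix i assume "i \<in> X"
    from z[OF this] show "\<forall>\<^sub>F v in generic_filter. pderivative (g i) \<phi> v * pderivative m (F i) v = 0"
      by (auto elim: eventually_mono)
  qed
  moreover have "\<forall>\<^sub>F v in generic_filter. pderivative m (\<lambda>v. \<Sum>i\<in>X. pderivative (g i) \<phi> v * F i v) v =
     (\<Sum>i\<in>X. pderivative (g i) \<phi> v * pderivative m (F i) v)"
    by (rule pderivative_flow[OF X \<phi> _ m]) (rule F)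
  ultimately show ?thesis
    using pderivative_cong[OF \<psi>, of m]
    by eventually_elim (simp add: sum.neutral)
qed

text \<open>Infinitely many generic identities cannot simply be intersected. The hypothesis is used
  for the finitely many variables of \<open>\<phi>\<close> only, and
  \<open>pderivative_outside\<close> treats all others simultaneously.\<close>

lemma time_derivative_eq_flow:
  assumes \<phi>: "meromorphic \<phi>"
    and z: "\<And>j k. \<forall>\<^sub>F v in generic_filter. pderivative (Input j k) \<phi> v = 0"
  shows "\<forall>\<^sub>F v in generic_filter.
    time_derivative X M f \<phi> v = (\<Sum>i\<in>X. pderivative (State i) \<phi> v * f i v)"
proof -
  obtain S where S: "meromorphic_in S \<phi>" using \<phi> by (auto simp: meromorphic_def)
  have "\<forall>\<^sub>F v in generic_filter. \<forall>m\<in>S. \<forall>j k. m = Input j k \<longrightarrow> pderivative m \<phi> v = 0"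
  proof (rule eventually_ball_finite[OF meromorphic_in_finite[OF S]], rule ballI)
    fix m
    show "\<forall>\<^sub>F v in generic_filter. \<forall>j k. m = Input j k \<longrightarrow> pderivative m \<phi> v = 0"
      using z by (cases m) (auto elim: eventually_mono)
  qed
  with pderivative_outside[OF S] show ?thesis
  proof eventually_elim
    case (elim v)
    then have "pderivative (Input j k) \<phi> v = 0" for j k by (cases "Input j k \<in> S") auto
    then show ?case by (simp add: time_derivative_def)
  qed
qed

text \<open>
  The Euler operator \<open>v k * d/dv k\<close> multiplies the \<open>i\<close>-th summand by \<open>m i\<close>, which allows
  eliminating the summands one by one.
\<close>

lemma powers_independent:
  assumes "finite I" "inj_on m I" "\<And>i. i \<in> I \<Longrightarrow> meromorphic (b i)"
    "\<And>i. i \<in> I \<Longrightarrow> \<forall>\<^sub>F v in generic_filter. pderivative k (b i) v = 0"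
    "\<forall>\<^sub>F v in generic_filter. (\<Sum>i\<in>I. v k ^ m i * b i v) = 0" "i \<in> I"
  shows "\<forall>\<^sub>F v in generic_filter. b i v = 0"
  using assms
proof (induction I arbitrary: b i rule: finite_induct)
  case (insert i0 I)
  let ?t = "\<lambda>i v. v k ^ m i * b i v"
  have mero: "meromorphic (?t i)" if "i \<in> insert i0 I" for i
    using insert.prems(2)[OF that] by (intro meromorphic_mult meromorphic_power) auto
  have pow: "pderivative k (\<lambda>v. v k ^ n) v = real n * v k ^ (n - 1)" for n and v :: "'b \<Rightarrow> real"
    unfolding pderivative_def by (rule DERIV_imp_deriv) (auto intro!: derivative_eq_intros)
  have "\<forall>\<^sub>F v in generic_filter. \<forall>i\<in>insert i0 I. v k * pderivative k (?t i) v = real (m i) * ?t i v"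
  proof (rule eventually_ball_finite, use insert.hyps in simp, rule ballI)
    fix i assume i: "i \<in> insert i0 I"
    have "\<forall>\<^sub>F v in generic_filter. pderivative k (\<lambda>v. v k ^ m i * b i v) v =
       pderivative k (\<lambda>v. v k ^ m i) v * b i v + v k ^ m i * pderivative k (b i) v"
      by (rule pderivative_mult[OF _ insert.prems(2)[OF i]]) (simp add: meromorphic_power)
    with insert.prems(3)[OF i]
    show "\<forall>\<^sub>F v in generic_filter. v k * pderivative k (?t i) v = real (m i) * ?t i v"
    proof eventually_elim
      case (elim v)
      then have "pderivative k (?t i) v = real (m i) * v k ^ (m i - 1) * b i v" by (simp only: pow mult_zero_right add_0_right)
      then show ?case by (cases "m i") simp_all
    qed
  qed
  moreover have "\<forall>\<^sub>F v in generic_filter. pderivative k (\<lambda>v. \<Sum>i\<in>insert i0 I. ?t i v) v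
      = (\<Sum>i\<in>insert i0 I. pderivative k (?t i) v)"
    by (rule pderivative_sum) (use insert.hyps mero in auto)
  ultimately have "\<forall>\<^sub>F v in generic_filter. (\<Sum>i\<in>insert i0 I. real (m i) * ?t i v) = 0"
    using pderivative_zero_cong[OF insert.prems(4), of k]
  proof eventually_elim
    case (elim v)
    have "(\<Sum>i\<in>insert i0 I. real (m i) * ?t i v) = (\<Sum>i\<in>insert i0 I. v k * pderivative k (?t i) v)"
      using elim(1) by (intro sum.cong) auto
    also have "\<dots> = v k * (\<Sum>i\<in>insert i0 I. pderivative k (?t i) v)" by (simp add: sum_distrib_left)
    also have "\<dots> = 0" using elim(2,3) by simp
    finally show ?case .
  qed
  with insert.prems(4)
  have red: "\<forall>\<^sub>F v in generic_filter. (\<Sum>i\<in>I. v k ^ m i * ((real (m i) - real (m i0)) * b i v)) = 0"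
  proof eventually_elim
    case (elim v)
    have "0 = (\<Sum>i\<in>insert i0 I. real (m i) * ?t i v) - real (m i0) * (\<Sum>i\<in>insert i0 I. ?t i v)"
      using elim by simp
    also have "\<dots> = (\<Sum>i\<in>insert i0 I. v k ^ m i * ((real (m i) - real (m i0)) * b i v))"
      by (simp add: sum_distrib_left sum_subtractf[symmetric] algebra_simps del: sum.insert)
    also have "\<dots> = (\<Sum>i\<in>I. v k ^ m i * ((real (m i) - real (m i0)) * b i v))"
      using insert.hyps by simp
    finally show ?case by simp
  qed
  have I: "\<forall>\<^sub>F v in generic_filter. b i v = 0" if i: "i \<in> I" for i
  proof -
    have "\<forall>\<^sub>F v in generic_filter. (real (m i) - real (m i0)) * b i v = 0"
    proof (rule insert.IH[OF _ _ _ red i])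
      show "inj_on m I" using insert.prems(1) by simp
      fix l assume l: "l \<in> I"
      then show "meromorphic (\<lambda>v. (real (m l) - real (m i0)) * b l v)"
        using insert.prems(2) by (intro meromorphic_mult) auto
      have "\<forall>\<^sub>F v in generic_filter. pderivative k (\<lambda>v. (real (m l) - real (m i0)) * b l v) v =
          pderivative k (\<lambda>v. real (m l) - real (m i0)) v * b l v + (real (m l) - real (m i0)) * pderivative k (b l) v"
        by (rule pderivative_mult[of "\<lambda>_. real (m l) - real (m i0)"]) (use insert.prems(2) l in auto)
      moreover have "\<forall>\<^sub>F v in generic_filter. pderivative k (b l) v = 0" using insert.prems(3) l by simp
      ultimately show "\<forall>\<^sub>F v in generic_filter. pderivative k (\<lambda>v. (real (m l) - real (m i0)) * b l v) v = 0"
        by eventually_elim simp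
    qed
    moreover have "m i \<noteq> m i0" using insert.prems(1) insert.hyps i by (auto simp: inj_on_def)
    ultimately show ?thesis by simp
  qed
  show ?case
  proof (cases "i = i0")
    case True
    have "\<forall>\<^sub>F v in generic_filter. \<forall>i\<in>I. b i v = 0"
      using insert.hyps I by (intro eventually_ball_finite) auto
    moreover have "\<forall>\<^sub>F v in generic_filter. (v :: 'b \<Rightarrow> real) k \<noteq> 0"
      by (rule eventually_nonzero[of "{k}" "\<lambda>v. v k" "\<lambda>_. 1"]) (auto intro: analytic_in_coord)
    ultimately have "\<forall>\<^sub>F v in generic_filter. b i0 v = 0"
      using insert.prems(4)
    proof eventually_elim
      case (elim v)
      then show ?case using insert.hyps by simp
    qed
    with True show ?thesis by simp
  next
    case False
    then show ?thesis using I insert.prems(5) by simp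
  qed
qed simp

section \<open>The network vector field\<close>

definition network_field :: "('a \<times> 'a) set \<Rightarrow> ('a \<Rightarrow> 'a \<Rightarrow> nat) \<Rightarrow> 'a \<Rightarrow> ('a \<Rightarrow> real) \<Rightarrow> real" where
  "network_field A n i x = 1 + (\<Sum>j | (j, i) \<in> A. x j ^ n j i)"

lemma analytic_in_sum:
  assumes "finite S" "\<And>i. i \<in> I \<Longrightarrow> analytic_in S (f i)"
  shows "analytic_in S (\<lambda>v. \<Sum>i\<in>I. f i v)"
  using assms(2)
  by (induction I rule: infinite_finite_induct) (use assms(1) in \<open>auto intro: analytic_in_add\<close>)

lemma analytic_in_power: "analytic_in S f \<Longrightarrow> analytic_in S (\<lambda>v. f v ^ n)"
  by (induction n) (auto intro: analytic_in_mult simp: analytic_in_def[of S f])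

lemma analytic_in_network_field:
  assumes "finite S" "\<And>j. (j, i) \<in> A \<Longrightarrow> g j \<in> S"
  shows "analytic_in S (\<lambda>v. network_field A n i (\<lambda>j. v (g j)))"
  unfolding network_field_def using assms
  by (intro analytic_in_add analytic_in_sum analytic_in_power analytic_in_coord) auto

lemma pderivative_network_field:
  assumes A: "finite A" and g: "inj g"
  shows "pderivative (g j) (\<lambda>v. network_field A n i (\<lambda>j. v (g j))) v =
     (if (j, i) \<in> A then real (n j i) * v (g j) ^ (n j i - 1) else 0)"
proof -
  have fin: "finite {l. (l, i) \<in> A}"
    by (rule finite_subset[of _ "fst ` A"]) (use A in force)+
  have "((\<lambda>t. ((v(g j := t)) (g l)) ^ n l i) has_field_derivative
      (if l = j then real (n j i) * v (g j) ^ (n j i - 1) else 0)) (at (v (g j)))" for l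
  proof (cases "l = j")
    case True
    then show ?thesis by (auto intro!: derivative_eq_intros)
  next
    case False
    then have "g l \<noteq> g j" using g by (auto dest: injD)
    then show ?thesis using False by simp
  qed
  then have "((\<lambda>t. 1 + (\<Sum>l | (l, i) \<in> A. ((v(g j := t)) (g l)) ^ n l i)) has_field_derivative
      0 + (\<Sum>l | (l, i) \<in> A. if l = j then real (n j i) * v (g j) ^ (n j i - 1) else 0)) (at (v (g j)))"
    by (intro DERIV_add DERIV_const DERIV_sum)
  then have "deriv (\<lambda>t. 1 + (\<Sum>l | (l, i) \<in> A. ((v(g j := t)) (g l)) ^ n l i)) (v (g j)) =
      (\<Sum>l | (l, i) \<in> A. if l = j then real (n j i) * v (g j) ^ (n j i - 1) else 0)"
    by (simp add: DERIV_imp_deriv)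
  also have "\<dots> = (if (j, i) \<in> A then real (n j i) * v (g j) ^ (n j i - 1) else 0)"
    using fin by (simp add: sum.delta)
  finally show ?thesis unfolding pderivative_def network_field_def .
qed

lemma identically_zero_network_field_iff:
  assumes A: "finite A" and g: "inj g" and n: "n j i > 0"
  shows "identically_zero (pderivative (g j) (\<lambda>v. network_field A n i (\<lambda>j. v (g j)))) \<longleftrightarrow> (j, i) \<notin> A"
proof (cases "(j, i) \<in> A")
  case True
  have "\<not> (\<forall>\<^sub>F v in generic_filter. real (n j i) * v (g j) ^ (n j i - 1) = 0)"
  proof
    assume z: "\<forall>\<^sub>F v in generic_filter. real (n j i) * v (g j) ^ (n j i - 1) = 0"
    have an: "analytic_in {g j} (\<lambda>v. real (n j i) * v (g j) ^ (n j i - 1))"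
      by (intro analytic_in_mult analytic_in_power analytic_in_coord) auto
    \<comment> \<open>At the point with all coordinates 1 the function has the value
      \<open>n j i\<close>, which is positive.\<close>
    show False using analytic_in_eq_0_generic[OF an z, of "\<lambda>_. 1"] n by simp
  qed
  then show ?thesis using True by (simp add: identically_zero_iff pderivative_network_field[OF A g])
next
  case False
  then show ?thesis by (simp add: identically_zero_iff pderivative_network_field[OF A g])
qed

section \<open>Autonomous elements of undriven components\<close>

text \<open>On \<open>H\<close> the field involves the variables of \<open>H\<close> alone, so all
  time derivatives of a coordinate in \<open>H\<close> remain functions of these variables and no
  input can enter.\<close>

lemma not_accessible_if_undriven:
  assumes X: "finite X" and H: "H \<subseteq> X" "i0 \<in> H"
    and f: "\<And>i. i \<in> X \<Longrightarrow> meromorphic_in (State ` X \<union> (\<lambda>j. Input j 0) ` {1..M}) (f i)"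
    and fH: "\<And>i j. i \<in> H \<Longrightarrow> j \<in> X - H \<Longrightarrow> identically_zero (pderivative (State j) (f i))"
    and fu: "\<And>i j. i \<in> H \<Longrightarrow> j \<in> {1..M} \<Longrightarrow> identically_zero (pderivative (Input j 0) (f i))"
  shows "\<not> accessible X M f"
proof -
  let ?\<xi> = "\<lambda>v. v (State i0)"
  have fm: "meromorphic (f i)" if "i \<in> X" for i using f[OF that] by (rule meromorphicI)
  have out: "\<forall>\<^sub>F v in generic_filter. pderivative m (f i) v = 0" if i: "i \<in> H" and m: "m \<notin> State ` H" for i m
  proof (cases "m \<in> State ` X \<union> (\<lambda>j. Input j 0) ` {1..M}")
    case True
    then show ?thesis using fH[OF i] fu[OF i] m unfolding identically_zero_iff by auto
  next
    case False
    have "i \<in> X" using i H by auto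
    from pderivative_outside[OF f[OF this]] show ?thesis
      by eventually_elim (use False in auto)
  qed
  have inv: "meromorphic ((time_derivative X M f ^^ k) ?\<xi>) \<and>
     (\<forall>m. m \<notin> State ` H \<longrightarrow> (\<forall>\<^sub>F v in generic_filter. pderivative m ((time_derivative X M f ^^ k) ?\<xi>) v = 0))" for k
  proof (induction k)
    case 0
    then show ?case using H(2) by (auto simp: pderivative_coord)
  next
    case (Suc k)
    define \<phi> where "\<phi> = (time_derivative X M f ^^ k) ?\<xi>"
    have \<phi>: "meromorphic \<phi>" and z: "\<And>m. m \<notin> State ` H \<Longrightarrow> \<forall>\<^sub>F v in generic_filter. pderivative m \<phi> v = 0"
      using Suc by (auto simp: \<phi>_def)
    have eq: "\<forall>\<^sub>F v in generic_filter. time_derivative X M f \<phi> v = (\<Sum>i\<in>X. pderivative (State i) \<phi> v * f i v)"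
      by (rule time_derivative_eq_flow[OF \<phi>]) (rule z, auto)
    have "meromorphic (time_derivative X M f \<phi>)"
      by (rule meromorphic_cong[OF meromorphic_flow[where F=f, OF \<phi> fm] eq])
    moreover have "\<forall>\<^sub>F v in generic_filter. pderivative m (time_derivative X M f \<phi>) v = 0" if m: "m \<notin> State ` H" for m
    proof (rule pderivative_flow_eq_0[where F=f and g=State, OF X \<phi> fm z[OF m] eq])
      fix i assume "i \<in> X"
      show "(\<forall>\<^sub>F v in generic_filter. pderivative (State i) \<phi> v = 0) \<or> (\<forall>\<^sub>F v in generic_filter. pderivative m (f i) v = 0)"
        using z[of "State i"] out[OF _ m, of i] by (cases "i \<in> H") auto
    qed
    ultimately show ?case by (simp add: \<phi>_def)
  qed
  have "autonomous_element X M f ?\<xi>"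
    unfolding autonomous_element_def identically_zero_iff
  proof (intro conjI nonconstant_coord allI ballI)
    show "meromorphic_in (State ` X) ?\<xi>"
      using X H by (intro analytic_imp_meromorphic_in analytic_in_coord) auto
    show "\<forall>\<^sub>F v in generic_filter. pderivative (Input j 0) ((time_derivative X M f ^^ k) ?\<xi>) v = 0" for k j
      using inv[of k] by auto
  qed
  then show ?thesis unfolding accessible_def by blast
qed

section \<open>Accessibility of the network\<close>

text \<open>Accessibility and the prescribed edge pattern are proved together, as both rest on the
  explicit derivatives \<open>pdState\<close> and \<open>pdInput\<close>.\<close>

lemma accessible_network:
  assumes X: "finite X" and A: "A \<subseteq> X \<times> X" and D: "D \<subseteq> X"
    and n: "\<And>j. inj_on (n j) {i. (j, i) \<in> A}" "\<And>i j. (j, i) \<in> A \<Longrightarrow> n j i > 0"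
    and u: "inj_on u D" "u ` D \<subseteq> {1..M}"
    and reach: "\<And>i. i \<in> X \<Longrightarrow> \<exists>d\<in>D. (d, i) \<in> A\<^sup>*"
    and f: "f = (\<lambda>i v. network_field A n i (\<lambda>j. v (State j)) + (if i \<in> D then v (Input (u i) 0) else 0))"
  shows "accessible X M f"
    and "i \<in> X \<Longrightarrow> meromorphic_in (State ` X \<union> (\<lambda>j. Input j 0) ` {1..M}) (f i)"
    and "i \<in> X \<Longrightarrow> j \<in> X \<Longrightarrow> \<not> identically_zero (pderivative (State j) (f i)) \<longleftrightarrow> (j, i) \<in> A"
    and "i \<in> X \<Longrightarrow> \<not> identically_zero (pderivative (Input l 0) (f i)) \<longleftrightarrow> i \<in> D \<and> u i = l"
proof -
  have finA: "finite A" using A X by (meson finite_SigmaI finite_subset)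
  let ?S = "State ` X \<union> (\<lambda>j. Input j 0) ` {1..M}"
  have finS: "finite ?S" using X by simp
  have an1: "analytic_in ?S (\<lambda>v. network_field A n i (\<lambda>j. v (State j)))" for i
    using A by (intro analytic_in_network_field finS) auto
  have an2: "analytic_in ?S (\<lambda>v. if i \<in> D then v (Input (u i) 0) else 0)" for i
  proof (cases "i \<in> D")
    case True
    then have "u i \<in> {1..M}" using u by auto
    then have "analytic_in ?S (\<lambda>v. v (Input (u i) 0))" by (intro analytic_in_coord finS) auto
    then show ?thesis using True by simp
  qed (use finS in simp)
  show fmi: "meromorphic_in ?S (f i)" for i
    unfolding f by (intro analytic_imp_meromorphic_in analytic_in_add an1 an2)
  have fm: "meromorphic (f i)" for i by (rule meromorphicI[OF fmi])
  have pd2: "pderivative m (\<lambda>v. if i \<in> D then v (Input (u i) 0) else 0) v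
      = (if i \<in> D \<and> m = Input (u i) 0 then 1 else 0)" for m i and v :: "'a sys_var \<Rightarrow> real"
    by (cases "i \<in> D") (auto simp: pderivative_coord)
  have pd: "pderivative m (f i) v = pderivative m (\<lambda>v. network_field A n i (\<lambda>j. v (State j))) v
      + (if i \<in> D \<and> m = Input (u i) 0 then 1 else 0)" for m i v
    unfolding f by (simp add: analytic_in_pderivative_add[OF an1 an2] pd2)
  have pdState: "pderivative (State j) (f i) v =
      (if (j, i) \<in> A then real (n j i) * v (State j) ^ (n j i - 1) else 0)" for i j v
    unfolding pd by (subst pderivative_network_field[OF finA]) (auto simp: inj_def)
  have "analytic_in (State ` X) (\<lambda>v. network_field A n i (\<lambda>j. v (State j)))" for i
    using A X by (intro analytic_in_network_field) auto
  then have pdInput: "pderivative (Input j k) (f i) v = (if i \<in> D \<and> j = u i \<and> k = 0 then 1 else 0)" for i j k v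
    unfolding pd by (subst pderivative_eq_0) auto
  show "\<not> identically_zero (pderivative (State j) (f i)) \<longleftrightarrow> (j, i) \<in> A" for i j
  proof -
    have eq: "pderivative (State j) (f i) = pderivative (State j) (\<lambda>v. network_field A n i (\<lambda>j. v (State j)))"
      by (rule ext) (simp add: pd)
    show ?thesis
    proof (cases "(j, i) \<in> A")
      case True
      then show ?thesis
        using identically_zero_network_field_iff[OF finA, of State n j i] n(2)[of j i] by (simp add: eq inj_def)
    next
      case False
      then show ?thesis unfolding identically_zero_iff pdState by simp
    qed
  qed
  show "\<not> identically_zero (pderivative (Input l 0) (f i)) \<longleftrightarrow> i \<in> D \<and> u i = l" for i l
    unfolding identically_zero_iff pdInput by auto
  have False if aut: "autonomous_element X M f \<xi>" for \<xi>
  proof -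
    define \<phi> where "\<phi> = (\<lambda>k. (time_derivative X M f ^^ k) \<xi>)"
    have \<xi>: "meromorphic_in (State ` X) \<xi>" "nonconstant \<xi>"
      and au: "\<And>k j. j \<in> {1..M} \<Longrightarrow> \<forall>\<^sub>F v in generic_filter. pderivative (Input j 0) (\<phi> k) v = 0"
      using aut by (auto simp: autonomous_element_def identically_zero_iff \<phi>_def)
    have \<phi>_Suc: "\<phi> (Suc k) = time_derivative X M f (\<phi> k)" for k by (simp add: \<phi>_def)
    \<comment> \<open>Autonomy excludes only the inputs \<open>1..M\<close> of order 0. Every other
      input variable is absent from \<open>f\<close> and therefore cannot enter when a function free
      of inputs is differentiated.\<close>
    have inv: "meromorphic (\<phi> k) \<and> (\<forall>j l. \<forall>\<^sub>F v in generic_filter. pderivative (Input j l) (\<phi> k) v = 0)" for k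
    proof (induction k)
      case 0
      have "\<forall>\<^sub>F v in generic_filter. pderivative (Input j l) (\<phi> 0) v = 0" for j l
        using pderivative_outside[OF \<xi>(1)] by eventually_elim (auto simp: \<phi>_def)
      then show ?case using \<xi>(1) by (auto simp: \<phi>_def intro: meromorphicI)
    next
      case (Suc k)
      then have m: "meromorphic (\<phi> k)" and z: "\<And>j l. \<forall>\<^sub>F v in generic_filter. pderivative (Input j l) (\<phi> k) v = 0"
        by auto
      note eq = time_derivative_eq_flow[OF m z, of X M f, folded \<phi>_Suc]
      have "\<forall>\<^sub>F v in generic_filter. pderivative (Input j l) (\<phi> (Suc k)) v = 0" for j l
      proof (cases "j \<in> {1..M} \<and> l = 0")
        case True
        then show ?thesis using au by auto
      next
        case False
        have "pderivative (Input j l) (f i) v = 0" for i v using False u(2) by (auto simp: pdInput)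
        then show ?thesis by (intro pderivative_flow_eq_0[where F=f and g=State, OF X m fm z eq]) auto
      qed
      moreover have "meromorphic (\<phi> (Suc k))" by (rule meromorphic_cong[OF meromorphic_flow[where F=f, OF m fm] eq])
      ultimately show ?case by blast
    qed
    then have m: "\<And>k. meromorphic (\<phi> k)" and z: "\<And>k j l. \<forall>\<^sub>F v in generic_filter. pderivative (Input j l) (\<phi> k) v = 0"
      by auto
    have flow: "\<forall>\<^sub>F v in generic_filter. pderivative y (\<phi> (Suc k)) v = (\<Sum>i\<in>X. pderivative (State i) (\<phi> k) v * pderivative y (f i) v)"
      if "\<forall>\<^sub>F v in generic_filter. pderivative y (\<phi> k) v = 0" for y k
      using pderivative_flow[where g=State and F=f, OF X m fm that]
        pderivative_cong[OF time_derivative_eq_flow[OF m z, of X M f k], of y]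
      by eventually_elim (simp add: \<phi>_Suc)
    \<comment> \<open>All orders are treated at once, because the relation for the successors of
      \<open>j\<close> at order \<open>k\<close> comes from the vanishing
      \<open>j\<close>-derivative at order \<open>Suc k\<close>.\<close>
    have zero: "\<forall>\<^sub>F v in generic_filter. pderivative (State i) (\<phi> k) v = 0" if "d \<in> D" "(d, i) \<in> A\<^sup>*" for d i k
      using that(2)
    proof (induction arbitrary: k rule: rtrancl_induct)
      case base
      \<comment> \<open>By injectivity of \<open>u\<close> the input of \<open>d\<close> enters
        \<open>f\<close> at \<open>d\<close> only, with coefficient 1, so the sum collapses to the
        single derivative in question.\<close>
      from flow[OF z[of "u d" 0 k]] z[of "u d" 0 "Suc k"] show ?case
      proof eventually_elim
        case (elim v)
        have "(\<Sum>i\<in>X. pderivative (State i) (\<phi> k) v * pderivative (Input (u d) 0) (f i) v) =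
            (\<Sum>i\<in>X. if i = d then pderivative (State d) (\<phi> k) v else 0)"
          by (rule sum.cong) (use u(1) \<open>d \<in> D\<close> in \<open>auto simp: pdInput inj_on_def\<close>)
        also have "\<dots> = pderivative (State d) (\<phi> k) v" using X D \<open>d \<in> D\<close> by (simp add: sum.delta subset_iff)
        finally show ?case using elim by simp
      qed
    next
      case (step j i)
      \<comment> \<open>Differentiating \<open>x ^ n\<close> leaves the factor \<open>n\<close>,
        which is moved into the coefficient, and the exponent \<open>n - 1\<close>. These exponents
        stay distinct because the original ones are positive. The coefficients do not depend on the
        state of \<open>j\<close>, since derivatives commute.\<close>
      let ?b = "\<lambda>i v. real (n j i) * pderivative (State i) (\<phi> k) v"
      have fin: "finite {i. (j, i) \<in> A}" by (rule finite_subset[OF _ X]) (use A in auto)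
      have "\<forall>\<^sub>F v in generic_filter. ?b i v = 0"
      proof (rule powers_independent[where I="{i. (j, i) \<in> A}" and m="\<lambda>i. n j i - 1" and k="State j" and b="?b", OF fin])
        show "inj_on (\<lambda>i. n j i - 1) {i. (j, i) \<in> A}"
          using n by (auto simp: inj_on_def) (metis Suc_pred)
        show "meromorphic (?b i)" for i
          by (intro meromorphic_mult meromorphic_pderivative m) simp
        show "\<forall>\<^sub>F v in generic_filter. pderivative (State j) (?b i) v = 0" for i
        proof -
          have "\<forall>\<^sub>F v in generic_filter. pderivative (State j) (?b i) v =
             pderivative (State j) (\<lambda>_. real (n j i)) v * pderivative (State i) (\<phi> k) v
             + real (n j i) * pderivative (State j) (pderivative (State i) (\<phi> k)) v"
            by (rule pderivative_mult[of "\<lambda>_. real (n j i)"]) (simp, rule meromorphic_pderivative[OF m])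
          then show ?thesis
            using mixed_pderivative[OF m, of "State j" "State i" k] pderivative_zero_cong[OF step.IH, of "State i" k]
            by eventually_elim simp
        qed
        show "\<forall>\<^sub>F v in generic_filter. (\<Sum>i | (j, i) \<in> A. v (State j) ^ (n j i - 1) * ?b i v) = 0"
          using flow[OF step.IH, of k] step.IH[of "Suc k"]
        proof eventually_elim
          case (elim v)
          have "(\<Sum>i\<in>X. pderivative (State i) (\<phi> k) v * pderivative (State j) (f i) v) =
              (\<Sum>i | (j, i) \<in> A. v (State j) ^ (n j i - 1) * ?b i v)"
            using A by (intro sum.mono_neutral_cong_right X) (auto simp: pdState)
          then show ?case using elim by simp
        qed
        show "i \<in> {i. (j, i) \<in> A}" using step by simp
      qed
      moreover have "n j i > 0" using n step by simp
      ultimately show ?case by simp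
    qed
    have "\<exists>c. \<forall>\<^sub>F v in generic_filter. \<xi> v = c"
    proof (rule generically_constant[OF \<xi>(1)])
      fix y assume "y \<in> State ` X"
      then obtain i where i: "i \<in> X" "y = State i" by blast
      from reach[OF i(1)] zero[of _ i 0] show "\<forall>\<^sub>F v in generic_filter. pderivative y \<xi> v = 0"
        by (auto simp: i \<phi>_def)
    qed
    then show False using \<xi>(2) by (simp add: nonconstant_iff)
  qed
  then show "accessible X M f" unfolding accessible_def by blast
qed

section \<open>Observability\<close>

text \<open>Neither the outputs nor the field outside \<open>H\<close> involve variables of
  \<open>H\<close>, so no Lie derivative of an output does. Every differential in the span has
  \<open>i0\<close>-component 0, whereas that of the coordinate \<open>i0\<close> is 1.\<close>

lemma not_observable_if_unsensed:
  assumes X: "finite X" and H: "H \<subseteq> X" "i0 \<in> H"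
    and f: "\<And>i. i \<in> X \<Longrightarrow> meromorphic_in X (f i)"
    and h: "\<And>j. j \<in> {1..P} \<Longrightarrow> meromorphic_in X (h j)"
    and fH: "\<And>i j. i \<in> X - H \<Longrightarrow> j \<in> H \<Longrightarrow> identically_zero (pderivative j (f i))"
    and hH: "\<And>i j. j \<in> {1..P} \<Longrightarrow> i \<in> H \<Longrightarrow> identically_zero (pderivative i (h j))"
  shows "\<not> observable X P f h"
proof -
  have fm: "meromorphic (f i)" if "i \<in> X" for i using f[OF that] by (rule meromorphicI)
  have inv: "meromorphic ((lie_derivative X f ^^ k) (h j)) \<and>
     (\<forall>m\<in>H. \<forall>\<^sub>F x in generic_filter. pderivative m ((lie_derivative X f ^^ k) (h j)) x = 0)" if j: "j \<in> {1..P}" for k j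
  proof (induction k)
    case 0
    then show ?case using meromorphicI[OF h[OF j]] hH[OF j] by (auto simp: identically_zero_iff)
  next
    case (Suc k)
    define \<phi> where "\<phi> = (lie_derivative X f ^^ k) (h j)"
    have \<phi>: "meromorphic \<phi>" and z: "\<And>m. m \<in> H \<Longrightarrow> \<forall>\<^sub>F x in generic_filter. pderivative m \<phi> x = 0"
      using Suc by (auto simp: \<phi>_def)
    have eq: "\<forall>\<^sub>F x in generic_filter. lie_derivative X f \<phi> x = (\<Sum>i\<in>X. pderivative i \<phi> x * f i x)"
      by (simp add: lie_derivative_def)
    have "meromorphic (lie_derivative X f \<phi>)"
      by (rule meromorphic_cong[OF meromorphic_flow[where F=f, OF \<phi> fm] eq])
    moreover have "\<forall>\<^sub>F x in generic_filter. pderivative m (lie_derivative X f \<phi>) x = 0" if m: "m \<in> H" for m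
    proof (rule pderivative_flow_eq_0[where F=f and g="\<lambda>i. i", OF X \<phi> fm z[OF m] eq])
      fix i assume "i \<in> X"
      then show "(\<forall>\<^sub>F x in generic_filter. pderivative i \<phi> x = 0) \<or> (\<forall>\<^sub>F x in generic_filter. pderivative m (f i) x = 0)"
        using z[of i] fH[of i m] m by (cases "i \<in> H") (auto simp: identically_zero_iff)
    qed
    ultimately show ?case by (simp add: \<phi>_def)
  qed
  have "\<not> in_output_span X P f h k (\<lambda>x. x i0)" for k
  proof
    assume "in_output_span X P f h k (\<lambda>x. x i0)"
    then obtain c where c: "\<forall>\<^sub>F x in generic_filter. pderivative i0 (\<lambda>x. x i0) x =
           (\<Sum>j=1..P. \<Sum>l\<le>k. c j l x * pderivative i0 ((lie_derivative X f ^^ l) (h j)) x)"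
      using H unfolding in_output_span_def eventually_generic_filter[symmetric] by blast
    have "\<forall>\<^sub>F x in generic_filter. \<forall>j\<in>{1..P}. \<forall>l\<in>{..k}. pderivative i0 ((lie_derivative X f ^^ l) (h j)) x = 0"
      using inv H(2) by (intro eventually_ball_finite ballI) auto
    with c have "\<forall>\<^sub>F x :: 'a \<Rightarrow> real in generic_filter. False"
      by eventually_elim (simp add: pderivative_coord)
    then show False by simp
  qed
  moreover have "meromorphic_in X (\<lambda>x. x i0)"
    using X H by (intro analytic_imp_meromorphic_in analytic_in_coord) auto
  ultimately have "hidden_element X P f h (\<lambda>x. x i0)"
    by (simp add: hidden_element_def nonconstant_coord)
  then show ?thesis unfolding observable_def by blast
qed

text \<open>
  Fraction-free Gaussian elimination; \<open>r0\<close> is the pivot row, and \<open>M'\<close> is the matrix without the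
  column \<open>x\<close>.
\<close>

lemma analytic_left_inverse:
  assumes S: "finite S" and I: "finite I" and R: "finite R"
    and M: "\<And>r i. r \<in> R \<Longrightarrow> i \<in> I \<Longrightarrow> analytic_in S (M r i)"
    and inj: "\<And>\<delta> i. (\<And>r. r \<in> R \<Longrightarrow> (\<Sum>i\<in>I. \<delta> i * M r i a) = 0) \<Longrightarrow> i \<in> I \<Longrightarrow> \<delta> i = 0"
  shows "\<exists>q C. analytic_in S q \<and> q a \<noteq> 0 \<and> (\<forall>i\<in>I. \<forall>r\<in>R. analytic_in S (C i r)) \<and>
     (\<forall>i\<in>I. \<forall>j\<in>I. \<forall>v. (\<Sum>r\<in>R. C i r v * M r j v) = (if i = j then q v else 0))"
  using I M inj
proof (induction I arbitrary: M rule: finite_induct)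
  case empty
  show ?case by (intro exI[of _ "\<lambda>_. 1"]) (use S in auto)
next
  case (insert x I)
  have "\<exists>r0\<in>R. M r0 x a \<noteq> 0"
  proof (rule ccontr)
    assume no: "\<not> ?thesis"
    \<comment> \<open>If column \<open>x\<close> vanished at \<open>a\<close>, the unit vector at
      \<open>x\<close> would lie in the kernel there.\<close>
    have "(if x = x then 1 else 0 :: real) = 0"
    proof (rule insert.prems(2)[of "\<lambda>i. if i = x then 1 else 0"])
      fix r assume "r \<in> R"
      then have "M r x a = 0" using no by blast
      then show "(\<Sum>i\<in>insert x I. (if i = x then 1 else 0) * M r i a) = 0"
        using insert.hyps by (intro sum.neutral) auto
    qed simp
    then show False by simp
  qed
  then obtain r0 where r0: "r0 \<in> R" "M r0 x a \<noteq> 0" by blast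
  define M' where "M' = (\<lambda>r j v. M r0 x v * M r j v - M r x v * M r0 j v)"
  have "\<exists>q C. analytic_in S q \<and> q a \<noteq> 0 \<and> (\<forall>i\<in>I. \<forall>r\<in>R. analytic_in S (C i r)) \<and>
     (\<forall>i\<in>I. \<forall>j\<in>I. \<forall>v. (\<Sum>r\<in>R. C i r v * M' r j v) = (if i = j then q v else 0))"
  proof (rule insert.IH)
    show "analytic_in S (M' r i)" if "r \<in> R" "i \<in> I" for r i
      unfolding M'_def using that r0 by (intro analytic_in_diff analytic_in_mult insert.prems(1)) auto
  next
    fix \<delta> i assume z: "\<And>r. r \<in> R \<Longrightarrow> (\<Sum>i\<in>I. \<delta> i * M' r i a) = 0" and i: "i \<in> I"
    \<comment> \<open>The entry at \<open>x\<close> is chosen such that the pivot row annihilates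
      the extended vector at \<open>a\<close>.\<close>
    define \<delta>' where "\<delta>' = \<delta>(x := - (\<Sum>j\<in>I. \<delta> j * M r0 j a) / M r0 x a)"
    have "\<delta>' i = 0"
    proof (rule insert.prems(2))
      fix r assume r: "r \<in> R"
      have "(\<Sum>j\<in>I. \<delta>' j * M r j a) = (\<Sum>j\<in>I. \<delta> j * M r j a)"
        using insert.hyps by (intro sum.cong) (auto simp: \<delta>'_def)
      then have "M r0 x a * (\<Sum>j\<in>insert x I. \<delta>' j * M r j a) =
          (\<Sum>j\<in>I. \<delta> j * M r j a) * M r0 x a - (\<Sum>j\<in>I. \<delta> j * M r0 j a) * M r x a"
        using insert.hyps r0 by (simp add: \<delta>'_def field_simps)
      also have "\<dots> = (\<Sum>j\<in>I. \<delta> j * M' r j a)"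
        by (simp add: M'_def sum_distrib_left sum_distrib_right sum_subtractf[symmetric] algebra_simps)
      finally show "(\<Sum>j\<in>insert x I. \<delta>' j * M r j a) = 0" using z[OF r] r0 by simp
    qed (use i in simp)
    then show "\<delta> i = 0" using insert.hyps i by (auto simp: \<delta>'_def split: if_splits)
  qed
  then obtain q C where q: "analytic_in S q" "q a \<noteq> 0" and C: "\<And>i r. i \<in> I \<Longrightarrow> r \<in> R \<Longrightarrow> analytic_in S (C i r)"
    and CM: "\<And>i j v. i \<in> I \<Longrightarrow> j \<in> I \<Longrightarrow> (\<Sum>r\<in>R. C i r v * M' r j v) = (if i = j then q v else 0)"
    by blast
  \<comment> \<open>\<open>B\<close> rewrites the combinations of rows of \<open>M'\<close> as
    combinations of rows of \<open>M\<close>; the correction at \<open>r0\<close> collects the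
    subtracted multiples of the pivot row. \<open>Bx\<close> takes \<open>q\<close> times the pivot
    row and clears its entries in the columns of \<open>I\<close> by means of
    \<open>B\<close>.\<close>
  define B where "B = (\<lambda>i r v. C i r v * M r0 x v - (if r = r0 then \<Sum>r'\<in>R. C i r' v * M r' x v else 0))"
  define Bx where "Bx = (\<lambda>r v. (if r = r0 then q v else 0) - (\<Sum>j\<in>I. M r0 j v * B j r v))"
  have B: "(\<Sum>r\<in>R. B i r v * M r j v) = (\<Sum>r\<in>R. C i r v * M' r j v)" for i j v
  proof -
    have "(\<Sum>r\<in>R. B i r v * M r j v) = (\<Sum>r\<in>R. C i r v * M r0 x v * M r j v) -
        (\<Sum>r\<in>R. if r = r0 then (\<Sum>r'\<in>R. C i r' v * M r' x v) * M r0 j v else 0)"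
      unfolding sum_subtractf[symmetric] by (rule sum.cong) (auto simp: B_def left_diff_distrib)
    also have "\<dots> = (\<Sum>r\<in>R. C i r v * M r0 x v * M r j v) - (\<Sum>r\<in>R. C i r v * M r x v) * M r0 j v"
      using R r0 by simp
    also have "\<dots> = (\<Sum>r\<in>R. C i r v * M' r j v)"
      by (simp add: M'_def right_diff_distrib sum_subtractf sum_distrib_right mult.assoc)
    finally show ?thesis .
  qed
  have Ban: "analytic_in S (B i r)" if "i \<in> I" "r \<in> R" for i r
  proof -
    have "analytic_in S (\<lambda>v. \<Sum>r'\<in>R. C i r' v * M r' x v)"
      using that C insert.prems(1) by (intro analytic_in_sum S analytic_in_mult) auto
    then have "analytic_in S (\<lambda>v. if r = r0 then \<Sum>r'\<in>R. C i r' v * M r' x v else 0)"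
      using S by (cases "r = r0") auto
    then show ?thesis unfolding B_def
      using that C insert.prems(1) r0 by (intro analytic_in_diff analytic_in_mult) auto
  qed
  have Bxan: "analytic_in S (Bx r)" if "r \<in> R" for r
  proof -
    have "analytic_in S (\<lambda>v. if r = r0 then q v else 0)" using S q by (cases "r = r0") auto
    then show ?thesis unfolding Bx_def
      using that Ban insert.prems(1) r0 by (intro analytic_in_diff analytic_in_sum S analytic_in_mult) auto
  qed
  have BM: "(\<Sum>r\<in>R. B i r v * M r j v) = (if i = j then q v else 0)" if "i \<in> I" "j \<in> insert x I" for i j v
  proof (cases "j = x")
    case True
    then show ?thesis unfolding B using insert.hyps that by (auto simp: M'_def intro: sum.neutral)
  next
    case False
    then show ?thesis unfolding B using CM that by simp
  qed
  have BxM: "(\<Sum>r\<in>R. Bx r v * M r j v) = (if j = x then q v * M r0 x v else 0)" if j: "j \<in> insert x I" for j v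
  proof -
    have "(\<Sum>r\<in>R. Bx r v * M r j v) = (\<Sum>r\<in>R. if r = r0 then q v * M r0 j v else 0)
        - (\<Sum>r\<in>R. \<Sum>i\<in>I. M r0 i v * (B i r v * M r j v))"
      unfolding sum_subtractf[symmetric]
      by (rule sum.cong) (auto simp: Bx_def left_diff_distrib sum_distrib_right mult.assoc)
    also have "(\<Sum>r\<in>R. \<Sum>i\<in>I. M r0 i v * (B i r v * M r j v)) = (\<Sum>i\<in>I. M r0 i v * (\<Sum>r\<in>R. B i r v * M r j v))"
      by (subst sum.swap) (simp add: sum_distrib_left)
    also have "\<dots> = (\<Sum>i\<in>I. if i = j then M r0 j v * q v else 0)"
      using j by (intro sum.cong) (auto simp: BM)
    finally show ?thesis using R r0 j insert.hyps by (auto simp: sum.delta)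
  qed
  show ?case
  proof (intro exI conjI ballI allI)
    show "analytic_in S (\<lambda>v. q v * M r0 x v)" using r0 by (intro analytic_in_mult q insert.prems(1)) auto
    show "q a * M r0 x a \<noteq> 0" using q r0 by simp
    show "analytic_in S (if i = x then Bx r else (\<lambda>v. M r0 x v * B i r v))" if "i \<in> insert x I" "r \<in> R" for i r
      using that r0 Bxan Ban insert.prems(1) by (auto intro!: analytic_in_mult)
    show "(\<Sum>r\<in>R. (if i = x then Bx r else (\<lambda>v. M r0 x v * B i r v)) v * M r j v)
        = (if i = j then q v * M r0 x v else 0)"
      if "i \<in> insert x I" "j \<in> insert x I" for i j v
    proof (cases "i = x")
      case True
      then show ?thesis using BxM[OF that(2)] by simp
    next
      case False
      then have "(\<Sum>r\<in>R. (if i = x then Bx r else (\<lambda>v. M r0 x v * B i r v)) v * M r j v) =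
          M r0 x v * (\<Sum>r\<in>R. B i r v * M r j v)" by (simp add: sum_distrib_left mult.assoc)
      then show ?thesis using BM[of i j v] that False by simp
    qed
  qed
qed

section \<open>Taylor series along the trajectory from the origin\<close>

unbundle no vec_syntax
unbundle fps_syntax

text \<open>The hypothesis concerns indices up to \<open>k\<close> only, so that the lemma is
  available inside the strong induction of \<open>traj_nonneg\<close>.\<close>

lemma fps_power_nth_nonneg:
  fixes f :: "real fps"
  assumes "\<And>a. a \<le> k \<Longrightarrow> f $ a \<ge> 0" "a \<le> k" shows "(f ^ n) $ a \<ge> 0"
  using assms(2)
proof (induction n arbitrary: a)
  case (Suc n)
  then show ?case by (auto simp: fps_mult_nth intro!: sum_nonneg mult_nonneg_nonneg assms(1))
qed (simp add: fps_one_nth)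

text \<open>
  The coefficients of \<open>taylor \<phi>\<close> are those of \<open>t \<mapsto> \<phi> (x t)\<close> for the trajectory of the vector
  field \<open>f\<close> starting at the origin; \<open>taylor_deriv i \<phi>\<close> is its derivative with respect to the \<open>i\<close>-th
  coordinate of the initial state.
\<close>

locale analytic_field =
  fixes X :: "'a set" and f :: "'a \<Rightarrow> ('a \<Rightarrow> real) \<Rightarrow> real"
  assumes X: "finite X" and f: "\<And>i. i \<in> X \<Longrightarrow> analytic_in X (f i)"
begin

definition taylor :: "(('a \<Rightarrow> real) \<Rightarrow> real) \<Rightarrow> real fps" where
  "taylor \<phi> = Abs_fps (\<lambda>k. (lie_derivative X f ^^ k) \<phi> (\<lambda>_. 0) / fact k)"

definition taylor_deriv :: "'a \<Rightarrow> (('a \<Rightarrow> real) \<Rightarrow> real) \<Rightarrow> real fps" where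
  "taylor_deriv i \<phi> = Abs_fps (\<lambda>k. pderivative i ((lie_derivative X f ^^ k) \<phi>) (\<lambda>_. 0) / fact k)"

lemma analytic_in_lie_derivative: "analytic_in X \<phi> \<Longrightarrow> analytic_in X (lie_derivative X f \<phi>)"
  unfolding lie_derivative_def
  by (intro analytic_in_sum X analytic_in_mult analytic_in_pderivative f)

lemma lie_derivative_add:
  "analytic_in X \<phi> \<Longrightarrow> analytic_in X \<psi> \<Longrightarrow>
   lie_derivative X f (\<lambda>v. \<phi> v + \<psi> v) = (\<lambda>v. lie_derivative X f \<phi> v + lie_derivative X f \<psi> v)"
  by (rule ext) (simp add: lie_derivative_def analytic_in_pderivative_add distrib_right sum.distrib)

lemma lie_derivative_mult:
  "analytic_in X \<phi> \<Longrightarrow> analytic_in X \<psi> \<Longrightarrow>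
   lie_derivative X f (\<lambda>v. \<phi> v * \<psi> v) = (\<lambda>v. lie_derivative X f \<phi> v * \<psi> v + \<phi> v * lie_derivative X f \<psi> v)"
  by (rule ext) (simp add: lie_derivative_def analytic_in_pderivative_mult algebra_simps sum.distrib sum_distrib_left)

lemma lie_derivative_const: "lie_derivative X f (\<lambda>_. c) = (\<lambda>_. 0)"
  by (rule ext) (simp add: lie_derivative_def)

lemma lie_derivative_coord: "i \<in> X \<Longrightarrow> lie_derivative X f (\<lambda>v. v i) = f i"
  using X by (intro ext) (simp add: lie_derivative_def pderivative_coord if_distrib[of "\<lambda>x. x * _"] sum.delta cong: if_cong)

lemma taylor_nth_Suc: "real (Suc k) * taylor \<phi> $ Suc k = taylor (lie_derivative X f \<phi>) $ k"
  by (simp add: taylor_def funpow_swap1 divide_simps del: funpow.simps of_nat_Suc) (simp add: funpow_swap1)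

lemma taylor_deriv_nth_Suc: "real (Suc k) * taylor_deriv i \<phi> $ Suc k = taylor_deriv i (lie_derivative X f \<phi>) $ k"
  by (simp add: taylor_deriv_def funpow_swap1 divide_simps del: funpow.simps of_nat_Suc) (simp add: funpow_swap1)

lemma taylor_nth_0: "taylor \<phi> $ 0 = \<phi> (\<lambda>_. 0)"
  by (simp add: taylor_def)

lemma taylor_deriv_nth_0: "taylor_deriv i \<phi> $ 0 = pderivative i \<phi> (\<lambda>_. 0)"
  by (simp add: taylor_deriv_def)

text \<open>This is the chain rule along the trajectory, as a formal identity: a Lie derivative
  shifts the list of iterated Lie derivatives by one.\<close>

lemma fps_deriv_taylor: "fps_deriv (taylor \<phi>) = taylor (lie_derivative X f \<phi>)"
  by (rule fps_ext) (simp add: taylor_nth_Suc[symmetric])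

lemma fps_deriv_taylor_deriv: "fps_deriv (taylor_deriv i \<phi>) = taylor_deriv i (lie_derivative X f \<phi>)"
  by (rule fps_ext) (simp add: taylor_deriv_nth_Suc[symmetric])

text \<open>The step of the inductions below. Passing to the derivative lowers the index but
  replaces functions by their Lie derivatives, hence the functions are generalised there.\<close>

lemma fps_nth_Suc_eqI:
  fixes F G :: "real fps"
  assumes "fps_deriv F $ k = fps_deriv G $ k" shows "F $ Suc k = G $ Suc k"
  using assms by (simp del: of_nat_Suc)

lemma taylor_add:
  assumes "analytic_in X \<phi>" "analytic_in X \<psi>"
  shows "taylor (\<lambda>v. \<phi> v + \<psi> v) = taylor \<phi> + taylor \<psi>"
proof (rule fps_ext)
  show "taylor (\<lambda>v. \<phi> v + \<psi> v) $ k = (taylor \<phi> + taylor \<psi>) $ k" for k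
    using assms
  proof (induction k arbitrary: \<phi> \<psi>)
    case (Suc k)
    show ?case
      by (rule fps_nth_Suc_eqI)
        (simp only: fps_deriv_taylor fps_deriv_add lie_derivative_add[OF Suc.prems]
          Suc.IH[OF analytic_in_lie_derivative[OF Suc.prems(1)] analytic_in_lie_derivative[OF Suc.prems(2)]])
  qed (simp add: taylor_nth_0)
qed

lemma taylor_deriv_add:
  assumes "analytic_in X \<phi>" "analytic_in X \<psi>"
  shows "taylor_deriv i (\<lambda>v. \<phi> v + \<psi> v) = taylor_deriv i \<phi> + taylor_deriv i \<psi>"
proof (rule fps_ext)
  show "taylor_deriv i (\<lambda>v. \<phi> v + \<psi> v) $ k = (taylor_deriv i \<phi> + taylor_deriv i \<psi>) $ k" for k
    using assms
  proof (induction k arbitrary: \<phi> \<psi>)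
    case 0
    then show ?case by (simp add: taylor_deriv_nth_0 analytic_in_pderivative_add)
  next
    case (Suc k)
    show ?case
      by (rule fps_nth_Suc_eqI)
        (simp only: fps_deriv_taylor_deriv fps_deriv_add lie_derivative_add[OF Suc.prems]
          Suc.IH[OF analytic_in_lie_derivative[OF Suc.prems(1)] analytic_in_lie_derivative[OF Suc.prems(2)]])
  qed
qed

text \<open>Both sides have the same constant term and obey the Leibniz rule, which reduces each
  coefficient to smaller ones.\<close>

lemma taylor_mult:
  assumes "analytic_in X \<phi>" "analytic_in X \<psi>"
  shows "taylor (\<lambda>v. \<phi> v * \<psi> v) = taylor \<phi> * taylor \<psi>"
proof (rule fps_ext)
  show "taylor (\<lambda>v. \<phi> v * \<psi> v) $ k = (taylor \<phi> * taylor \<psi>) $ k" for k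
    using assms
  proof (induction k arbitrary: \<phi> \<psi>)
    case (Suc k)
    note an = Suc.prems analytic_in_lie_derivative[OF Suc.prems(1)] analytic_in_lie_derivative[OF Suc.prems(2)]
    have "fps_deriv (taylor (\<lambda>v. \<phi> v * \<psi> v)) $ k =
       (taylor (\<lambda>v. lie_derivative X f \<phi> v * \<psi> v) + taylor (\<lambda>v. \<phi> v * lie_derivative X f \<psi> v)) $ k"
      by (simp only: fps_deriv_taylor lie_derivative_mult[OF an(1,2)]
        taylor_add[OF analytic_in_mult[OF an(3,2)] analytic_in_mult[OF an(1,4)]])
    also have "\<dots> = fps_deriv (taylor \<phi> * taylor \<psi>) $ k"
      by (simp only: fps_add_nth Suc.IH[OF an(3,2)] Suc.IH[OF an(1,4)] fps_deriv_mult fps_deriv_taylor add.commute)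
    finally show ?case by (rule fps_nth_Suc_eqI)
  qed (simp add: taylor_nth_0)
qed

lemma taylor_deriv_mult:
  assumes "analytic_in X \<phi>" "analytic_in X \<psi>"
  shows "taylor_deriv i (\<lambda>v. \<phi> v * \<psi> v) = taylor_deriv i \<phi> * taylor \<psi> + taylor \<phi> * taylor_deriv i \<psi>"
proof (rule fps_ext)
  show "taylor_deriv i (\<lambda>v. \<phi> v * \<psi> v) $ k = (taylor_deriv i \<phi> * taylor \<psi> + taylor \<phi> * taylor_deriv i \<psi>) $ k" for k
    using assms
  proof (induction k arbitrary: \<phi> \<psi>)
    case 0
    then show ?case by (simp add: taylor_deriv_nth_0 taylor_nth_0 analytic_in_pderivative_mult)
  next
    case (Suc k)
    note an = Suc.prems analytic_in_lie_derivative[OF Suc.prems(1)] analytic_in_lie_derivative[OF Suc.prems(2)]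
    have "fps_deriv (taylor_deriv i (\<lambda>v. \<phi> v * \<psi> v)) $ k =
       (taylor_deriv i (\<lambda>v. lie_derivative X f \<phi> v * \<psi> v) + taylor_deriv i (\<lambda>v. \<phi> v * lie_derivative X f \<psi> v)) $ k"
      by (simp only: fps_deriv_taylor_deriv lie_derivative_mult[OF an(1,2)]
        taylor_deriv_add[OF analytic_in_mult[OF an(3,2)] analytic_in_mult[OF an(1,4)]])
    also have "\<dots> = fps_deriv (taylor_deriv i \<phi> * taylor \<psi> + taylor \<phi> * taylor_deriv i \<psi>) $ k"
      unfolding fps_add_nth[of "taylor_deriv i _"] Suc.IH[OF an(3,2)] Suc.IH[OF an(1,4)]
      by (simp add: fps_deriv_mult fps_deriv_taylor fps_deriv_taylor_deriv del: fps_deriv_nth)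
    finally show ?case by (rule fps_nth_Suc_eqI)
  qed
qed

lemma taylor_const: "taylor (\<lambda>_. c) = fps_const c"
proof (rule fps_ext)
  show "taylor (\<lambda>_. c) $ k = fps_const c $ k" for k
  proof (induction k arbitrary: c)
    case (Suc k)
    have "fps_deriv (taylor (\<lambda>_. c)) $ k = fps_const 0 $ k"
      by (simp only: fps_deriv_taylor lie_derivative_const Suc.IH)
    then show ?case by (intro fps_nth_Suc_eqI) simp
  qed (simp add: taylor_nth_0)
qed

lemma taylor_deriv_const: "taylor_deriv i (\<lambda>_. c) = 0"
proof (rule fps_ext)
  show "taylor_deriv i (\<lambda>_. c) $ k = 0 $ k" for k
  proof (induction k arbitrary: c)
    case (Suc k)
    have "fps_deriv (taylor_deriv i (\<lambda>_. c)) $ k = 0 $ k"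
      by (simp only: fps_deriv_taylor_deriv lie_derivative_const Suc.IH)
    then show ?case by (intro fps_nth_Suc_eqI) simp
  qed (simp add: taylor_deriv_nth_0)
qed

lemma taylor_power: "analytic_in X \<phi> \<Longrightarrow> taylor (\<lambda>v. \<phi> v ^ n) = taylor \<phi> ^ n"
  by (induction n) (simp_all add: taylor_const taylor_mult analytic_in_power)

lemma taylor_deriv_power:
  assumes "analytic_in X \<phi>"
  shows "taylor_deriv i (\<lambda>v. \<phi> v ^ n) = of_nat n * (taylor \<phi> ^ (n - 1) * taylor_deriv i \<phi>)"
proof (induction n)
  case (Suc n)
  have "taylor_deriv i (\<lambda>v. \<phi> v ^ Suc n) = taylor_deriv i \<phi> * taylor \<phi> ^ n + taylor \<phi> * taylor_deriv i (\<lambda>v. \<phi> v ^ n)"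
    using assms by (simp add: taylor_deriv_mult analytic_in_power taylor_power)
  also have "\<dots> = of_nat (Suc n) * (taylor \<phi> ^ n * taylor_deriv i \<phi>)"
    unfolding Suc by (cases n) (simp_all add: algebra_simps)
  finally show ?case by simp
qed (simp add: taylor_deriv_const)

lemma taylor_sum:
  assumes "finite I" "\<And>j. j \<in> I \<Longrightarrow> analytic_in X (g j)"
  shows "taylor (\<lambda>v. \<Sum>j\<in>I. g j v) = (\<Sum>j\<in>I. taylor (g j))"
  using assms
  by (induction I rule: finite_induct) (simp_all add: taylor_const taylor_add analytic_in_sum X)

lemma taylor_deriv_sum:
  assumes "finite I" "\<And>j. j \<in> I \<Longrightarrow> analytic_in X (g j)"
  shows "taylor_deriv i (\<lambda>v. \<Sum>j\<in>I. g j v) = (\<Sum>j\<in>I. taylor_deriv i (g j))"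
  using assms
  by (induction I rule: finite_induct) (simp_all add: taylor_deriv_const taylor_deriv_add analytic_in_sum X)

end

section \<open>Sensitivities and their orders\<close>

text \<open>On edges the subtraction in \<open>n_def\<close> is not truncated, since indices are
  smaller than \<open>card X\<close>; for the same reason the exponents are positive.\<close>

locale polynomial_network =
  fixes X :: "'a set" and A :: "('a \<times> 'a) set" and n :: "'a \<Rightarrow> 'a \<Rightarrow> nat" and idx :: "'a \<Rightarrow> nat"
  assumes finite_X: "finite X" and A: "A \<subseteq> X \<times> X" and idx_inj: "inj_on idx X"
    and idx_less: "\<And>i. i \<in> X \<Longrightarrow> idx i < card X"
    and n_def: "\<And>i j. n j i = card X + idx j - idx i"
begin

abbreviation "field \<equiv> network_field A n"

lemma finite_in: "finite {j. (j, i) \<in> A}"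
  by (rule finite_subset[OF _ finite_X]) (use A in auto)

lemma n_pos: "(j, i) \<in> A \<Longrightarrow> n j i > 0"
  using A idx_less[of i] by (auto simp: n_def)

lemma n_idx: "(j, i) \<in> A \<Longrightarrow> n j i + idx i = card X + idx j"
  using A idx_less[of i] by (auto simp: n_def)

lemma analytic_in_field: "analytic_in X (field i)"
  using analytic_in_network_field[where g="\<lambda>j. j", of X i A n] finite_X A by auto

sublocale analytic_field X field
  by unfold_locales (rule finite_X, rule analytic_in_field)

definition traj :: "'a \<Rightarrow> real fps" where "traj j = taylor (\<lambda>x. x j)"

definition sens :: "'a \<Rightarrow> 'a \<Rightarrow> real fps" where "sens i j = taylor_deriv i (\<lambda>x. x j)"

lemma analytic_in_summand: "(l, j) \<in> A \<Longrightarrow> analytic_in X (\<lambda>x. x l ^ n l j)"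
  using A finite_X by (intro analytic_in_power analytic_in_coord) auto

lemma fps_deriv_traj:
  assumes "j \<in> X"
  shows "fps_deriv (traj j) = 1 + (\<Sum>l | (l, j) \<in> A. traj l ^ n l j)"
proof -
  have "fps_deriv (traj j) = taylor (\<lambda>x. 1 + (\<Sum>l | (l, j) \<in> A. x l ^ n l j))"
    unfolding traj_def fps_deriv_taylor lie_derivative_coord[OF assms] network_field_def ..
  also have "\<dots> = taylor (\<lambda>_. 1) + taylor (\<lambda>x. \<Sum>l | (l, j) \<in> A. x l ^ n l j)"
    using analytic_in_summand by (intro taylor_add analytic_in_sum finite_X) (auto simp: finite_X)
  also have "\<dots> = 1 + (\<Sum>l | (l, j) \<in> A. taylor (\<lambda>x. x l ^ n l j))"
    using analytic_in_summand by (subst taylor_sum[OF finite_in]) (auto simp: taylor_const)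
  also have "\<dots> = 1 + (\<Sum>l | (l, j) \<in> A. traj l ^ n l j)"
    unfolding traj_def using A finite_X
    by (intro arg_cong2[where f="(+)"] sum.cong refl taylor_power analytic_in_coord) auto
  finally show ?thesis .
qed

text \<open>The variational equation: the field linearised along the trajectory.\<close>

lemma fps_deriv_sens:
  assumes "j \<in> X"
  shows "fps_deriv (sens i j) = (\<Sum>l | (l, j) \<in> A. of_nat (n l j) * (traj l ^ (n l j - 1) * sens i l))"
proof -
  have "fps_deriv (sens i j) = taylor_deriv i (\<lambda>x. 1 + (\<Sum>l | (l, j) \<in> A. x l ^ n l j))"
    unfolding sens_def fps_deriv_taylor_deriv lie_derivative_coord[OF assms] network_field_def ..
  also have "\<dots> = taylor_deriv i (\<lambda>_. 1) + taylor_deriv i (\<lambda>x. \<Sum>l | (l, j) \<in> A. x l ^ n l j)"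
    using analytic_in_summand by (intro taylor_deriv_add analytic_in_sum finite_X) (auto simp: finite_X)
  also have "\<dots> = (\<Sum>l | (l, j) \<in> A. taylor_deriv i (\<lambda>x. x l ^ n l j))"
    using analytic_in_summand by (subst taylor_deriv_sum[OF finite_in]) (auto simp: taylor_deriv_const)
  also have "\<dots> = (\<Sum>l | (l, j) \<in> A. of_nat (n l j) * (traj l ^ (n l j - 1) * sens i l))"
    unfolding traj_def sens_def using A finite_X
    by (intro sum.cong refl taylor_deriv_power analytic_in_coord) auto
  finally show ?thesis .
qed

lemma traj_nth_0: "traj j $ 0 = 0"
  by (simp add: traj_def taylor_nth_0)

text \<open>At the origin all powers vanish, their exponents being positive, so the constant term of
  the field is the initial speed.\<close>

lemma traj_nth_1:
  assumes "j \<in> X" shows "traj j $ 1 = 1"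
proof -
  have "traj j $ 1 = fps_deriv (traj j) $ 0" by simp
  also have "\<dots> = 1 + (\<Sum>l | (l, j) \<in> A. (traj l $ 0) ^ n l j)"
    by (simp add: fps_deriv_traj[OF assms] fps_sum_nth fps_power_zeroth del: fps_deriv_nth)
  also have "(\<Sum>l | (l, j) \<in> A. (traj l $ 0) ^ n l j) = 0"
    by (rule sum.neutral) (auto simp: traj_nth_0 n_pos)
  finally show ?thesis by simp
qed

lemma traj_nonneg: "j \<in> X \<Longrightarrow> traj j $ k \<ge> 0"
proof (induction k arbitrary: j rule: less_induct)
  case (less k)
  show ?case
  proof (cases k)
    case (Suc m)
    have "real (Suc m) * traj j $ Suc m = fps_deriv (traj j) $ m" by simp
    also have "\<dots> = 1 $ m + (\<Sum>l | (l, j) \<in> A. (traj l ^ n l j) $ m)"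
      by (simp add: fps_deriv_traj[OF less.prems] fps_sum_nth del: fps_deriv_nth)
    also have "\<dots> \<ge> 0"
    proof (intro add_nonneg_nonneg sum_nonneg)
      fix l assume "l \<in> {l. (l, j) \<in> A}"
      then have "l \<in> X" using A by auto
      then show "(traj l ^ n l j) $ m \<ge> 0"
        using less.IH Suc by (intro fps_power_nth_nonneg[where k=m]) auto
    qed (simp add: fps_one_nth)
    finally show ?thesis using Suc by (simp add: zero_le_mult_iff)
  qed (simp add: traj_nth_0)
qed

lemma traj_power_nonneg: "j \<in> X \<Longrightarrow> (traj j ^ m) $ k \<ge> 0"
  by (rule fps_power_nth_nonneg[where k=k]) (auto intro: traj_nonneg)

lemma traj_power_nth_same: "j \<in> X \<Longrightarrow> (traj j ^ m) $ m = 1"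
  using startsby_zero_power_nth_same[OF traj_nth_0, of j m] traj_nth_1 by simp

lemma traj_power_nth_less: "k < m \<Longrightarrow> (traj j ^ m) $ k = 0"
  using startsby_zero_power_prefix[OF traj_nth_0] by blast

lemma sens_nth_0: "sens i j $ 0 = (if i = j then 1 else 0)"
  by (auto simp: sens_def taylor_deriv_nth_0 pderivative_coord)

lemma sens_nth_Suc:
  assumes "j \<in> X"
  shows "real (Suc k) * sens i j $ Suc k =
    (\<Sum>l | (l, j) \<in> A. \<Sum>a=0..k. real (n l j) * ((traj l ^ (n l j - 1)) $ a * sens i l $ (k - a)))"
proof -
  have "real (Suc k) * sens i j $ Suc k = fps_deriv (sens i j) $ k" by simp
  also have "\<dots> = (\<Sum>l | (l, j) \<in> A. \<Sum>a=0..k. real (n l j) * ((traj l ^ (n l j - 1)) $ a * sens i l $ (k - a)))"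
    unfolding fps_deriv_sens[OF assms] fps_sum_nth fps_mult_of_nat_nth
    unfolding fps_mult_nth sum_distrib_left ..
  finally show ?thesis .
qed

text \<open>Together with \<open>traj_nonneg\<close> this excludes cancellation between
  contributions of different paths.\<close>

lemma sens_nonneg: "j \<in> X \<Longrightarrow> sens i j $ k \<ge> 0"
proof (induction k arbitrary: j rule: less_induct)
  case (less k)
  show ?case
  proof (cases k)
    case 0
    then show ?thesis by (simp add: sens_nth_0)
  next
    case (Suc m)
    have "real (Suc m) * sens i j $ Suc m \<ge> 0"
      unfolding sens_nth_Suc[OF less.prems]
    proof (intro sum_nonneg mult_nonneg_nonneg)
      fix l a assume "l \<in> {l. (l, j) \<in> A}" "a \<in> {0..m}"
      then show "(traj l ^ (n l j - 1)) $ a \<ge> 0" "sens i l $ (m - a) \<ge> 0"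
        using A Suc by (auto intro!: traj_power_nonneg less.IH)
    qed simp
    then show ?thesis using Suc by (simp add: zero_le_mult_iff)
  qed
qed

text \<open>In the recursion the leading coefficient of \<open>traj l ^ (n l j - 1)\<close> meets
  coefficient \<open>k\<close> of \<open>sens i l\<close>; this product is positive and no other
  summand is negative. The power raises the index by \<open>n l j - 1\<close> and integration by
  1.\<close>

lemma sens_step:
  assumes lj: "(l, j) \<in> A" and k: "sens i l $ k \<noteq> 0"
  shows "sens i j $ (k + n l j) \<noteq> 0"
proof -
  define m where "m = k + n l j - 1"
  have m: "k + n l j = Suc m" using n_pos[OF lj] by (simp add: m_def)
  have mem: "j \<in> X" "l \<in> X" using lj A by auto
  have nonneg: "real (n l' j) * ((traj l' ^ (n l' j - 1)) $ a * sens i l' $ (m - a)) \<ge> 0"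
    if "(l', j) \<in> A" for l' a
    using that A by (intro mult_nonneg_nonneg traj_power_nonneg sens_nonneg) auto
  let ?a = "n l j - 1"
  have a: "?a \<le> m" "m - ?a = k" using n_pos[OF lj] by (auto simp: m_def)
  have "0 < real (n l j) * ((traj l ^ ?a) $ ?a * sens i l $ (m - ?a))"
    unfolding a(2) traj_power_nth_same[OF mem(2)]
    using n_pos[OF lj] k sens_nonneg[OF mem(2), of i k] by simp
  also have "\<dots> \<le> (\<Sum>a=0..m. real (n l j) * ((traj l ^ ?a) $ a * sens i l $ (m - a)))"
    using a nonneg[OF lj] by (intro member_le_sum) auto
  also have "\<dots> \<le> (\<Sum>l | (l, j) \<in> A. \<Sum>a=0..m. real (n l j) * ((traj l ^ (n l j - 1)) $ a * sens i l $ (m - a)))"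
    using nonneg lj by (intro member_le_sum[where f="\<lambda>l. \<Sum>a=0..m. real (n l j) * ((traj l ^ (n l j - 1)) $ a * sens i l $ (m - a))"]
      finite_in sum_nonneg) auto
  also have "\<dots> = real (Suc m) * sens i j $ Suc m" using sens_nth_Suc[OF mem(1)] by simp
  finally show ?thesis unfolding m by auto
qed

text \<open>A nonzero coefficient of positive index stems from a nonzero summand of the recursion.
  As the power of \<open>traj l\<close> has no terms below \<open>n l j - 1\<close>, passing the
  edge raises the index by at least \<open>n l j\<close>.\<close>

lemma sens_nonzero_cases:
  assumes j: "j \<in> X" and k: "sens i j $ k \<noteq> 0"
  shows "k = 0 \<and> j = i \<or> (\<exists>l k'. (l, j) \<in> A \<and> sens i l $ k' \<noteq> 0 \<and> k' + n l j \<le> k)"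
proof (cases k)
  case 0
  then show ?thesis using k by (auto simp: sens_nth_0 split: if_splits)
next
  case (Suc m)
  then have "(\<Sum>l | (l, j) \<in> A. \<Sum>a=0..m. real (n l j) * ((traj l ^ (n l j - 1)) $ a * sens i l $ (m - a))) \<noteq> 0"
    using k sens_nth_Suc[OF j, of m i] by auto
  then obtain l where l: "(l, j) \<in> A"
    and "(\<Sum>a=0..m. real (n l j) * ((traj l ^ (n l j - 1)) $ a * sens i l $ (m - a))) \<noteq> 0"
    by (metis (mono_tags, lifting) mem_Collect_eq sum.neutral)
  then obtain a where a: "a \<le> m" "real (n l j) * ((traj l ^ (n l j - 1)) $ a * sens i l $ (m - a)) \<noteq> 0"
    by (metis (mono_tags, lifting) atLeastAtMost_iff sum.neutral)
  then have "\<not> a < n l j - 1" using traj_power_nth_less[of a "n l j - 1" l] by auto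
  then have "(m - a) + n l j \<le> k" using a n_pos[OF l] Suc by linarith
  moreover have "sens i l $ (m - a) \<noteq> 0" using a by auto
  ultimately show ?thesis using l by blast
qed

text \<open>The order of vanishing of \<open>sens i j\<close>. It is informative only if some
  coefficient is nonzero, which the lemmas therefore assume.\<close>

definition sens_order :: "'a \<Rightarrow> 'a \<Rightarrow> nat" where "sens_order i j = (LEAST k. sens i j $ k \<noteq> 0)"

lemma sens_order_le: "sens i j $ k \<noteq> 0 \<Longrightarrow> sens_order i j \<le> k"
  unfolding sens_order_def by (rule Least_le)

lemma sens_order_nonzero: "sens i j $ k \<noteq> 0 \<Longrightarrow> sens i j $ sens_order i j \<noteq> 0"
  unfolding sens_order_def by (rule LeastI)

text \<open>
  The order adds up the exponents along an optimal path; by the choice of the exponents this sum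
  telescopes modulo \<open>card X\<close>, so that the order determines where the traj starts.
\<close>

lemma sens_order_idx:
  assumes "j \<in> X" "sens i j $ k \<noteq> 0"
  shows "\<exists>m. sens_order i j + idx j = idx i + card X * m"
  using assms
proof (induction "sens_order i j" arbitrary: j k rule: less_induct)
  case less
  note nz = sens_order_nonzero[OF less.prems(2)]
  from sens_nonzero_cases[OF less.prems(1) nz] show ?case
  proof (elim disjE exE conjE)
    assume "sens_order i j = 0" "j = i"
    then show ?thesis by (intro exI[of _ 0]) simp
  next
    fix l k' assume 2: "(l, j) \<in> A" "sens i l $ k' \<noteq> 0" "k' + n l j \<le> sens_order i j"
    \<comment> \<open>One inequality extends an optimal path by the edge, the other comes from the
      predecessor just found; the order thus satisfies the shortest-path equation.\<close>
    have "sens_order i j \<le> sens_order i l + n l j"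
      using sens_step[OF 2(1) sens_order_nonzero[OF 2(2)]] by (rule sens_order_le)
    moreover have "sens_order i l \<le> k'" using 2(2) by (rule sens_order_le)
    ultimately have eq: "sens_order i j = sens_order i l + n l j" using 2(3) by linarith
    then have "sens_order i l < sens_order i j" using n_pos[OF 2(1)] by simp
    moreover have "l \<in> X" using 2(1) A by auto
    ultimately obtain m where m: "sens_order i l + idx l = idx i + card X * m"
      using less.hyps 2(2) by blast
    have "sens_order i j + idx j = idx i + card X * Suc m"
      using eq m n_idx[OF 2(1)] by simp
    then show ?thesis ..
  qed
qed

lemma sens_order_inj:
  assumes j: "j \<in> X" and i: "i \<in> X" "i' \<in> X"
    and nz: "sens i j $ k \<noteq> 0" "sens i' j $ k' \<noteq> 0" and eq: "sens_order i j = sens_order i' j"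
  shows "i = i'"
proof -
  obtain m m' where "sens_order i j + idx j = idx i + card X * m" "sens_order i' j + idx j = idx i' + card X * m'"
    using sens_order_idx[OF j] nz by metis
  then have "idx i + card X * m = idx i' + card X * m'" using eq by simp
  then have "(idx i + card X * m) mod card X = (idx i' + card X * m') mod card X" by simp
  then have "idx i = idx i'" using idx_less i by simp
  then show ?thesis using idx_inj i by (auto dest: inj_onD)
qed

lemma sens_nonzero_if_reachable:
  assumes "(i, j) \<in> A\<^sup>*" shows "\<exists>k. sens i j $ k \<noteq> 0"
  using assms
proof (induction rule: rtrancl_induct)
  case base
  show ?case by (intro exI[of _ 0]) (simp add: sens_nth_0)
next
  case (step l j)
  then show ?case using sens_step by blast
qed

text \<open>Among the nodes with \<open>\<delta> i \<noteq> 0\<close> that influence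
  \<open>d\<close>, one has the least order. Distinct nodes have distinct orders, so at the
  coefficient of this order its summand stands alone and must vanish, a contradiction.\<close>

lemma output_differentials_injective:
  assumes D: "D \<subseteq> X" and reach: "\<And>i. i \<in> X \<Longrightarrow> \<exists>d\<in>D. (i, d) \<in> A\<^sup>*"
  obtains K where "\<And>\<delta> i. (\<And>d k. d \<in> D \<Longrightarrow> k \<le> K \<Longrightarrow>
      (\<Sum>i\<in>X. \<delta> i * pderivative i ((lie_derivative X field ^^ k) (\<lambda>x. x d)) (\<lambda>_. 0)) = 0) \<Longrightarrow> i \<in> X \<Longrightarrow> \<delta> i = 0"
proof -
  \<comment> \<open>Any common bound of the orders is suitable; pairs without influence can only
    enlarge it.\<close>
  define K where "K = (\<Sum>i\<in>X. \<Sum>d\<in>D. sens_order i d)"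
  have finD: "finite D" using D finite_X finite_subset by blast
  have K: "sens_order i d \<le> K" if "i \<in> X" "d \<in> D" for i d
  proof -
    have "sens_order i d \<le> (\<Sum>d\<in>D. sens_order i d)" using that finD by (intro member_le_sum) auto
    also have "\<dots> \<le> K" unfolding K_def using that finite_X by (intro member_le_sum) auto
    finally show ?thesis .
  qed
  show thesis
  proof (rule that[of K], rule ccontr)
    fix \<delta> :: "'a \<Rightarrow> real" and i
    assume z: "\<And>d k. d \<in> D \<Longrightarrow> k \<le> K \<Longrightarrow>
      (\<Sum>i\<in>X. \<delta> i * pderivative i ((lie_derivative X field ^^ k) (\<lambda>x. x d)) (\<lambda>_. 0)) = 0"
      and i: "i \<in> X" "\<delta> i \<noteq> 0"
    obtain d where d: "d \<in> D" "(i, d) \<in> A\<^sup>*" using reach i by blast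
    define I where "I = {i \<in> X. \<delta> i \<noteq> 0 \<and> (\<exists>k. sens i d $ k \<noteq> 0)}"
    have "finite I" "I \<noteq> {}" using finite_X i sens_nonzero_if_reachable[OF d(2)] by (auto simp: I_def)
    then obtain i0 where i0: "i0 \<in> I" "\<And>i. i \<in> I \<Longrightarrow> sens_order i0 d \<le> sens_order i d"
      using ex_is_arg_min_if_finite[of I "\<lambda>i. sens_order i d"] by (auto simp: is_arg_min_linorder)
    let ?k = "sens_order i0 d"
    have dX: "d \<in> X" using d D by auto
    have "\<delta> i * sens i d $ ?k = 0" if "i \<in> X - {i0}" for i
    proof (rule ccontr)
      assume nz: "\<delta> i * sens i d $ ?k \<noteq> 0"
      then have "i \<in> I" using that by (auto simp: I_def)
      then have "sens_order i0 d = sens_order i d" using i0(2) sens_order_le[of i d ?k] nz by (intro antisym) auto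
      moreover have "i0 \<in> X" "\<exists>k. sens i0 d $ k \<noteq> 0" using i0(1) by (auto simp: I_def)
      ultimately show False using sens_order_inj[OF dX, of i i0] nz that by auto
    qed
    then have "(\<Sum>i\<in>X - {i0}. \<delta> i * sens i d $ ?k) = 0" by (intro sum.neutral) blast
    then have "(\<Sum>i\<in>X. \<delta> i * sens i d $ ?k) = \<delta> i0 * sens i0 d $ ?k"
      using i0(1) finite_X by (subst sum.remove[of X i0]) (simp_all add: I_def)
    moreover have "\<delta> i0 * sens i0 d $ ?k \<noteq> 0" using i0(1) sens_order_nonzero by (auto simp: I_def)
    moreover have "(\<Sum>i\<in>X. \<delta> i * sens i d $ ?k) =
      (\<Sum>i\<in>X. \<delta> i * pderivative i ((lie_derivative X field ^^ ?k) (\<lambda>x. x d)) (\<lambda>_. 0)) / fact ?k"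
      by (simp add: sens_def taylor_deriv_def sum_divide_distrib)
    moreover have "?k \<le> K" using K i0(1) d(1) by (auto simp: I_def)
    ultimately show False using z[OF d(1), of ?k] by simp
  qed
qed

text \<open>Full rank at the origin gives a left inverse of the matrix of output differentials that
  is analytic up to the factor \<open>1 / q\<close>. It solves for the differential of any
  meromorphic function wherever \<open>q\<close> is nonzero.\<close>

lemma observable_network:
  assumes D: "D \<subseteq> X" and reach: "\<And>i. i \<in> X \<Longrightarrow> \<exists>d\<in>D. (i, d) \<in> A\<^sup>*"
    and e: "e ` {1..P} = D"
  shows "observable X P field (\<lambda>j x. x (e j))"
proof -
  let ?h = "\<lambda>j x. x (e j)"
  obtain K where K: "\<And>\<delta> i. (\<And>d k. d \<in> D \<Longrightarrow> k \<le> K \<Longrightarrow>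
      (\<Sum>i\<in>X. \<delta> i * pderivative i ((lie_derivative X field ^^ k) (\<lambda>x. x d)) (\<lambda>_. 0)) = 0) \<Longrightarrow> i \<in> X \<Longrightarrow> \<delta> i = 0"
    using output_differentials_injective[OF D reach] by blast
  define R where "R = {1..P} \<times> {..K}"
  define M where "M = (\<lambda>(j, k) i. pderivative i ((lie_derivative X field ^^ k) (?h j)))"
  have eD: "e j \<in> D" if "j \<in> {1..P}" for j using that e by blast
  have Lan: "analytic_in X ((lie_derivative X field ^^ k) (?h j))" if "j \<in> {1..P}" for j k
    using eD[OF that] D
    by (induction k) (auto intro!: analytic_in_coord finite_X analytic_in_lie_derivative)
  have "\<exists>q C. analytic_in X q \<and> q (\<lambda>_. 0) \<noteq> 0 \<and> (\<forall>i\<in>X. \<forall>r\<in>R. analytic_in X (C i r)) \<and>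
     (\<forall>i\<in>X. \<forall>j\<in>X. \<forall>v. (\<Sum>r\<in>R. C i r v * M r j v) = (if i = j then q v else 0))"
  proof (rule analytic_left_inverse[OF finite_X finite_X])
    show "finite R" by (simp add: R_def)
    show "analytic_in X (M r i)" if "r \<in> R" for r i
      using that by (auto simp: R_def M_def intro!: analytic_in_pderivative Lan)
    fix \<delta> i assume z: "\<And>r. r \<in> R \<Longrightarrow> (\<Sum>i\<in>X. \<delta> i * M r i (\<lambda>_. 0)) = 0" and i: "i \<in> X"
    show "\<delta> i = 0"
    proof (rule K[OF _ i])
      fix d k assume "d \<in> D" "k \<le> K"
      then obtain j where "j \<in> {1..P}" "d = e j" using e by blast
      then show "(\<Sum>i\<in>X. \<delta> i * pderivative i ((lie_derivative X field ^^ k) (\<lambda>x. x d)) (\<lambda>_. 0)) = 0"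
        using z[of "(j, k)"] \<open>k \<le> K\<close> by (simp add: R_def M_def)
    qed
  qed
  then obtain q C where q: "analytic_in X q" "q (\<lambda>_. 0) \<noteq> 0"
    and C: "\<And>i r. i \<in> X \<Longrightarrow> r \<in> R \<Longrightarrow> analytic_in X (C i r)"
    and CM: "\<And>i j v. i \<in> X \<Longrightarrow> j \<in> X \<Longrightarrow> (\<Sum>r\<in>R. C i r v * M r j v) = (if i = j then q v else 0)"
    by blast
  have "in_output_span X P field ?h K \<zeta>" if \<zeta>: "meromorphic_in X \<zeta>" for \<zeta>
  proof -
    \<comment> \<open>The row of partial derivatives of \<open>\<zeta>\<close> times the left
      inverse \<open>C / q\<close>.\<close>
    define c where "c = (\<lambda>j l x. \<Sum>i\<in>X. pderivative i \<zeta> x * (inverse (q x) * C i (j, l) x))"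
    have inv: "meromorphic_in X (\<lambda>x. inverse (q x))"
      by (rule meromorphic_inI[of X "\<lambda>_. 1" q "\<lambda>_. 0"]) (auto simp: q finite_X inverse_eq_divide)
    have "meromorphic_in X (c j l)" if "j \<in> {1..P}" "l \<le> K" for j l
      unfolding c_def using that
      by (intro meromorphic_in_sum finite_X meromorphic_in_mult meromorphic_in_pderivative \<zeta> inv
          analytic_imp_meromorphic_in C) (auto simp: R_def)
    moreover have "generically (\<lambda>x. pderivative i \<zeta> x =
       (\<Sum>j=1..P. \<Sum>l\<le>K. c j l x * pderivative i ((lie_derivative X field ^^ l) (?h j)) x))" if i: "i \<in> X" for i
      unfolding eventually_generic_filter[symmetric]
      using eventually_nonzero[OF q(1), OF q(2)]
    proof eventually_elim
      case (elim x)
      have "(\<Sum>j=1..P. \<Sum>l\<le>K. c j l x * pderivative i ((lie_derivative X field ^^ l) (?h j)) x) =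
        (\<Sum>r\<in>R. c (fst r) (snd r) x * M r i x)"
        by (simp add: R_def M_def sum.cartesian_product case_prod_unfold)
      also have "\<dots> = (\<Sum>r\<in>R. \<Sum>l\<in>X. pderivative l \<zeta> x * (inverse (q x) * (C l r x * M r i x)))"
        by (simp add: c_def sum_distrib_right mult.assoc)
      also have "\<dots> = (\<Sum>l\<in>X. pderivative l \<zeta> x * (inverse (q x) * (\<Sum>r\<in>R. C l r x * M r i x)))"
        by (subst sum.swap) (simp add: sum_distrib_left)
      also have "\<dots> = (\<Sum>l\<in>X. if l = i then pderivative i \<zeta> x else 0)"
        using elim i by (intro sum.cong) (auto simp: CM)
      also have "\<dots> = pderivative i \<zeta> x" using i finite_X by (simp add: sum.delta)
      finally show ?case by simp
    qed
    ultimately show ?thesis unfolding in_output_span_def by blast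
  qed
  then show ?thesis unfolding observable_def hidden_element_def by blast
qed

end

section \<open>Strongly connected components\<close>

text \<open>Take an ancestor \<open>u\<close> of \<open>v\<close> with the fewest ancestors. An
  ancestor \<open>w\<close> of \<open>u\<close> has all its ancestors among those of
  \<open>u\<close>, by minimality the same ones, and \<open>u\<close> is one of them.\<close>

lemma ex_initial_vertex:
  assumes X: "finite X" and r: "r \<subseteq> X \<times> X" and v: "v \<in> X"
  obtains u where "u \<in> X" "(u, v) \<in> r\<^sup>*" "\<And>w. (w, u) \<in> r\<^sup>* \<Longrightarrow> (u, w) \<in> r\<^sup>*"
proof -
  define anc where "anc = (\<lambda>u. {w. (w, u) \<in> r\<^sup>*})"
  have anc_X: "anc u \<subseteq> X" if "u \<in> X" for u
  proof
    fix w assume "w \<in> anc u"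
    then have "(w, u) \<in> r\<^sup>*" by (simp add: anc_def)
    then show "w \<in> X" using that r by (cases rule: converse_rtranclE) auto
  qed
  have "finite (anc v)" "anc v \<noteq> {}" using anc_X[OF v] X finite_subset by (auto simp: anc_def)
  then obtain u where u: "u \<in> anc v" "\<And>w. w \<in> anc v \<Longrightarrow> card (anc u) \<le> card (anc w)"
    using ex_is_arg_min_if_finite[of "anc v" "\<lambda>u. card (anc u)"] by (auto simp: is_arg_min_linorder)
  have uX: "u \<in> X" using u anc_X[OF v] by blast
  show thesis
  proof (rule that[OF uX])
    show "(u, v) \<in> r\<^sup>*" using u(1) by (simp add: anc_def)
    fix w assume w: "(w, u) \<in> r\<^sup>*"
    have "anc w \<subseteq> anc u" using w by (auto simp: anc_def)
    moreover have "card (anc u) \<le> card (anc w)"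
      using w u(1) by (intro u(2)) (auto simp: anc_def)
    moreover have "finite (anc u)" using anc_X[OF uX] X finite_subset by blast
    ultimately have "anc w = anc u" by (meson card_seteq)
    moreover have "u \<in> anc u" by (simp add: anc_def)
    ultimately show "(u, w) \<in> r\<^sup>*" by (auto simp: anc_def)
  qed
qed

context pair_fin_digraph
begin

lemma parcs_subset: "parcs G \<subseteq> pverts G \<times> pverts G"
  by (auto dest: in_arcsD1 in_arcsD2)

text \<open>Translates components into plain \<open>rtrancl\<close>. Reachability in the digraph
  also demands that the nodes belong to \<open>G\<close>, which membership in a component
  guarantees.\<close>

lemma verts_scc_eq:
  assumes H: "H \<in> sccs" and u: "u \<in> verts H"
  shows "u \<in> pverts G" "verts H = {w. (u, w) \<in> (parcs G)\<^sup>* \<and> (w, u) \<in> (parcs G)\<^sup>*}"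
proof -
  have S: "verts H \<in> sccs_verts" using H by (intro in_sccs_vertsI_sccs) auto
  then have reach: "\<And>u v. u \<in> verts H \<Longrightarrow> v \<in> verts H \<Longrightarrow> u \<rightarrow>\<^sup>*\<^bsub>with_proj G\<^esub> v"
    and max: "\<And>u v. u \<in> verts H \<Longrightarrow> v \<notin> verts H \<Longrightarrow> \<not> u \<rightarrow>\<^sup>*\<^bsub>with_proj G\<^esub> v \<or> \<not> v \<rightarrow>\<^sup>*\<^bsub>with_proj G\<^esub> u"
    by (auto simp: in_sccs_verts_conv_reachable)
  show uX: "u \<in> pverts G" using reach[OF u u] by (simp add: reachable_conv)
  show "verts H = {w. (u, w) \<in> (parcs G)\<^sup>* \<and> (w, u) \<in> (parcs G)\<^sup>*}"
  proof (intro equalityI subsetI)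
    fix w assume "w \<in> verts H"
    then show "w \<in> {w. (u, w) \<in> (parcs G)\<^sup>* \<and> (w, u) \<in> (parcs G)\<^sup>*}"
      using reach[OF u] reach[OF _ u] by (auto simp: reachable_conv)
  next
    fix w assume w: "w \<in> {w. (u, w) \<in> (parcs G)\<^sup>* \<and> (w, u) \<in> (parcs G)\<^sup>*}"
    then have "u \<rightarrow>\<^sup>*\<^bsub>with_proj G\<^esub> w" using uX by (simp add: reachable_conv')
    moreover from this have "w \<in> pverts G" by (simp add: reachable_conv)
    then have "w \<rightarrow>\<^sup>*\<^bsub>with_proj G\<^esub> u" using w by (simp add: reachable_conv')
    ultimately show "w \<in> verts H" using max[OF u] by blast
  qed
qed

lemma ex_scc:
  assumes u: "u \<in> pverts G" obtains H where "H \<in> sccs" "u \<in> verts H"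
proof -
  have "{w. u \<rightarrow>\<^sup>*\<^bsub>with_proj G\<^esub> w \<and> w \<rightarrow>\<^sup>*\<^bsub>with_proj G\<^esub> u} \<in> sccs_verts"
    unfolding in_sccs_verts_conv_reachable using u by (auto intro: reachable_trans)
  then have "{w. u \<rightarrow>\<^sup>*\<^bsub>with_proj G\<^esub> w \<and> w \<rightarrow>\<^sup>*\<^bsub>with_proj G\<^esub> u} \<in> verts ` sccs"
    by (simp add: sccs_verts_conv)
  then obtain H where "H \<in> sccs" "verts H = {w. u \<rightarrow>\<^sup>*\<^bsub>with_proj G\<^esub> w \<and> w \<rightarrow>\<^sup>*\<^bsub>with_proj G\<^esub> u}" by auto
  then show thesis using that[of H] u by simp
qed

lemma card_sccs_le:
  assumes HH: "HH \<subseteq> sccs" and D: "finite D" "\<And>H. H \<in> HH \<Longrightarrow> verts H \<inter> D \<noteq> {}"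
  shows "card (s ` HH) \<le> card D"
proof -
  have "\<forall>H\<in>HH. \<exists>x. x \<in> verts H \<inter> D" using D(2) by blast
  then obtain t where t: "\<And>H. H \<in> HH \<Longrightarrow> t H \<in> verts H \<inter> D" by metis
  have "inj_on t HH"
  proof (rule inj_onI)
    fix H H' assume *: "H \<in> HH" "H' \<in> HH" "t H = t H'"
    have "t H \<in> verts H" "t H \<in> verts H'" using t[OF *(1)] t[OF *(2)] *(3) by auto
    then have "verts H = verts H'" using verts_scc_eq(2)[of H "t H"] verts_scc_eq(2)[of H' "t H"] * HH by auto
    then show "H = H'" using inj_on_verts_sccs HH * by (meson inj_onD subsetD)
  qed
  moreover have "t ` HH \<subseteq> D" using t by auto
  ultimately have "finite HH" "card HH \<le> card D"
    using D(1) inj_on_finite card_inj_on_le by blast+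
  then show ?thesis using card_image_le le_trans by blast
qed

text \<open>The component of an initial ancestor of \<open>v\<close> has no incoming edge: the
  source of such an edge would be an ancestor of \<open>u\<close>, hence mutually reachable with it.
  All of its nodes reach \<open>v\<close>, so any choice within it is good.\<close>

lemma root_scc_reaches:
  assumes v: "v \<in> pverts G"
  obtains H where "H \<in> root_sccs G" "\<And>u. u \<in> verts H \<Longrightarrow> (u, v) \<in> (parcs G)\<^sup>*"
proof -
  obtain u where u: "u \<in> pverts G" "(u, v) \<in> (parcs G)\<^sup>*" "\<And>w. (w, u) \<in> (parcs G)\<^sup>* \<Longrightarrow> (u, w) \<in> (parcs G)\<^sup>*"
    using ex_initial_vertex[OF pair_finite_verts parcs_subset v] by blast
  obtain H where H: "H \<in> sccs" "u \<in> verts H" using ex_scc[OF u(1)] .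
  note eq = verts_scc_eq(2)[OF H]
  show thesis
  proof (rule that)
    show "H \<in> root_sccs G" unfolding root_sccs_def
      using H(1) u(3) by (auto simp: eq intro: converse_rtrancl_into_rtrancl)
    show "(w, v) \<in> (parcs G)\<^sup>*" if "w \<in> verts H" for w
      using that u(2) by (auto simp: eq)
  qed
qed

text \<open>The argument of \<open>root_scc_reaches\<close> in the reversed graph.\<close>

lemma top_scc_reached:
  assumes v: "v \<in> pverts G"
  obtains H where "H \<in> top_sccs G" "\<And>u. u \<in> verts H \<Longrightarrow> (v, u) \<in> (parcs G)\<^sup>*"
proof -
  have "(parcs G)\<inverse> \<subseteq> pverts G \<times> pverts G" using parcs_subset by auto
  then obtain u where u: "u \<in> pverts G" "(v, u) \<in> (parcs G)\<^sup>*" "\<And>w. (u, w) \<in> (parcs G)\<^sup>* \<Longrightarrow> (w, u) \<in> (parcs G)\<^sup>*"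
    using ex_initial_vertex[OF pair_finite_verts _ v, of "(parcs G)\<inverse>"] by (auto simp: rtrancl_converse)
  obtain H where H: "H \<in> sccs" "u \<in> verts H" using ex_scc[OF u(1)] .
  note eq = verts_scc_eq(2)[OF H]
  show thesis
  proof (rule that)
    show "H \<in> top_sccs G" unfolding top_sccs_def
      using H(1) u(3) by (auto simp: eq intro: rtrancl_into_rtrancl)
    show "(v, w) \<in> (parcs G)\<^sup>*" if "w \<in> verts H" for w
      using that u(2) by (auto simp: eq)
  qed
qed

section \<open>Driver and sensor sets\<close>

lemma ex_polynomial_network:
  obtains n idx where "polynomial_network (pverts G) (parcs G) n idx"
proof -
  obtain idx where "bij_betw idx (pverts G) {0..<card (pverts G)}"
    using ex_bij_betw_finite_nat[OF pair_finite_verts] by blast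
  then have "polynomial_network (pverts G) (parcs G) (\<lambda>j i. card (pverts G) + idx j - idx i) idx"
    using parcs_subset by unfold_locales (auto simp: bij_betw_def pair_finite_verts)
  then show thesis by (rule that)
qed

text \<open>Every node of \<open>D\<close> receives an input of its own, so no two driven nodes
  share an input.\<close>

lemma driver_set_if_reaching:
  assumes D: "D \<subseteq> pverts G" and reach: "\<And>i. i \<in> pverts G \<Longrightarrow> \<exists>d\<in>D. (d, i) \<in> (parcs G)\<^sup>*"
  shows "driver_set G D"
proof -
  obtain n idx where "polynomial_network (pverts G) (parcs G) n idx" by (rule ex_polynomial_network)
  then interpret polynomial_network "pverts G" "parcs G" n idx .
  have finD: "finite D" using D pair_finite_verts finite_subset by blast
  define M where "M = card D"
  obtain e where e: "bij_betw e {1..M} D" using ex_bij_betw_nat_finite_1[OF finD] by (auto simp: M_def)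
  define u where "u = inv_into {1..M} e"
  have u: "bij_betw u D {1..M}" unfolding u_def by (rule bij_betw_inv_into[OF e])
  define f where "f = (\<lambda>i v. network_field (parcs G) n i (\<lambda>j. v (State j)) + (if i \<in> D then v (Input (u i) 0) else 0))"
  define B where "B = {(j, i). i \<in> D \<and> u i = j}"
  have inj: "inj_on (n j) {i. (j, i) \<in> parcs G}" for j
  proof (rule inj_onI, clarify)
    fix i i' assume a: "(j, i) \<in> parcs G" "(j, i') \<in> parcs G" "n j i = n j i'"
    then have "idx i = idx i'" using n_idx[OF a(1)] n_idx[OF a(2)] by simp
    then show "i = i'" using idx_inj parcs_subset a by (auto dest: inj_onD)
  qed
  have uM: "u ` D \<subseteq> {1..M}" using u by (auto simp: bij_betw_def)
  note net = accessible_network[where n=n, OF pair_finite_verts parcs_subset D inj n_pos bij_betw_imp_inj_on[OF u] uM reach f_def]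
  have "structurally_accessible G M B"
    unfolding structurally_accessible_def
    using net by (intro exI[of _ f]) (auto simp: B_def)
  moreover have "B \<subseteq> {1..M} \<times> pverts G" using D uM by (auto simp: B_def)
  ultimately show ?thesis
    unfolding driver_set_def using D by (intro conjI exI[of _ M] exI[of _ B]) (auto simp: B_def)
qed

lemma driver_set_meets_root_scc:
  assumes D: "driver_set G D" and H: "H \<in> root_sccs G"
  shows "verts H \<inter> D \<noteq> {}"
proof
  assume disj: "verts H \<inter> D = {}"
  from H have scc: "H \<in> sccs" and root: "\<And>u v. (u, v) \<in> parcs G \<Longrightarrow> v \<in> verts H \<Longrightarrow> u \<in> verts H"
    by (auto simp: root_sccs_def)
  have sub: "verts H \<subseteq> pverts G" using verts_scc_eq(1)[OF scc] by auto
  obtain x where x: "x \<in> verts H"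
    using scc by (auto simp: sccs_def strongly_connected_def)
  obtain M B where B: "\<And>i. i \<in> pverts G \<Longrightarrow> i \<in> D \<longleftrightarrow> (\<exists>j. (j, i) \<in> B)" and acc: "structurally_accessible G M B"
    using D unfolding driver_set_def by blast
  obtain f :: "'a \<Rightarrow> ('a sys_var \<Rightarrow> real) \<Rightarrow> real"
    where f: "\<And>i. i \<in> pverts G \<Longrightarrow> meromorphic_in (State ` pverts G \<union> (\<lambda>j. Input j 0) ` {1..M}) (f i)"
      "\<And>i j. i \<in> pverts G \<Longrightarrow> j \<in> pverts G \<Longrightarrow> \<not> identically_zero (pderivative (State j) (f i)) \<longleftrightarrow> (j, i) \<in> parcs G"
      "\<And>i j. i \<in> pverts G \<Longrightarrow> j \<in> {1..M} \<Longrightarrow> \<not> identically_zero (pderivative (Input j 0) (f i)) \<longleftrightarrow> (j, i) \<in> B"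
    and a: "accessible (pverts G) M f"
    using acc unfolding structurally_accessible_def by blast
  have "\<not> accessible (pverts G) M f"
  proof (rule not_accessible_if_undriven[OF pair_finite_verts sub x f(1)])
    show "identically_zero (pderivative (State j) (f i))" if "i \<in> verts H" "j \<in> pverts G - verts H" for i j
      using that f(2)[of i j] root[of j i] sub by blast
    show "identically_zero (pderivative (Input j 0) (f i))" if "i \<in> verts H" "j \<in> {1..M}" for i j
      using that f(3)[of i j] B[of i] disj sub by blast
  qed
  with a show False by contradiction
qed

text \<open>Every node of \<open>D\<close> is read directly by an output of its own.\<close>

lemma sensor_set_if_reached:
  assumes D: "D \<subseteq> pverts G" and reach: "\<And>i. i \<in> pverts G \<Longrightarrow> \<exists>d\<in>D. (i, d) \<in> (parcs G)\<^sup>*"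
  shows "sensor_set G D"
proof -
  obtain n idx where "polynomial_network (pverts G) (parcs G) n idx" by (rule ex_polynomial_network)
  then interpret polynomial_network "pverts G" "parcs G" n idx .
  have finD: "finite D" using D pair_finite_verts finite_subset by blast
  define P where "P = card D"
  obtain e where e: "bij_betw e {1..P} D" using ex_bij_betw_nat_finite_1[OF finD] by (auto simp: P_def)
  have eD: "e ` {1..P} = D" by (rule bij_betw_imp_surj_on[OF e])
  define C where "C = {(i, j). j \<in> {1..P} \<and> e j = i}"
  have "structurally_observable G P C"
    unfolding structurally_observable_def
  proof (intro exI[of _ field] exI[of _ "\<lambda>j x. x (e j)"] conjI ballI)
    show "meromorphic_in (pverts G) (field i)" for i
      by (rule analytic_imp_meromorphic_in[OF analytic_in_field])
    show "meromorphic_in (pverts G) (\<lambda>x. x (e j))" if "j \<in> {1..P}" for j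
      using that eD D by (intro analytic_imp_meromorphic_in analytic_in_coord pair_finite_verts) auto
    show "\<not> identically_zero (pderivative j (field i)) \<longleftrightarrow> (j, i) \<in> parcs G" for i j
    proof (cases "(j, i) \<in> parcs G")
      case True
      then show ?thesis
        using identically_zero_network_field_iff[OF pair_finite_arcs, of "\<lambda>j. j" n j i] n_pos by simp
    next
      case False
      then show ?thesis
        using pderivative_network_field[OF pair_finite_arcs, of "\<lambda>j. j" j n i] by (simp add: identically_zero_iff)
    qed
    show "\<not> identically_zero (pderivative i (\<lambda>x. x (e j))) \<longleftrightarrow> (i, j) \<in> C" if "j \<in> {1..P}" for i j
      using that by (auto simp: C_def identically_zero_iff pderivative_coord)
    show "observable (pverts G) P field (\<lambda>j x. x (e j))"
      by (rule observable_network[OF D reach eD])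
  qed
  moreover have "C \<subseteq> pverts G \<times> {1..P}" using D eD by (auto simp: C_def)
  moreover have "i \<in> D \<longleftrightarrow> (\<exists>j. (i, j) \<in> C)" for i using eD by (auto simp: C_def)
  ultimately show ?thesis unfolding sensor_set_def using D by blast
qed

lemma sensor_set_meets_top_scc:
  assumes D: "sensor_set G D" and H: "H \<in> top_sccs G"
  shows "verts H \<inter> D \<noteq> {}"
proof
  assume disj: "verts H \<inter> D = {}"
  from H have scc: "H \<in> sccs" and top: "\<And>u v. (u, v) \<in> parcs G \<Longrightarrow> u \<in> verts H \<Longrightarrow> v \<in> verts H"
    by (auto simp: top_sccs_def)
  have sub: "verts H \<subseteq> pverts G" using verts_scc_eq(1)[OF scc] by auto
  obtain x where x: "x \<in> verts H"
    using scc by (auto simp: sccs_def strongly_connected_def)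
  obtain P C where C: "\<And>i. i \<in> pverts G \<Longrightarrow> i \<in> D \<longleftrightarrow> (\<exists>j. (i, j) \<in> C)" and obs: "structurally_observable G P C"
    using D unfolding sensor_set_def by blast
  obtain f :: "'a \<Rightarrow> ('a \<Rightarrow> real) \<Rightarrow> real" and h :: "nat \<Rightarrow> ('a \<Rightarrow> real) \<Rightarrow> real"
    where f: "\<And>i. i \<in> pverts G \<Longrightarrow> meromorphic_in (pverts G) (f i)"
      "\<And>j. j \<in> {1..P} \<Longrightarrow> meromorphic_in (pverts G) (h j)"
      "\<And>i j. i \<in> pverts G \<Longrightarrow> j \<in> pverts G \<Longrightarrow> \<not> identically_zero (pderivative j (f i)) \<longleftrightarrow> (j, i) \<in> parcs G"
      "\<And>i j. i \<in> pverts G \<Longrightarrow> j \<in> {1..P} \<Longrightarrow> \<not> identically_zero (pderivative i (h j)) \<longleftrightarrow> (i, j) \<in> C"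
    and o: "observable (pverts G) P f h"
    using obs unfolding structurally_observable_def by blast
  have "\<not> observable (pverts G) P f h"
  proof (rule not_observable_if_unsensed[OF pair_finite_verts sub x f(1,2)])
    show "identically_zero (pderivative j (f i))" if "i \<in> pverts G - verts H" "j \<in> verts H" for i j
      using that f(3)[of i j] top[of j i] sub by blast
    show "identically_zero (pderivative i (h j))" if "j \<in> {1..P}" "i \<in> verts H" for i j
      using that f(4)[of i j] C[of i] disj sub by blast
  qed
  with o show False by contradiction
qed

section \<open>Minimality\<close>

lemma minimal_driver_set_root_sccs:
  assumes s: "\<forall>H\<in>root_sccs G. s H \<in> verts H"
  shows "minimal_driver_set G (s ` root_sccs G)"
proof -
  have sub: "root_sccs G \<subseteq> sccs" by (auto simp: root_sccs_def)
  have "driver_set G (s ` root_sccs G)"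
  proof (rule driver_set_if_reaching)
    show "s ` root_sccs G \<subseteq> pverts G" using s verts_scc_eq(1) sub by blast
    show "\<exists>d\<in>s ` root_sccs G. (d, i) \<in> (parcs G)\<^sup>*" if "i \<in> pverts G" for i
      using root_scc_reaches[OF that] s by (metis imageI)
  qed
  moreover have "card (s ` root_sccs G) \<le> card D" if "driver_set G D" for D
  proof (rule card_sccs_le[OF sub])
    show "finite D" using that pair_finite_verts finite_subset unfolding driver_set_def by blast
  qed (rule driver_set_meets_root_scc[OF that])
  ultimately show ?thesis unfolding minimal_driver_set_def by blast
qed

lemma minimal_sensor_set_top_sccs:
  assumes s: "\<forall>H\<in>top_sccs G. s H \<in> verts H"
  shows "minimal_sensor_set G (s ` top_sccs G)"
proof -
  have sub: "top_sccs G \<subseteq> sccs" by (auto simp: top_sccs_def)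
  have "sensor_set G (s ` top_sccs G)"
  proof (rule sensor_set_if_reached)
    show "s ` top_sccs G \<subseteq> pverts G" using s verts_scc_eq(1) sub by blast
    show "\<exists>d\<in>s ` top_sccs G. (i, d) \<in> (parcs G)\<^sup>*" if "i \<in> pverts G" for i
      using top_scc_reached[OF that] s by (metis imageI)
  qed
  moreover have "card (s ` top_sccs G) \<le> card D" if "sensor_set G D" for D
  proof (rule card_sccs_le[OF sub])
    show "finite D" using that pair_finite_verts finite_subset unfolding sensor_set_def by blast
  qed (rule sensor_set_meets_top_scc[OF that])
  ultimately show ?thesis unfolding minimal_sensor_set_def by blast
qed

end

theorem proposition1:
  fixes G :: "'a pair_pre_digraph"
  assumes "pair_fin_digraph G"
  shows "(\<forall>s. (\<forall>H\<in>root_sccs G. s H \<in> verts H) \<longrightarrow> minimal_driver_set G (s ` root_sccs G)) \<and>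
         (\<forall>s. (\<forall>H\<in>top_sccs G. s H \<in> verts H) \<longrightarrow> minimal_sensor_set G (s ` top_sccs G))"
proof -
  interpret pair_fin_digraph G by fact
  show ?thesis using minimal_driver_set_root_sccs minimal_sensor_set_top_sccs by blast
qed

end
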